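(* Let $M$ be an integrably parallelizable manifold. Then the cotangent bundle $T^*M$ admits a Calabi–Yau structure, and (for this structure and the metric it induces on $M$) the Riemannian degenerate special Lagrangian equation on $[0,1]\times M$ governs geodesics in the space of positive graph Lagrangians in $T^*M$.
   Context: Let $n=\dim M$ and $\theta\in(-\pi,\pi]$. **Terms.** A manifold is *integrably parallelizable* if it admits an atlas of charts such that the differentials of the transition maps are the identity. A *Calabi–Yau structure* on a manifold $X$ of real dimension $2n$ is a triple $(J,\omega,\Omega)$ such that $(X,J,\omega)$ is Kähler and $\Omega$ is a nowhere vanishing holomorphic $n$-form. **Space of positive Lagrangians.** Let $L$ be a real $n$-manifold (here $X=T^*M$, $L=M$). $\mathcal L$ is the set of oriented Lagrangian submanifolds of $X$ diffeomorphic to $L$, and $\mathcal L^+_\theta=\{\Gamma\in\mathcal L:\mathrm{Re}(e^{-\sqrt{-1}\theta}\Omega)|_\Gamma>0\}$. $\mathcal O_\theta$ is a connected component of the intersection of $\mathcal L^+_\theta$ with an orbit of the group of compactly supported Hamiltonian diffeomorphisms of $(X,\omega)$. The tangent space $T_\Gamma\mathcal O_\theta$ is identified with $\{h\in C^\infty(\Gamma):\int_\Gamma h\,\mathrm{Re}\,\Omega=0\}$ if $L$ is compact, and with the compactly supported functions on $\Gamma$ if $L$ is non-compact; the metric is $(h,k)_\theta|_\Gamma=\int_\Gamma hk\,\mathrm{Re}(e^{-\sqrt{-1}\theta}\Omega)$. For a path $\Lambda:[0,1]\to\mathcal O_\theta$ and diffeomorphisms $g_t:L\to\Lambda_t$,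 the velocity of $\Lambda$ is the function $h_t$ on $\Lambda_t$, in this tangent space, with $g_t^*\iota_{dg_t/dt}\,\omega=d(h_t\circ g_t)$. Let $\zeta_t$ be the unique vector field on $L$ with $\iota_{\zeta_t}g_t^*\mathrm{Re}(e^{-\sqrt{-1}\theta}\Omega)=-g_t^*\iota_{dg_t/dt}\mathrm{Re}(e^{-\sqrt{-1}\theta}\Omega)$, viewing $g_t$ as a map $L\to X$. The geodesic equation is $$\Big(\frac{\partial}{\partial t}(h_t\circ g_t)+g_t^*dh_t(\zeta_t)\Big)\circ g_t^{-1}=0.$$ **Riemannian degenerate special Lagrangian equation (DSL) of phase $\theta$.** For a Riemannian manifold $M$ and $f\in C^2([0,1]\times M)$, $f_t=f(t,\cdot)$, it is the pair of conditions $$\mathrm{Im}\Big(e^{-\sqrt{-1}\theta}\det\big[I_n+\sqrt{-1}\,\mathrm{Hess}f(\bar v,\bar v)\big]\Big)=0,\qquad \mathrm{Re}\Big(e^{-\sqrt{-1}\theta}\det\big[I+\sqrt{-1}\,\mathrm{Hess}f_t(v,v)\big]\Big)>0,$$ where $v=(v_1,\dots,v_n)$ is any local orthonormal frame on $M$, $\bar v=(\partial_t,v)$, $I_n=\mathrm{diag}(0,1,\dots,1)$ is $(n+1)\times(n+1)$, $I$ is the $n\times n$ identity, and $\mathrm{Hess}f(\bar v,\bar v)$, $\mathrm{Hess}f_t(v,v)$ are the matrices of the Riemannian Hessians $\mathrm{Hess}\,u(V,W)=V(Wu)-(\nabla_VW)u$ for the product metric on $[0,1]\times M$ and for the metric on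 $M$. In the theorem, $M$ carries the (flat) metric induced by the Calabi–Yau structure of $T^*M$. **Meaning of "governs".** For a path of graph Lagrangians $\Lambda_t=\mathrm{graph}(df_t)\subset T^*M$, $f\in C^2([0,1]\times M)$, parametrized by $g_t(p)=(p,df_t|_p)$, the function $h_t$ given by $h_t\circ g_t=-\partial_tf_t$ solves $g_t^*\iota_{dg_t/dt}\omega=d(h_t\circ g_t)$; with this velocity, the geodesic equation for $\Lambda$ is the first (Im) condition of the Riemannian DSL for $f$, and the positivity of the Lagrangians $\Lambda_t$ is the second (Re) condition. *)

theory Defs
  imports "HOL-Analysis.Analysis"
begin

section \<open>Functions of class \<open>C^k\<close>\<close>

text \<open>
  Derivatives are taken within \<open>S\<close>, so that \<open>S\<close> may be an open set or a product
  \<open>[0,1] \<times> U\<close> with \<open>U\<close> open (one-sided derivatives at the end points).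
\<close>

primrec Ck_on ::
  "nat \<Rightarrow> 'e::euclidean_space set \<Rightarrow> ('e \<Rightarrow> 'f::real_normed_vector) \<Rightarrow> bool" where
  "Ck_on 0 S f \<longleftrightarrow> continuous_on S f"
| "Ck_on (Suc k) S f \<longleftrightarrow>
     f differentiable_on S \<and> (\<forall>v. Ck_on k S (\<lambda>x. frechet_derivative f (at x within S) v))"

definition smooth_on :: "'e::euclidean_space set \<Rightarrow> ('e \<Rightarrow> 'f::real_normed_vector) \<Rightarrow> bool" where
  "smooth_on S f \<longleftrightarrow> (\<forall>k. Ck_on k S f)"


section \<open>Smooth manifolds\<close>

text \<open>
  A chart is a pair of a domain and a coordinate map; the values of the map outside the domain
  are irrelevant. A manifold is given by an atlas \<open>A\<close>; the underlying set and the topology are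
  read off from \<open>A\<close>, and \<open>charts A\<close> is the maximal atlas containing \<open>A\<close>.
\<close>

type_synonym ('a, 'e) chart = "'a set \<times> ('a \<Rightarrow> 'e)"

definition inv_chart :: "('a, 'e) chart \<Rightarrow> 'e \<Rightarrow> 'a" where
  "inv_chart c = inv_into (fst c) (snd c)"

definition chart_image :: "('a, 'e) chart \<Rightarrow> 'e set" where
  "chart_image c = snd c ` fst c"

definition is_chart :: "('a, 'e::euclidean_space) chart \<Rightarrow> bool" where
  "is_chart c \<longleftrightarrow> inj_on (snd c) (fst c) \<and> open (chart_image c)"

definition transition :: "('a, 'e) chart \<Rightarrow> ('a, 'e) chart \<Rightarrow> 'e \<Rightarrow> 'e" where
  "transition c c' = snd c' \<circ> inv_chart c"

definition compatible :: "('a, 'e::euclidean_space) chart \<Rightarrow> ('a, 'e) chart \<Rightarrow> bool" where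
  "compatible c c' \<longleftrightarrow>
     open (snd c ` (fst c \<inter> fst c')) \<and> open (snd c' ` (fst c \<inter> fst c')) \<and>
     smooth_on (snd c ` (fst c \<inter> fst c')) (transition c c') \<and>
     smooth_on (snd c' ` (fst c \<inter> fst c')) (transition c' c)"

definition smooth_atlas :: "('a, 'e::euclidean_space) chart set \<Rightarrow> bool" where
  "smooth_atlas A \<longleftrightarrow> (\<forall>c\<in>A. is_chart c) \<and> (\<forall>c\<in>A. \<forall>c'\<in>A. compatible c c')"

definition points :: "('a, 'e) chart set \<Rightarrow> 'a set" where
  "points A = (\<Union>c\<in>A. fst c)"

definition charts :: "('a, 'e::euclidean_space) chart set \<Rightarrow> ('a, 'e) chart set" where
  "charts A = {c. fst c \<subseteq> points A \<and> is_chart c \<and> (\<forall>c'\<in>A. compatible c c')}"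

definition charts_at :: "('a, 'e::euclidean_space) chart set \<Rightarrow> 'a \<Rightarrow> ('a, 'e) chart set" where
  "charts_at A p = {c \<in> charts A. p \<in> fst c}"

definition chart_at :: "('a, 'e::euclidean_space) chart set \<Rightarrow> 'a \<Rightarrow> ('a, 'e) chart" where
  "chart_at A p = (SOME c. c \<in> charts_at A p)"

definition atlas_topology :: "('a, 'e::euclidean_space) chart set \<Rightarrow> 'a topology" where
  "atlas_topology A =
     topology (\<lambda>W. W \<subseteq> points A \<and> (\<forall>c\<in>A. open (snd c ` (W \<inter> fst c))))"

definition second_countable_space :: "'a topology \<Rightarrow> bool" where
  "second_countable_space T \<longleftrightarrow>
     (\<exists>B. countable B \<and> (\<forall>V\<in>B. openin T V) \<and>
          (\<forall>U x. openin T U \<and> x \<in> U \<longrightarrow> (\<exists>V\<in>B. x \<in> V \<and> V \<subseteq> U)))"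

definition smooth_manifold :: "('a, 'e::euclidean_space) chart set \<Rightarrow> bool" where
  "smooth_manifold A \<longleftrightarrow>
     smooth_atlas A \<and> Hausdorff_space (atlas_topology A) \<and> second_countable_space (atlas_topology A)"

definition integrably_parallelizable :: "('a, 'e::euclidean_space) chart set \<Rightarrow> bool" where
  "integrably_parallelizable A \<longleftrightarrow>
     smooth_manifold A \<and>
     (\<exists>B \<subseteq> charts A. points B = points A \<and>
        (\<forall>c\<in>B. \<forall>c'\<in>B. \<forall>x\<in>snd c ` (fst c \<inter> fst c').
            frechet_derivative (transition c c') (at x) = id))"

text \<open>An orientation, given by an oriented atlas.\<close>

definition orientation ::
  "('a, real^'n) chart set \<Rightarrow> ('a, real^'n) chart set \<Rightarrow> bool" where
  "orientation A Or \<longleftrightarrow>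
     Or \<subseteq> charts A \<and> points Or = points A \<and>
     (\<forall>c\<in>Or. \<forall>c'\<in>Or. \<forall>x\<in>snd c ` (fst c \<inter> fst c').
         det (matrix (frechet_derivative (transition c c') (at x))) > 0)"


section \<open>Tangent and cotangent vectors\<close>

text \<open>
  A tangent vector at \<open>p\<close> is the family of its coordinate vectors in all charts around \<open>p\<close>,
  related by the differentials of the transition maps (and \<open>0\<close> at the charts not containing
  \<open>p\<close>, which makes the representation unique).
\<close>

type_synonym ('a, 'e) tvec = "('a, 'e) chart \<Rightarrow> 'e"

definition tangent_space ::
  "('a, 'e::euclidean_space) chart set \<Rightarrow> 'a \<Rightarrow> ('a, 'e) tvec set" where
  "tangent_space A p =
     {X. (\<forall>c. c \<notin> charts_at A p \<longrightarrow> X c = 0) \<and>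
         (\<forall>c\<in>charts_at A p. \<forall>c'\<in>charts_at A p.
             X c' = frechet_derivative (transition c c') (at (snd c p)) (X c))}"

text \<open>The tangent vector at \<open>p\<close> whose coordinate vector in the chart \<open>c\<close> is \<open>u\<close>.\<close>

definition coord_vec ::
  "('a, 'e::euclidean_space) chart set \<Rightarrow> ('a, 'e) chart \<Rightarrow> 'a \<Rightarrow> 'e \<Rightarrow> ('a, 'e) tvec" where
  "coord_vec A c p u =
     (\<lambda>c'. if c' \<in> charts_at A p
           then frechet_derivative (transition c c') (at (snd c p)) u else 0)"

definition lincomb ::
  "real \<Rightarrow> ('a, 'e::real_vector) tvec \<Rightarrow> real \<Rightarrow> ('a, 'e) tvec \<Rightarrow> ('a, 'e) tvec" where
  "lincomb a X b Y = (\<lambda>c. a *\<^sub>R X c + b *\<^sub>R Y c)"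

text \<open>The dual space of the tangent space (functionals are \<open>0\<close> off the tangent space).\<close>

definition cotangent_space ::
  "('a, 'e::euclidean_space) chart set \<Rightarrow> 'a \<Rightarrow> (('a, 'e) tvec \<Rightarrow> real) set" where
  "cotangent_space A p =
     {xi. (\<forall>X. X \<notin> tangent_space A p \<longrightarrow> xi X = 0) \<and>
          (\<forall>X\<in>tangent_space A p. \<forall>Y\<in>tangent_space A p. \<forall>a b.
              xi (lincomb a X b Y) = a * xi X + b * xi Y)}"

definition differential ::
  "('a, 'e::euclidean_space) chart set \<Rightarrow> ('a \<Rightarrow> real) \<Rightarrow> 'a \<Rightarrow> ('a, 'e) tvec \<Rightarrow> real" where
  "differential A u p =
     (\<lambda>X. if X \<in> tangent_space A p
          then let c = chart_at A p
               in frechet_derivative (u \<circ> inv_chart c) (at (snd c p)) (X c)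
          else 0)"

definition pushforward ::
  "('a, 'e::euclidean_space) chart set \<Rightarrow> ('b, 'f::euclidean_space) chart set \<Rightarrow>
   ('a \<Rightarrow> 'b) \<Rightarrow> 'a \<Rightarrow> ('a, 'e) tvec \<Rightarrow> ('b, 'f) tvec" where
  "pushforward A X g p v =
     (\<lambda>C. if C \<in> charts_at X (g p)
          then let c = chart_at A p
               in frechet_derivative (snd C \<circ> g \<circ> inv_chart c) (at (snd c p)) (v c)
          else 0)"

text \<open>Velocity vector of a curve \<open>[0,1] \<rightarrow> X\<close>.\<close>

definition curve_velocity ::
  "('b, 'f::euclidean_space) chart set \<Rightarrow> (real \<Rightarrow> 'b) \<Rightarrow> real \<Rightarrow> ('b, 'f) tvec" where
  "curve_velocity X \<gamma> t =
     (\<lambda>C. if C \<in> charts_at X (\<gamma> t)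
          then vector_derivative (\<lambda>s. snd C (\<gamma> s)) (at t within {0..1}) else 0)"


section \<open>The cotangent bundle\<close>

text \<open>
  The chart of the cotangent bundle induced by a chart \<open>(x\<^sub>1, \<dots>, x\<^sub>n)\<close> of the base has the
  coordinates \<open>(x, y)\<close>, where \<open>y\<close> are the components of the covector. The model space
  \<open>\<real>\<^sup>2\<^sup>n\<close> is \<^typ>\<open>complex^'n\<close>, regarded as a real vector space, with
  \<open>(x, y)\<close> written as \<open>x + \<i>y\<close>. Smoothness always refers to real derivatives.
\<close>

type_synonym ('a, 'n) cotangent_point = "'a \<times> (('a, real^'n) tvec \<Rightarrow> real)"

definition cotangent_chart ::
  "('a, real^'n) chart set \<Rightarrow> ('a, real^'n) chart \<Rightarrow>
   (('a, 'n) cotangent_point, complex^'n) chart" where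
  "cotangent_chart A c =
     ({(p, xi). p \<in> fst c \<and> xi \<in> cotangent_space A p},
      \<lambda>(p, xi). \<chi> k. Complex (snd c p $ k) (xi (coord_vec A c p (axis k 1))))"

definition cotangent_bundle ::
  "('a, real^'n) chart set \<Rightarrow> (('a, 'n) cotangent_point, complex^'n) chart set" where
  "cotangent_bundle A = cotangent_chart A ` charts A"


section \<open>Calabi--Yau structures on manifolds of real dimension \<open>2n\<close>\<close>

type_synonym ('b, 'f) endo_field = "'b \<Rightarrow> ('b, 'f) tvec \<Rightarrow> ('b, 'f) tvec"
type_synonym ('b, 'f) two_form = "'b \<Rightarrow> ('b, 'f) tvec \<Rightarrow> ('b, 'f) tvec \<Rightarrow> real"
type_synonym ('b, 'f, 'n) complex_n_form = "'b \<Rightarrow> ('n \<Rightarrow> ('b, 'f) tvec) \<Rightarrow> complex"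

definition almost_complex ::
  "('b, 'f::euclidean_space) chart set \<Rightarrow> ('b, 'f) endo_field \<Rightarrow> bool" where
  "almost_complex X J \<longleftrightarrow>
     (\<forall>p\<in>points X. \<forall>u\<in>tangent_space X p.
        J p u \<in> tangent_space X p \<and> J p (J p u) = (\<lambda>c. - u c) \<and>
        (\<forall>v\<in>tangent_space X p. \<forall>a b. J p (lincomb a u b v) = lincomb a (J p u) b (J p v)))"

definition holomorphic_chart ::
  "('b, complex^'n) chart set \<Rightarrow> ('b, complex^'n) endo_field \<Rightarrow> ('b, complex^'n) chart \<Rightarrow> bool"
  where
  "holomorphic_chart X J c \<longleftrightarrow>
     c \<in> charts X \<and> (\<forall>p\<in>fst c. \<forall>u\<in>tangent_space X p. J p u c = \<i> *s u c)"

text \<open>Smoothness of \<open>J\<close> is a consequence of the existence of holomorphic coordinates.\<close>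

definition complex_structure ::
  "('b, complex^'n) chart set \<Rightarrow> ('b, complex^'n) endo_field \<Rightarrow> bool" where
  "complex_structure X J \<longleftrightarrow>
     almost_complex X J \<and> (\<forall>p\<in>points X. \<exists>c. p \<in> fst c \<and> holomorphic_chart X J c)"

definition form_coords ::
  "('b, 'f::euclidean_space) chart set \<Rightarrow> ('b, 'f) two_form \<Rightarrow> ('b, 'f) chart \<Rightarrow>
   'f \<Rightarrow> 'f \<Rightarrow> 'f \<Rightarrow> real" where
  "form_coords X \<omega> c x u v =
     (let p = inv_chart c x in \<omega> p (coord_vec X c p u) (coord_vec X c p v))"

text \<open>
  The last condition is the vanishing of \<open>d\<omega>\<close> on constant coordinate fields. As smoothness and
  closedness do not depend on the coordinates, they are tested in one chart around each point.
\<close>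

definition closed_two_form ::
  "('b, 'f::euclidean_space) chart set \<Rightarrow> ('b, 'f) two_form \<Rightarrow> bool" where
  "closed_two_form X \<omega> \<longleftrightarrow>
     (\<forall>p\<in>points X. \<forall>u\<in>tangent_space X p. \<omega> p u u = 0 \<and>
        (\<forall>v\<in>tangent_space X p. \<forall>w\<in>tangent_space X p. \<forall>a b.
           \<omega> p (lincomb a u b v) w = a * \<omega> p u w + b * \<omega> p v w \<and>
           \<omega> p w (lincomb a u b v) = a * \<omega> p w u + b * \<omega> p w v)) \<and>
     (\<forall>p\<in>points X. \<exists>c\<in>charts_at X p.
        (\<forall>u v. smooth_on (chart_image c) (\<lambda>x. form_coords X \<omega> c x u v)) \<and>
        (\<forall>x\<in>chart_image c. \<forall>u v w.
            frechet_derivative (\<lambda>y. form_coords X \<omega> c y v w) (at x) u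
          - frechet_derivative (\<lambda>y. form_coords X \<omega> c y u w) (at x) v
          + frechet_derivative (\<lambda>y. form_coords X \<omega> c y u v) (at x) w = 0))"

definition kaehler ::
  "('b, complex^'n) chart set \<Rightarrow> ('b, complex^'n) endo_field \<Rightarrow> ('b, complex^'n) two_form \<Rightarrow> bool"
  where
  "kaehler X J \<omega> \<longleftrightarrow>
     complex_structure X J \<and> closed_two_form X \<omega> \<and>
     (\<forall>p\<in>points X. \<forall>u\<in>tangent_space X p.
        (u \<noteq> (\<lambda>_. 0) \<longrightarrow> \<omega> p u (J p u) > 0) \<and>
        (\<forall>v\<in>tangent_space X p. \<omega> p (J p u) (J p v) = \<omega> p u v))"

definition holomorphic_function_on :: "(complex^'n) set \<Rightarrow> (complex^'n \<Rightarrow> complex) \<Rightarrow> bool" where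
  "holomorphic_function_on S F \<longleftrightarrow>
     (\<forall>z\<in>S. F differentiable (at z) \<and>
        (\<forall>u. frechet_derivative F (at z) (\<i> *s u) = \<i> * frechet_derivative F (at z) u))"

text \<open>
  Locally \<open>\<Omega> = F dz\<^sub>1 \<and> \<dots> \<and> dz\<^sub>n\<close> with \<open>F\<close> holomorphic; the value of
  \<open>dz\<^sub>1 \<and> \<dots> \<and> dz\<^sub>n\<close> on \<open>v\<^sub>1, \<dots>, v\<^sub>n\<close> is the determinant of \<open>dz\<^sub>j(v\<^sub>k)\<close>.
\<close>

definition holomorphic_n_form ::
  "('b, complex^'n) chart set \<Rightarrow> ('b, complex^'n) endo_field \<Rightarrow>
   ('b, complex^'n, 'n) complex_n_form \<Rightarrow> bool" where
  "holomorphic_n_form X J \<Omega> \<longleftrightarrow>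
     (\<forall>p\<in>points X. \<exists>c F. p \<in> fst c \<and> holomorphic_chart X J c \<and>
        holomorphic_function_on (chart_image c) F \<and>
        (\<forall>q\<in>fst c. \<forall>v. (\<forall>k. v k \<in> tangent_space X q) \<longrightarrow>
            \<Omega> q v = F (snd c q) * det (\<chi> j k. v k c $ j)))"

definition calabi_yau ::
  "('b, complex^'n) chart set \<Rightarrow> ('b, complex^'n) endo_field \<Rightarrow> ('b, complex^'n) two_form \<Rightarrow>
   ('b, complex^'n, 'n) complex_n_form \<Rightarrow> bool" where
  "calabi_yau X J \<omega> \<Omega> \<longleftrightarrow>
     kaehler X J \<omega> \<and> holomorphic_n_form X J \<Omega> \<and>
     (\<forall>p\<in>points X. \<exists>v. (\<forall>k. v k \<in> tangent_space X p) \<and> \<Omega> p v \<noteq> 0)"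


section \<open>Positive Lagrangians and the geodesic equation\<close>

definition C1_map ::
  "('a, 'e::euclidean_space) chart set \<Rightarrow> ('b, 'f::euclidean_space) chart set \<Rightarrow> ('a \<Rightarrow> 'b) \<Rightarrow> bool"
  where
  "C1_map A X g \<longleftrightarrow>
     (\<forall>p\<in>points A. \<exists>c\<in>charts_at A p. \<exists>C\<in>charts_at X (g p).
        g ` fst c \<subseteq> fst C \<and> Ck_on 1 (chart_image c) (snd C \<circ> g \<circ> inv_chart c))"

definition lagrangian_embedding ::
  "('a, real^'n) chart set \<Rightarrow> ('b, complex^'n) chart set \<Rightarrow> ('b, complex^'n) two_form \<Rightarrow>
   ('a \<Rightarrow> 'b) \<Rightarrow> bool" where
  "lagrangian_embedding A X \<omega> g \<longleftrightarrow>
     C1_map A X g \<and> embedding_map (atlas_topology A) (atlas_topology X) g \<and>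
     (\<forall>p\<in>points A. inj_on (pushforward A X g p) (tangent_space A p) \<and>
        (\<forall>u\<in>tangent_space A p. \<forall>v\<in>tangent_space A p.
            \<omega> (g p) (pushforward A X g p u) (pushforward A X g p v) = 0))"

text \<open>
  Positivity of the submanifold parametrized by \<open>g\<close>, which carries the orientation transported
  from \<open>Or\<close> by \<open>g\<close>.
\<close>

definition positive_of_phase ::
  "('a, real^'n) chart set \<Rightarrow> ('a, real^'n) chart set \<Rightarrow> ('b, complex^'n) chart set \<Rightarrow>
   ('b, complex^'n, 'n) complex_n_form \<Rightarrow> real \<Rightarrow> ('a \<Rightarrow> 'b) \<Rightarrow> bool" where
  "positive_of_phase A Or X \<Omega> \<theta> g \<longleftrightarrow>
     (\<forall>p\<in>points A. \<forall>v. (\<forall>k. v k \<in> tangent_space A p) \<and>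
        (\<exists>c\<in>Or. p \<in> fst c \<and> det (\<chi> j k. v k c $ j) > 0) \<longrightarrow>
        Re (exp (- \<i> * of_real \<theta>) * \<Omega> (g p) (\<lambda>k. pushforward A X g p (v k))) > 0)"

text \<open>\<open>g\<^sub>t\<^sup>* \<iota>(dg\<^sub>t/dt) \<omega> = d(h\<^sub>t \<circ> g\<^sub>t)\<close> for all \<open>t\<close>\<close>

definition velocity_equation ::
  "('a, real^'n) chart set \<Rightarrow> ('b, complex^'n) chart set \<Rightarrow> ('b, complex^'n) two_form \<Rightarrow>
   (real \<Rightarrow> 'a \<Rightarrow> 'b) \<Rightarrow> (real \<Rightarrow> 'b \<Rightarrow> real) \<Rightarrow> bool" where
  "velocity_equation A X \<omega> g h \<longleftrightarrow>
     (\<forall>t\<in>{0..1}. \<forall>p\<in>points A. \<forall>v\<in>tangent_space A p.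
        \<omega> (g t p) (curve_velocity X (\<lambda>s. g s p) t) (pushforward A X (g t) p v)
          = differential A (h t \<circ> g t) p v)"

text \<open>
  The vector field \<open>\<zeta>\<^sub>t\<close>. The equation between \<open>(n-1)\<close>-forms is tested by inserting the
  contracted vector in the slot \<open>k\<close>; since \<open>\<Omega>\<close> is alternating, the position of the slot
  does not matter.
\<close>

definition zeta ::
  "('a, real^'n) chart set \<Rightarrow> ('b, complex^'n) chart set \<Rightarrow>
   ('b, complex^'n, 'n) complex_n_form \<Rightarrow> real \<Rightarrow> (real \<Rightarrow> 'a \<Rightarrow> 'b) \<Rightarrow>
   real \<Rightarrow> 'a \<Rightarrow> ('a, real^'n) tvec" where
  "zeta A X \<Omega> \<theta> g t p =
     (THE z. z \<in> tangent_space A p \<and>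
        (\<forall>v k. (\<forall>i. v i \<in> tangent_space A p) \<longrightarrow>
           Re (exp (- \<i> * of_real \<theta>) *
               \<Omega> (g t p) (\<lambda>i. pushforward A X (g t) p ((v(k := z)) i)))
           = - Re (exp (- \<i> * of_real \<theta>) *
               \<Omega> (g t p) ((\<lambda>i. pushforward A X (g t) p (v i))
                          (k := curve_velocity X (\<lambda>s. g s p) t)))))"

text \<open>
  As \<open>h\<^sub>t\<close> is defined on \<open>\<Lambda>\<^sub>t = g\<^sub>t(L)\<close> only, \<open>g\<^sub>t\<^sup>* dh\<^sub>t\<close> is read as \<open>d(h\<^sub>t \<circ> g\<^sub>t)\<close>.
\<close>

definition geodesic_equation ::
  "('a, real^'n) chart set \<Rightarrow> ('b, complex^'n) chart set \<Rightarrow>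
   ('b, complex^'n, 'n) complex_n_form \<Rightarrow> real \<Rightarrow> (real \<Rightarrow> 'a \<Rightarrow> 'b) \<Rightarrow>
   (real \<Rightarrow> 'b \<Rightarrow> real) \<Rightarrow> bool" where
  "geodesic_equation A X \<Omega> \<theta> g h \<longleftrightarrow>
     (\<forall>t\<in>{0..1}. \<forall>q\<in>g t ` points A.
        let p = inv_into (points A) (g t) q in
          vector_derivative (\<lambda>s. h s (g s p)) (at t within {0..1})
          + differential A (h t \<circ> g t) p (zeta A X \<Omega> \<theta> g t p) = 0)"


section \<open>The Riemannian Hessian\<close>

type_synonym ('a, 'e) metric = "'a \<Rightarrow> ('a, 'e) tvec \<Rightarrow> ('a, 'e) tvec \<Rightarrow> real"

text \<open>
  Computations in a coordinate domain \<open>S\<close> (open, or \<open>[0,1]\<close> times an open set) carrying a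
  metric \<open>G\<close>: the Levi-Civita connection is \<open>\<nabla>\<^sub>V W = DW(V) + \<Gamma>(V, W)\<close>, with the Christoffel
  symbol \<open>\<Gamma>\<close> given by the Koszul formula for constant fields.
\<close>

definition dir_deriv ::
  "'e::euclidean_space set \<Rightarrow> ('e \<Rightarrow> 'e) \<Rightarrow> ('e \<Rightarrow> 'f::real_normed_vector) \<Rightarrow> 'e \<Rightarrow> 'f" where
  "dir_deriv S V u x = frechet_derivative u (at x within S) (V x)"

definition christoffel ::
  "'e::euclidean_space set \<Rightarrow> ('e \<Rightarrow> 'e \<Rightarrow> 'e \<Rightarrow> real) \<Rightarrow> 'e \<Rightarrow> 'e \<Rightarrow> 'e \<Rightarrow> 'e" where
  "christoffel S G x v w =
     (THE y. \<forall>z. 2 * G x y z =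
          dir_deriv S (\<lambda>_. v) (\<lambda>x'. G x' w z) x
        + dir_deriv S (\<lambda>_. w) (\<lambda>x'. G x' v z) x
        - dir_deriv S (\<lambda>_. z) (\<lambda>x'. G x' v w) x)"

definition levi_civita ::
  "'e::euclidean_space set \<Rightarrow> ('e \<Rightarrow> 'e \<Rightarrow> 'e \<Rightarrow> real) \<Rightarrow> ('e \<Rightarrow> 'e) \<Rightarrow> ('e \<Rightarrow> 'e) \<Rightarrow> 'e \<Rightarrow> 'e" where
  "levi_civita S G V W x = dir_deriv S V W x + christoffel S G x (V x) (W x)"

definition hessian_coords ::
  "'e::euclidean_space set \<Rightarrow> ('e \<Rightarrow> 'e \<Rightarrow> 'e \<Rightarrow> real) \<Rightarrow> ('e \<Rightarrow> real) \<Rightarrow>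
   ('e \<Rightarrow> 'e) \<Rightarrow> ('e \<Rightarrow> 'e) \<Rightarrow> 'e \<Rightarrow> real" where
  "hessian_coords S G u V W x =
     dir_deriv S V (dir_deriv S W u) x - dir_deriv S (levi_civita S G V W) u x"

definition hessian ::
  "('a, 'e::euclidean_space) chart set \<Rightarrow> ('a, 'e) metric \<Rightarrow> ('a \<Rightarrow> real) \<Rightarrow>
   ('a \<Rightarrow> ('a, 'e) tvec) \<Rightarrow> ('a \<Rightarrow> ('a, 'e) tvec) \<Rightarrow> 'a \<Rightarrow> real" where
  "hessian A g u V W p =
     (let c = chart_at A p in
      hessian_coords (chart_image c) (form_coords A g c) (u \<circ> inv_chart c)
        (\<lambda>x. V (inv_chart c x) c) (\<lambda>x. W (inv_chart c x) c) (snd c p))"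

text \<open>
  The Hessian on \<open>[0,1] \<times> M\<close> for the product metric. A tangent vector of the product is a pair
  of a number (the component along \<open>\<partial>\<^sub>t\<close>) and a tangent vector of \<open>M\<close>.
\<close>

definition product_hessian ::
  "('a, 'e::euclidean_space) chart set \<Rightarrow> ('a, 'e) metric \<Rightarrow> (real \<Rightarrow> 'a \<Rightarrow> real) \<Rightarrow>
   (real \<Rightarrow> 'a \<Rightarrow> real \<times> ('a, 'e) tvec) \<Rightarrow> (real \<Rightarrow> 'a \<Rightarrow> real \<times> ('a, 'e) tvec) \<Rightarrow>
   real \<Rightarrow> 'a \<Rightarrow> real" where
  "product_hessian A g f V W t p =
     (let c = chart_at A p;
          coords = (\<lambda>U (s, x). (fst (U s (inv_chart c x)), snd (U s (inv_chart c x)) c))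
      in hessian_coords ({0..1} \<times> chart_image c)
           (\<lambda>(s, x) (a, u) (b, v). a * b + form_coords A g c x u v)
           (\<lambda>(s, x). f s (inv_chart c x)) (coords V) (coords W) (t, snd c p))"


section \<open>The Riemannian degenerate special Lagrangian equation\<close>

definition orthonormal_frame ::
  "('a, real^'n) chart set \<Rightarrow> ('a, real^'n) metric \<Rightarrow> 'a set \<Rightarrow>
   ('n \<Rightarrow> 'a \<Rightarrow> ('a, real^'n) tvec) \<Rightarrow> bool" where
  "orthonormal_frame A g U v \<longleftrightarrow>
     openin (atlas_topology A) U \<and>
     (\<forall>p\<in>U. \<forall>i. v i p \<in> tangent_space A p) \<and>
     (\<forall>p\<in>U. \<forall>i j. g p (v i p) (v j p) = (if i = j then 1 else 0)) \<and>
     (\<forall>c\<in>charts A. \<forall>i. smooth_on (snd c ` (U \<inter> fst c)) (\<lambda>x. v i (inv_chart c x) c))"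

text \<open>The frame \<open>(\<partial>\<^sub>t, v)\<close>; the index \<^const>\<open>None\<close> stands for the direction \<open>\<partial>\<^sub>t\<close>.\<close>

definition product_frame ::
  "('n \<Rightarrow> 'a \<Rightarrow> ('a, 'e::zero) tvec) \<Rightarrow> 'n option \<Rightarrow> real \<Rightarrow> 'a \<Rightarrow> real \<times> ('a, 'e) tvec" where
  "product_frame v a t p = (case a of None \<Rightarrow> (1, \<lambda>_. 0) | Some i \<Rightarrow> (0, v i p))"

definition DSL_Im ::
  "('a, real^'n) chart set \<Rightarrow> ('a, real^'n) metric \<Rightarrow> real \<Rightarrow> (real \<Rightarrow> 'a \<Rightarrow> real) \<Rightarrow> bool" where
  "DSL_Im A g \<theta> f \<longleftrightarrow>
     (\<forall>U v. orthonormal_frame A g U v \<longrightarrow> (\<forall>t\<in>{0..1}. \<forall>p\<in>U.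
        Im (exp (- \<i> * of_real \<theta>) *
            det (\<chi> a b. (if a = b \<and> a \<noteq> None then 1 else 0) +
                   \<i> * of_real (product_hessian A g f (product_frame v a) (product_frame v b) t p)))
        = 0))"

definition DSL_Re ::
  "('a, real^'n) chart set \<Rightarrow> ('a, real^'n) metric \<Rightarrow> real \<Rightarrow> (real \<Rightarrow> 'a \<Rightarrow> real) \<Rightarrow> bool" where
  "DSL_Re A g \<theta> f \<longleftrightarrow>
     (\<forall>U v. orthonormal_frame A g U v \<longrightarrow> (\<forall>t\<in>{0..1}. \<forall>p\<in>U.
        Re (exp (- \<i> * of_real \<theta>) *
            det (\<chi> i j. (if i = j then 1 else 0) +
                   \<i> * of_real (hessian A g (f t) (v i) (v j) p)))
        > 0))"


section \<open>Graphs in the cotangent bundle\<close>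

text \<open>The pullback of the metric \<open>\<omega>(\<cdot>, J\<cdot>)\<close> of the cotangent bundle by the zero section.\<close>

definition zero_section :: "'a \<Rightarrow> ('a, 'n::finite) cotangent_point" where
  "zero_section p = (p, \<lambda>_. 0)"

definition induced_metric ::
  "('a, real^'n) chart set \<Rightarrow>
   (('a, 'n) cotangent_point, complex^'n) endo_field \<Rightarrow>
   (('a, 'n) cotangent_point, complex^'n) two_form \<Rightarrow> ('a, real^'n) metric" where
  "induced_metric A J \<omega> p u v =
     (let X = cotangent_bundle A; d = pushforward A X zero_section p
      in \<omega> (zero_section p) (d u) (J (zero_section p) (d v)))"

definition flat_metric :: "('a, 'e::euclidean_space) chart set \<Rightarrow> ('a, 'e) metric \<Rightarrow> bool" where
  "flat_metric A g \<longleftrightarrow>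
     (\<forall>p\<in>points A. \<exists>c\<in>charts_at A p. \<forall>q\<in>fst c.
        \<forall>u\<in>tangent_space A q. \<forall>v\<in>tangent_space A q. g q u v = u c \<bullet> v c)"

definition C2_on_product :: "('a, 'e::euclidean_space) chart set \<Rightarrow> (real \<Rightarrow> 'a \<Rightarrow> real) \<Rightarrow> bool"
  where
  "C2_on_product A f \<longleftrightarrow>
     (\<forall>c\<in>charts A. Ck_on 2 ({0..1} \<times> chart_image c) (\<lambda>(t, x). f t (inv_chart c x)))"

definition time_deriv :: "(real \<Rightarrow> 'a \<Rightarrow> real) \<Rightarrow> real \<Rightarrow> 'a \<Rightarrow> real" where
  "time_deriv f t p = vector_derivative (\<lambda>s. f s p) (at t within {0..1})"

definition graph_path ::
  "('a, real^'n) chart set \<Rightarrow> (real \<Rightarrow> 'a \<Rightarrow> real) \<Rightarrow> real \<Rightarrow> 'a \<Rightarrow> ('a, 'n) cotangent_point" where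
  "graph_path A f t p = (p, differential A (f t) p)"

end

theory Submission
  imports Defs
begin

text \<open>
  In the charts of a parallelizing atlas the transition maps of \<open>M\<close> have differential \<open>id\<close>, so the
  induced charts \<open>x + \<i>y\<close> of the cotangent bundle also have transition maps with differential \<open>id\<close>.
  The standard \<open>J\<close>, \<open>\<omega> = dx \<and> dy\<close> and \<open>\<Omega> = dz\<^sub>1 \<and> \<dots> \<and> dz\<^sub>n\<close> of \<open>\<complex>\<^sup>n\<close> are therefore well
  defined, and the induced metric is flat.

  With \<open>H\<close> the Hessian of \<open>f\<^sub>t\<close> in such a chart and \<open>K = I + \<i>H\<close>, the differential of the graph
  parametrization is \<open>v \<mapsto> K v\<close>, so \<open>\<Omega>\<close> pulls back to \<open>det K\<close> times the volume form, which gives the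
  positivity condition. If \<open>K y = \<i> a\<close> with \<open>a\<close> the mixed derivatives \<open>\<partial>\<^sub>t \<partial>\<^sub>k f\<close> and
  \<open>\<kappa> = e\<^sup>-\<^sup>\<i>\<^sup>\<theta> det K\<close>, then \<open>\<zeta> = - Re (\<kappa> y) / Re \<kappa>\<close>, and both the geodesic equation and the
  imaginary part of the bordered determinant \<open>\<i> (\<partial>\<^sub>t\<^sup>2 f - a \<bullet> y) det K\<close> say that
  \<open>\<partial>\<^sub>t\<^sup>2 f Re \<kappa> = a \<bullet> Re (\<kappa> y)\<close>.
\<close>

section \<open>Functions of class \<open>C\<^sup>k\<close>\<close>

text \<open>The determinant identity is short; the work lies in reaching flat coordinates.
  \<open>hessian\<close>, \<open>differential\<close> and \<open>pushforward\<close> are computed in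
  \<open>chart_at\<close>, an arbitrary member of the maximal atlas, where the metric need not be
  Euclidean and the frame fields vary. There the metric is the pullback of the Euclidean one by the
  transition map to a flat chart, and its Christoffel symbol is governed by the second derivative of
  that map. This cancels exactly the second order term of the chain rule, so plain second
  derivatives of f in the flat chart remain. The other obstacle is the boundary of the time
  interval: f is only C^2 on [0,1] x U, derivatives are one-sided at t = 0 and t = 1, and symmetry
  of second derivatives is proved in the interior and extended by continuity. That symmetry makes
  graphs Lagrangian and matches the fibre velocity with the differential of the time derivative of
  f. Positivity makes K invertible and permits division by \<open>Re \<kappa>\<close>; without it
  neither y nor the vector field \<zeta> is available, hence it precedes the comparison of the two
  equations.\<close>

lemma frechet_derivative_within_cong:
  assumes "\<And>y. y \<in> S \<Longrightarrow> f y = g y" and "x \<in> S"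
  shows "frechet_derivative f (at x within S) = frechet_derivative g (at x within S)"
proof -
  have "(f has_derivative D) (at x within S) \<longleftrightarrow> (g has_derivative D) (at x within S)" for D
    using has_derivative_transform[OF assms(2), of g f D] has_derivative_transform[OF assms(2), of f g D] assms
    by auto
  then show ?thesis by (simp add: frechet_derivative_def)
qed

lemma differentiable_on_cong:
  assumes "\<And>y. y \<in> S \<Longrightarrow> f y = g y"
  shows "f differentiable_on S \<longleftrightarrow> g differentiable_on S"
  using assms unfolding differentiable_on_def
  by (metis differentiable_transform_within zero_less_one)

lemma Ck_on_cong:
  assumes "\<And>y. y \<in> S \<Longrightarrow> f y = g y"
  shows "Ck_on k S f \<longleftrightarrow> Ck_on k S g"
  using assms
proof (induction k arbitrary: f g)
  case 0
  then show ?case by (simp cong: continuous_on_cong)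
next
  case (Suc k)
  have "Ck_on k S (\<lambda>x. frechet_derivative f (at x within S) v)
    \<longleftrightarrow> Ck_on k S (\<lambda>x. frechet_derivative g (at x within S) v)" for v
    by (intro Suc.IH) (simp add: frechet_derivative_within_cong[of S f g] Suc.prems)
  then show ?case using differentiable_on_cong[of S f g] Suc.prems by simp
qed

lemma Ck_on_imp_continuous_on: "Ck_on k S f \<Longrightarrow> continuous_on S f"
  by (cases k) (auto simp: differentiable_imp_continuous_on)

lemma Ck_on_decrease: "Ck_on (Suc k) S f \<Longrightarrow> Ck_on k S f"
  by (induction k arbitrary: f) (auto simp: differentiable_imp_continuous_on)

text \<open>Induction on k: at the points of an open \<open>T\<close> inside the open
  \<open>S\<close>, derivatives within \<open>T\<close> and within \<open>S\<close> coincide, so the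
  local hypotheses pass to the derivatives. It allows smoothness of transition maps to be checked
  near one point at a time.\<close>

lemma Ck_on_local:
  assumes "open S" "\<And>x. x \<in> S \<Longrightarrow> \<exists>T. open T \<and> x \<in> T \<and> T \<subseteq> S \<and> Ck_on k T f"
  shows "Ck_on k S f"
  using assms(2)
proof (induction k arbitrary: f)
  case 0
  have "continuous (at x) f" if "x \<in> S" for x
    using 0[OF that] continuous_on_eq_continuous_at by auto
  then show ?case by (simp add: continuous_at_imp_continuous_on)
next
  case (Suc k)
  have "f differentiable (at x within S)" if "x \<in> S" for x
    using Suc.prems[OF that] that \<open>open S\<close>
    by (metis Ck_on.simps(2) at_within_open differentiable_on_def)
  moreover have "Ck_on k S (\<lambda>x. frechet_derivative f (at x within S) v)" for v
  proof (rule Suc.IH)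
    fix x assume "x \<in> S"
    from Suc.prems[OF this] obtain T where T: "open T" "x \<in> T" "T \<subseteq> S" "Ck_on (Suc k) T f" by auto
    have "Ck_on k T (\<lambda>x. frechet_derivative f (at x within T) v)" using T by simp
    then have "Ck_on k T (\<lambda>x. frechet_derivative f (at x within S) v)"
      by (rule Ck_on_cong[THEN iffD1, rotated])
        (use T \<open>open S\<close> in \<open>metis at_within_open subsetD\<close>)
    then show "\<exists>T. open T \<and> x \<in> T \<and> T \<subseteq> S \<and> Ck_on k T (\<lambda>x. frechet_derivative f (at x within S) v)"
      using T by blast
  qed
  ultimately show ?case by (simp add: differentiable_on_def)
qed

text \<open>\<open>S\<close> may have boundary points, as [0,1] x U has; openness of
  \<open>T\<close> guarantees that at its points the derivatives within \<open>T\<close> and within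
  \<open>S\<close> agree.\<close>

lemma Ck_on_subset:
  assumes "Ck_on k S f" "open T" "T \<subseteq> S"
  shows "Ck_on k T f"
  using assms(1)
proof (induction k arbitrary: f)
  case 0
  then show ?case using assms(3) continuous_on_subset by auto
next
  case (Suc k)
  have "Ck_on k T (\<lambda>x. frechet_derivative f (at x within S) v)" for v
    using Suc by simp
  moreover have "Ck_on k T (\<lambda>x. frechet_derivative f (at x within S) v)
     \<longleftrightarrow> Ck_on k T (\<lambda>x. frechet_derivative f (at x within T) v)" for v
    by (rule Ck_on_cong) (use assms in \<open>metis at_within_open at_within_open_subset\<close>)
  ultimately show ?case using Suc.prems assms(3) differentiable_on_subset by auto
qed

text \<open>Trades \<open>frechet_derivative\<close> for an explicit formula \<open>f'\<close>, so
  that the closure properties reduce to the usual differentiation rules.\<close>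

lemma Ck_on_SucI:
  assumes "open S" "\<And>x. x \<in> S \<Longrightarrow> (f has_derivative f' x) (at x)" "\<And>v. Ck_on k S (\<lambda>x. f' x v)"
  shows "Ck_on (Suc k) S f"
proof -
  have "f differentiable_on S"
    using assms(1,2) by (meson differentiableI differentiable_on_def has_derivative_at_withinI)
  moreover have "Ck_on k S (\<lambda>x. frechet_derivative f (at x within S) v)" for v
  proof -
    have "frechet_derivative f (at x within S) v = f' x v" if "x \<in> S" for x
      using frechet_derivative_at[OF assms(2)[OF that]] at_within_open[OF that assms(1)] by simp
    then show ?thesis
      using assms(3)[of v] Ck_on_cong[of S "\<lambda>x. frechet_derivative f (at x within S) v" "\<lambda>x. f' x v" k]
      by simp
  qed
  ultimately show ?thesis by simp
qed

lemma Ck_on_SucD: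
  assumes "Ck_on (Suc k) S f" "open S"
  shows "\<And>x. x \<in> S \<Longrightarrow> (f has_derivative frechet_derivative f (at x)) (at x)"
    and "Ck_on k S (\<lambda>x. frechet_derivative f (at x) v)"
proof -
  show "(f has_derivative frechet_derivative f (at x)) (at x)" if "x \<in> S" for x
    using assms that by (metis Ck_on.simps(2) at_within_open differentiable_on_def frechet_derivative_works)
  have "Ck_on k S (\<lambda>x. frechet_derivative f (at x within S) v)" using assms by simp
  then show "Ck_on k S (\<lambda>x. frechet_derivative f (at x) v)"
    by (rule Ck_on_cong[THEN iffD1, rotated]) (metis assms(2) at_within_open)
qed

section \<open>Closure of C^k under linear maps, sums, products and composition\<close>

lemma Ck_on_const [simp]: "open S \<Longrightarrow> Ck_on k S (\<lambda>x. c)"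
proof (induction k arbitrary: c)
  case (Suc k)
  then show ?case by (intro Ck_on_SucI[where f' = "\<lambda>x v. 0"]) auto
qed simp

lemma Ck_on_linear_compose:
  assumes "bounded_linear L" "open S" "Ck_on k S f"
  shows "Ck_on k S (\<lambda>x. L (f x))"
  using assms(3)
proof (induction k arbitrary: f)
  case 0
  then show ?case using assms(1) by (simp add: bounded_linear.continuous_on)
next
  case (Suc k)
  note d = Ck_on_SucD[OF Suc.prems assms(2)]
  show ?case
    by (rule Ck_on_SucI[OF assms(2), where f' = "\<lambda>x v. L (frechet_derivative f (at x) v)"])
      (auto intro: bounded_linear.has_derivative[OF assms(1)] d Suc.IH)
qed

lemma Ck_on_add:
  assumes "open S" "Ck_on k S f" "Ck_on k S g"
  shows "Ck_on k S (\<lambda>x. f x + g x)"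
  using assms(2,3)
proof (induction k arbitrary: f g)
  case 0
  then show ?case by (simp add: continuous_on_add)
next
  case (Suc k)
  note d = Ck_on_SucD[OF Suc.prems(1) assms(1)] Ck_on_SucD[OF Suc.prems(2) assms(1)]
  show ?case
    by (rule Ck_on_SucI[OF assms(1),
          where f' = "\<lambda>x v. frechet_derivative f (at x) v + frechet_derivative g (at x) v"])
      (auto intro: has_derivative_add d Suc.IH)
qed

lemma Ck_on_sum:
  assumes "open S" "\<And>i. i \<in> I \<Longrightarrow> Ck_on k S (f i)"
  shows "Ck_on k S (\<lambda>x. \<Sum>i\<in>I. f i x)"
  using assms by (induction I rule: infinite_finite_induct) (auto intro: Ck_on_add)

lemma Ck_on_scaleR:
  assumes "open S" "Ck_on k S f" "Ck_on k S g"
  shows "Ck_on k S (\<lambda>x. f x *\<^sub>R g x)"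
  using assms(2,3)
proof (induction k arbitrary: f g)
  case 0
  then show ?case by (simp add: continuous_on_scaleR)
next
  case (Suc k)
  note d = Ck_on_SucD[OF Suc.prems(1) assms(1)] Ck_on_SucD[OF Suc.prems(2) assms(1)]
  show ?case
    by (rule Ck_on_SucI[OF assms(1),
          where f' = "\<lambda>x v. f x *\<^sub>R frechet_derivative g (at x) v + frechet_derivative f (at x) v *\<^sub>R g x"])
      (auto intro!: has_derivative_scaleR Ck_on_add assms(1) d Suc.IH Ck_on_decrease[OF Suc.prems(1)]
         Ck_on_decrease[OF Suc.prems(2)])
qed

text \<open>\<open>Ck_on\<close> controls a varying linear map only on a fixed vector. Expanding the
  argument in the basis turns the value on a varying vector into a finite sum of products, which
  avoids operator-valued derivatives throughout.\<close>

lemma linear_Basis_expansion: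
  fixes L :: "'e::euclidean_space \<Rightarrow> 'f::real_vector"
  assumes "linear L"
  shows "L v = (\<Sum>b\<in>Basis. (v \<bullet> b) *\<^sub>R L b)"
  using assms linear_sum[OF assms, of "\<lambda>b. (v \<bullet> b) *\<^sub>R b" Basis]
  by (simp add: euclidean_representation linear_cmul)

text \<open>In the chain rule both g'(f x) and its argument f'(x) v depend on x. After expansion in
  the basis the coefficients are components of the derivative of \<open>f\<close>, and the factors
  g'(f x) b fall under the induction hypothesis, with \<open>f\<close> weakened to class
  C^k.\<close>

lemma Ck_on_compose:
  assumes "open S" "open T" "f ` S \<subseteq> T" "Ck_on k S f" "Ck_on k T g"
  shows "Ck_on k S (\<lambda>x. g (f x))"
  using assms(4,5)
proof (induction k arbitrary: g)
  case 0
  then show ?case using continuous_on_compose2[OF _ _ assms(3)] by simp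
next
  case (Suc k)
  note df = Ck_on_SucD[OF Suc.prems(1) assms(1)]
  note dg = Ck_on_SucD[OF Suc.prems(2) assms(2)]
  let ?g' = "\<lambda>y. frechet_derivative g (at y)" and ?f' = "\<lambda>x. frechet_derivative f (at x)"
  have "Ck_on k S (\<lambda>x. \<Sum>b\<in>Basis. (?f' x v \<bullet> b) *\<^sub>R ?g' (f x) b)" for v
    using Ck_on_decrease[OF Suc.prems(1)]
    by (intro Ck_on_sum Ck_on_scaleR assms(1) Suc.IH dg Ck_on_linear_compose[OF bounded_linear_inner_left] df)
  moreover have "((\<lambda>x. g (f x)) has_derivative (\<lambda>v. \<Sum>b\<in>Basis. (?f' x v \<bullet> b) *\<^sub>R ?g' (f x) b)) (at x)"
    if "x \<in> S" for x
  proof -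
    have fx: "f x \<in> T" using that assms(3) by auto
    have "linear (?g' (f x))" using dg(1)[OF fx] has_derivative_linear by blast
    then have "(\<Sum>b\<in>Basis. (?f' x v \<bullet> b) *\<^sub>R ?g' (f x) b) = ?g' (f x) (?f' x v)" for v
      using linear_Basis_expansion by metis
    then show ?thesis
      using has_derivative_compose[OF df(1)[OF that] dg(1)[OF fx]] by simp
  qed
  ultimately show ?case by (intro Ck_on_SucI[OF assms(1)])
qed

lemma Ck_on_linear: "bounded_linear L \<Longrightarrow> open S \<Longrightarrow> Ck_on k S L"
proof (induction k)
  case 0
  then show ?case by (simp add: linear_continuous_on)
next
  case (Suc k)
  then show ?case by (intro Ck_on_SucI[where f' = "\<lambda>x. L"]) (auto intro: bounded_linear_imp_has_derivative)
qed

lemma smooth_on_cong: "(\<And>y. y \<in> S \<Longrightarrow> f y = g y) \<Longrightarrow> smooth_on S f \<longleftrightarrow> smooth_on S g"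
  unfolding smooth_on_def using Ck_on_cong by blast

lemma smooth_on_imp_continuous_on: "smooth_on S f \<Longrightarrow> continuous_on S f"
  unfolding smooth_on_def using Ck_on_imp_continuous_on by blast

lemma smooth_on_local:
  assumes "open S" "\<And>x. x \<in> S \<Longrightarrow> \<exists>T. open T \<and> x \<in> T \<and> T \<subseteq> S \<and> smooth_on T f"
  shows "smooth_on S f"
  unfolding smooth_on_def using assms Ck_on_local unfolding smooth_on_def by metis

lemma smooth_on_subset: "smooth_on S f \<Longrightarrow> open T \<Longrightarrow> T \<subseteq> S \<Longrightarrow> smooth_on T f"
  unfolding smooth_on_def using Ck_on_subset by blast

lemma smooth_on_const [simp]: "open S \<Longrightarrow> smooth_on S (\<lambda>x. c)"
  by (simp add: smooth_on_def)

lemma smooth_on_linear: "bounded_linear L \<Longrightarrow> open S \<Longrightarrow> smooth_on S L"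
  by (simp add: smooth_on_def Ck_on_linear)

lemma smooth_on_linear_compose:
  "bounded_linear L \<Longrightarrow> open S \<Longrightarrow> smooth_on S f \<Longrightarrow> smooth_on S (\<lambda>x. L (f x))"
  by (simp add: smooth_on_def Ck_on_linear_compose)

lemma smooth_on_add:
  "open S \<Longrightarrow> smooth_on S f \<Longrightarrow> smooth_on S g \<Longrightarrow> smooth_on S (\<lambda>x. f x + g x)"
  by (simp add: smooth_on_def Ck_on_add)

lemma smooth_on_sum:
  "open S \<Longrightarrow> (\<And>i. i \<in> I \<Longrightarrow> smooth_on S (f i)) \<Longrightarrow> smooth_on S (\<lambda>x. \<Sum>i\<in>I. f i x)"
  by (simp add: smooth_on_def Ck_on_sum)

lemma smooth_on_scaleR:
  "open S \<Longrightarrow> smooth_on S f \<Longrightarrow> smooth_on S g \<Longrightarrow> smooth_on S (\<lambda>x. f x *\<^sub>R g x)"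
  by (simp add: smooth_on_def Ck_on_scaleR)

lemma smooth_on_compose:
  "open S \<Longrightarrow> open T \<Longrightarrow> f ` S \<subseteq> T \<Longrightarrow> smooth_on S f \<Longrightarrow> smooth_on T g
   \<Longrightarrow> smooth_on S (\<lambda>x. g (f x))"
  unfolding smooth_on_def using Ck_on_compose by blast

lemma smooth_on_derivative:
  assumes "open S" "smooth_on S f"
  shows "x \<in> S \<Longrightarrow> (f has_derivative frechet_derivative f (at x)) (at x)"
    and "smooth_on S (\<lambda>x. frechet_derivative f (at x) v)"
  using assms Ck_on_SucD unfolding smooth_on_def by blast+

text \<open>This condition makes derivatives within \<open>S\<close> unique; it also holds at the boundary points of
  \<open>[0,1] \<times> U\<close>.\<close>

definition unique_derivative_at :: "'e::euclidean_space set \<Rightarrow> 'e \<Rightarrow> bool" where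
  "unique_derivative_at S x \<longleftrightarrow> (\<forall>i\<in>Basis. \<forall>e>0. \<exists>d. 0 < \<bar>d\<bar> \<and> \<bar>d\<bar> < e \<and> x + d *\<^sub>R i \<in> S)"

lemma frechet_derivative_within_eq:
  assumes "unique_derivative_at S x" "(f has_derivative D) (at x within S)"
  shows "frechet_derivative f (at x within S) = D"
proof -
  have "(f has_derivative frechet_derivative f (at x within S)) (at x within S)"
    using assms(2) differentiableI frechet_derivative_works by blast
  then show ?thesis
    using frechet_derivative_unique_within[OF _ assms(2)] assms(1) unfolding unique_derivative_at_def by blast
qed

lemma open_unique_derivative_at:
  assumes "open S" "x \<in> S"
  shows "unique_derivative_at S x"
  unfolding unique_derivative_at_def
proof (intro ballI allI impI)
  fix i :: 'a and e :: real assume i: "i \<in> Basis" and "e > 0"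
  obtain r where r: "r > 0" "ball x r \<subseteq> S" using assms open_contains_ball by blast
  let ?d = "min (e/2) (r/2)"
  have "x + ?d *\<^sub>R i \<in> S"
    using r i \<open>e > 0\<close> by (intro subsetD[OF r(2)]) (auto simp: dist_norm)
  then show "\<exists>d. 0 < \<bar>d\<bar> \<and> \<bar>d\<bar> < e \<and> x + d *\<^sub>R i \<in> S"
    using r \<open>e > 0\<close> by (intro exI[of _ ?d]) auto
qed

lemma unique_derivative_at_Times:
  assumes "unique_derivative_at S x" "unique_derivative_at T y" "x \<in> S" "y \<in> T"
  shows "unique_derivative_at (S \<times> T) (x, y)"
  using assms unfolding unique_derivative_at_def Basis_prod_def by (auto simp: ball_Un)

lemma unique_derivative_at_unit_interval:
  assumes "t \<in> {0..1::real}"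
  shows "unique_derivative_at {0..1} t"
  unfolding unique_derivative_at_def
proof (intro ballI allI impI)
  fix i :: real and e :: real assume i: "i \<in> Basis" and "e > 0"
  show "\<exists>d. 0 < \<bar>d\<bar> \<and> \<bar>d\<bar> < e \<and> t + d *\<^sub>R i \<in> {0..1}"
  \<comment> \<open>The increment points into the interval, to the right for small t and to the left
    otherwise; its size is at most 1/2, so it cannot leave at the other end.\<close>
  proof (cases "t < 1/2")
    case True
    then show ?thesis using assms i \<open>e > 0\<close> by (intro exI[of _ "min (e/2) (1/2)"]) auto
  next
    case False
    then show ?thesis using assms i \<open>e > 0\<close> by (intro exI[of _ "- min (e/2) (1/2)"]) auto
  qed
qed

lemma unique_derivative_at_unit_interval_Times:
  "open S \<Longrightarrow> t \<in> {0..1::real} \<Longrightarrow> x \<in> S \<Longrightarrow> unique_derivative_at ({0..1} \<times> S) (t, x)"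
  by (simp add: open_unique_derivative_at unique_derivative_at_Times unique_derivative_at_unit_interval)


section \<open>Symmetry of second derivatives\<close>

text \<open>The mean value theorem twice: along \<open>v\<close> for the difference of
  \<open>F\<close> in direction \<open>w\<close>, then along \<open>w\<close> for the derivative of
  \<open>F\<close> in direction \<open>v\<close>. The left side is symmetric in \<open>v\<close> and
  \<open>w\<close>, which is the source of Schwarz's theorem.\<close>

lemma second_difference:
  fixes F :: "'e::euclidean_space \<Rightarrow> real"
  assumes "h > 0" and "open S"
    and S: "\<And>a b. a \<in> {0..h} \<Longrightarrow> b \<in> {0..h} \<Longrightarrow> x + a *\<^sub>R v + b *\<^sub>R w \<in> S"
    and F: "Ck_on 2 S F"
  shows "\<exists>a\<in>{0..h}. \<exists>b\<in>{0..h}.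
    F (x + h *\<^sub>R v + h *\<^sub>R w) - F (x + h *\<^sub>R v) - F (x + h *\<^sub>R w) + F x =
    h * h * frechet_derivative (\<lambda>y. frechet_derivative F (at y) v) (at (x + a *\<^sub>R v + b *\<^sub>R w)) w"
proof -
  let ?D = "\<lambda>y. frechet_derivative F (at y) v"
  have F2: "Ck_on (Suc (Suc 0)) S F" using F by (simp add: numeral_2_eq_2)
  note dF = Ck_on_SucD[OF F2 assms(2)]
  note dD = Ck_on_SucD(1)[OF dF(2) assms(2)]
  let ?g = "\<lambda>s. F (x + s *\<^sub>R v + h *\<^sub>R w) - F (x + s *\<^sub>R v)"
  have g: "(?g has_real_derivative (?D (x + s *\<^sub>R v + h *\<^sub>R w) - ?D (x + s *\<^sub>R v))) (at s)"
    if "0 \<le> s" "s \<le> h" for s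
  proof -
    have 1: "(F has_derivative frechet_derivative F (at (x + s *\<^sub>R v + h *\<^sub>R w))) (at (x + s *\<^sub>R v + h *\<^sub>R w))"
      using that \<open>h > 0\<close> by (intro dF(1) S) auto
    have 2: "(F has_derivative frechet_derivative F (at (x + s *\<^sub>R v))) (at (x + s *\<^sub>R v))"
      using that \<open>h > 0\<close> S[of s 0] by (intro dF(1)) auto
    have "(?g has_derivative (\<lambda>d. frechet_derivative F (at (x + s *\<^sub>R v + h *\<^sub>R w)) (d *\<^sub>R v)
       - frechet_derivative F (at (x + s *\<^sub>R v)) (d *\<^sub>R v))) (at s)"
      by (intro has_derivative_diff
          has_derivative_compose[where f = "\<lambda>s. x + s *\<^sub>R v + h *\<^sub>R w" and g = F, OF _ 1]
          has_derivative_compose[where f = "\<lambda>s. x + s *\<^sub>R v" and g = F, OF _ 2])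
        (auto intro!: derivative_eq_intros)
    then show ?thesis
      unfolding has_field_derivative_def
      by (rule has_derivative_eq_rhs)
        (simp add: fun_eq_iff right_diff_distrib mult.commute linear_cmul[OF has_derivative_linear[OF 1]]
          linear_cmul[OF has_derivative_linear[OF 2]])
  qed
  obtain a where a: "0 < a" "a < h"
    "?g h - ?g 0 = (h - 0) * (?D (x + a *\<^sub>R v + h *\<^sub>R w) - ?D (x + a *\<^sub>R v))"
    using MVT2[OF \<open>h > 0\<close> g] by blast
  let ?k = "\<lambda>s. ?D (x + a *\<^sub>R v + s *\<^sub>R w)"
  let ?DD = "\<lambda>y. frechet_derivative ?D (at y) w"
  have k: "(?k has_real_derivative ?DD (x + a *\<^sub>R v + s *\<^sub>R w)) (at s)"
    if "0 \<le> s" "s \<le> h" for s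
  proof -
    have 1: "(?D has_derivative frechet_derivative ?D (at (x + a *\<^sub>R v + s *\<^sub>R w))) (at (x + a *\<^sub>R v + s *\<^sub>R w))"
      using that \<open>h > 0\<close> a by (intro dD S) auto
    have "(?k has_derivative (\<lambda>d. frechet_derivative ?D (at (x + a *\<^sub>R v + s *\<^sub>R w)) (d *\<^sub>R w))) (at s)"
      by (intro has_derivative_compose[where f = "\<lambda>s. x + a *\<^sub>R v + s *\<^sub>R w" and g = ?D, OF _ 1]) (auto intro!: derivative_eq_intros)
    then show ?thesis
      unfolding has_field_derivative_def
      by (rule has_derivative_eq_rhs)
        (simp add: fun_eq_iff linear_cmul[OF has_derivative_linear[OF 1]])
  qed
  obtain b where b: "0 < b" "b < h" "?k h - ?k 0 = (h - 0) * ?DD (x + a *\<^sub>R v + b *\<^sub>R w)"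
    using MVT2[OF \<open>h > 0\<close> k] by blast
  have "F (x + h *\<^sub>R v + h *\<^sub>R w) - F (x + h *\<^sub>R v) - F (x + h *\<^sub>R w) + F x = h * h * ?DD (x + a *\<^sub>R v + b *\<^sub>R w)"
    using a(3) b(3) by (simp add: algebra_simps)
  then show ?thesis using a b by (intro bexI[of _ a] bexI[of _ b]) auto
qed

text \<open>Exchanging \<open>v\<close> and \<open>w\<close> leaves the second difference unchanged,
  so the two mixed derivatives agree at a pair of points close to \<open>x\<close>; continuity
  brings both values to \<open>x\<close> up to any \<open>e\<close>.\<close>

lemma second_derivative_symmetric_open:
  fixes F :: "'e::euclidean_space \<Rightarrow> real"
  assumes "open S" "Ck_on 2 S F" "x \<in> S"
  shows "frechet_derivative (\<lambda>y. frechet_derivative F (at y) v) (at x) w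
       = frechet_derivative (\<lambda>y. frechet_derivative F (at y) w) (at x) v"
proof -
  define A where "A = (\<lambda>v w x. frechet_derivative (\<lambda>y. frechet_derivative F (at y) v) (at x) w)"
  have F2: "Ck_on (Suc (Suc 0)) S F" using assms(2) by (simp add: numeral_2_eq_2)
  have cont: "continuous (at x) (A v w)" for v w
    using Ck_on_SucD(2)[OF Ck_on_SucD(2)[OF F2 assms(1)] assms(1)] assms(1,3)
    unfolding A_def by (simp add: continuous_on_eq_continuous_at)
  have "\<bar>A v w x - A w v x\<bar> \<le> e" if e: "e > 0" for e
  proof -
    obtain d1 where d1: "d1 > 0" "\<And>y. dist y x < d1 \<Longrightarrow> \<bar>A v w y - A v w x\<bar> < e / 2"
      using cont[of v w, unfolded continuous_at_eps_delta dist_real_def, rule_format, of "e / 2"] half_gt_zero[OF e] by metis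
    obtain d2 where d2: "d2 > 0" "\<And>y. dist y x < d2 \<Longrightarrow> \<bar>A w v y - A w v x\<bar> < e / 2"
      using cont[of w v, unfolded continuous_at_eps_delta dist_real_def, rule_format, of "e / 2"] half_gt_zero[OF e] by metis
    obtain d3 where d3: "d3 > 0" "ball x d3 \<subseteq> S" using assms(1,3) open_contains_ball by blast
    define d where "d = min d1 (min d2 d3)"
    \<comment> \<open>All points x + a v + b w with a, b in [0, h] lie within d / 2 of x; the
      summand 1 keeps the divisor positive when both vectors vanish.\<close>
    define h where "h = d / (2 * (norm v + norm w + 1))"
    have "d > 0" using d1 d2 d3 by (simp add: d_def)
    have n: "norm v + norm w + 1 > 0" by (simp add: add_nonneg_pos)
    have "h > 0" using \<open>d > 0\<close> n by (simp add: h_def)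
    \<comment> \<open>Only the sum of the norms matters, so one estimate serves both orders of the
      two directions.\<close>
    have near: "dist (x + a *\<^sub>R v' + b *\<^sub>R w') x < d"
      if "a \<in> {0..h}" "b \<in> {0..h}" "norm v' + norm w' = norm v + norm w" for a b v' w'
    proof -
      have "norm (a *\<^sub>R v' + b *\<^sub>R w') \<le> a * norm v' + b * norm w'"
        using that norm_triangle_ineq[of "a *\<^sub>R v'" "b *\<^sub>R w'"] by simp
      also have "\<dots> \<le> h * norm v' + h * norm w'"
        using that by (intro add_mono mult_right_mono) auto
      also have "\<dots> = h * (norm v + norm w)" by (simp add: that(3)[symmetric] distrib_left)
      also have "\<dots> \<le> h * (norm v + norm w + 1)" using \<open>h > 0\<close> by simp
      also have "\<dots> = d / 2" using n by (simp add: h_def field_simps)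
      finally show ?thesis using \<open>d > 0\<close> by (simp add: dist_norm add.assoc)
    qed
    have inS: "x + a *\<^sub>R v' + b *\<^sub>R w' \<in> S"
      if "a \<in> {0..h}" "b \<in> {0..h}" "norm v' + norm w' = norm v + norm w" for a b v' w'
      by (rule subsetD[OF d3(2)]) (use near[OF that] in \<open>simp add: d_def dist_commute\<close>)
    obtain a b where ab: "a \<in> {0..h}" "b \<in> {0..h}"
      "F (x + h *\<^sub>R v + h *\<^sub>R w) - F (x + h *\<^sub>R v) - F (x + h *\<^sub>R w) + F x = h * h * A v w (x + a *\<^sub>R v + b *\<^sub>R w)"
      using second_difference[OF \<open>h > 0\<close> assms(1) inS assms(2), of v w] unfolding A_def by auto
    obtain a' b' where ab': "a' \<in> {0..h}" "b' \<in> {0..h}"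
      "F (x + h *\<^sub>R w + h *\<^sub>R v) - F (x + h *\<^sub>R w) - F (x + h *\<^sub>R v) + F x = h * h * A w v (x + a' *\<^sub>R w + b' *\<^sub>R v)"
      using second_difference[OF \<open>h > 0\<close> assms(1) inS assms(2), of w v] unfolding A_def by (auto simp: add.commute)
    have "F (x + h *\<^sub>R v + h *\<^sub>R w) = F (x + h *\<^sub>R w + h *\<^sub>R v)" by (simp add: algebra_simps)
    then have "h * h * A v w (x + a *\<^sub>R v + b *\<^sub>R w) = h * h * A w v (x + a' *\<^sub>R w + b' *\<^sub>R v)"
      using ab(3) ab'(3) by linarith
    then have "A v w (x + a *\<^sub>R v + b *\<^sub>R w) = A w v (x + a' *\<^sub>R w + b' *\<^sub>R v)" using \<open>h > 0\<close> by simp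
    moreover have "\<bar>A v w (x + a *\<^sub>R v + b *\<^sub>R w) - A v w x\<bar> < e / 2"
      using near[OF ab(1,2), of v w] by (intro d1) (simp add: d_def)
    moreover have "\<bar>A w v (x + a' *\<^sub>R w + b' *\<^sub>R v) - A w v x\<bar> < e / 2"
      using near[OF ab'(1,2), of w v] by (intro d2) (simp add: d_def)
    ultimately show ?thesis by linarith
  qed
  then have "\<bar>A v w x - A w v x\<bar> \<le> 0" by (rule field_le_epsilon) simp
  then show ?thesis by (simp add: A_def)
qed

text \<open>The difference of the mixed derivatives is continuous on \<open>S\<close> and zero on
  the interior, and the interior is dense in \<open>S\<close>. This reaches the end points t = 0 and
  t = 1, where derivatives are one-sided.\<close>

lemma second_derivative_symmetric:
  fixes F :: "'e::euclidean_space \<Rightarrow> real"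
  assumes "S \<subseteq> closure (interior S)" "Ck_on 2 S F" "x \<in> S"
  shows "frechet_derivative (\<lambda>y. frechet_derivative F (at y within S) v) (at x within S) w
       = frechet_derivative (\<lambda>y. frechet_derivative F (at y within S) w) (at x within S) v"
proof -
  define A where "A = (\<lambda>v w x. frechet_derivative (\<lambda>y. frechet_derivative F (at y within S) v) (at x within S) w)"
  have cont: "continuous_on S (\<lambda>x. A v w x - A w v x)"
    using assms(2) unfolding A_def by (intro continuous_on_diff) (auto simp: numeral_2_eq_2)
  have int: "A v w x = A w v x" if "x \<in> interior S" for x
  proof -
    have *: "A v w x = frechet_derivative (\<lambda>y. frechet_derivative F (at y) v) (at x) w" for v w
    proof -
      have x: "at x within S = at x" "at x within interior S = at x"
        using that at_within_interior at_within_open by blast+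
      have "frechet_derivative (\<lambda>y. frechet_derivative F (at y within S) v) (at x within interior S)
        = frechet_derivative (\<lambda>y. frechet_derivative F (at y) v) (at x within interior S)"
        by (rule frechet_derivative_within_cong[OF _ that]) (simp only: at_within_interior)
      from fun_cong[OF this[unfolded x(2)], of w] show ?thesis unfolding A_def x(1) .
    qed
    have "Ck_on 2 (interior S) F" using assms(2) by (rule Ck_on_subset) (simp_all add: interior_subset)
    then show ?thesis using second_derivative_symmetric_open[of "interior S" F x v w] that by (simp add: *)
  qed
  let ?Z = "{x \<in> S. A v w x - A w v x = 0}"
  have "closedin (top_of_set S) ?Z" by (rule continuous_closedin_preimage_constant[OF cont])
  then obtain T where T: "closed T" "?Z = S \<inter> T" by (auto simp: closedin_closed)
  have "interior S \<subseteq> T" using T(2) int interior_subset[of S] by auto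
  then have "closure (interior S) \<subseteq> T" using T(1) by (rule closure_minimal)
  then have "x \<in> ?Z" using assms T(2) by blast
  then show ?thesis by (simp add: A_def)
qed

lemma unit_interval_Times_subset_closure_interior:
  assumes "open U"
  shows "{0..1::real} \<times> U \<subseteq> closure (interior ({0..1} \<times> U))"
  using assms closure_subset[of U] by (auto simp: interior_Times closure_Times interior_open)


section \<open>Atlases and tangent vectors\<close>

lemma inv_chart_left [simp]: "is_chart c \<Longrightarrow> p \<in> fst c \<Longrightarrow> inv_chart c (snd c p) = p"
  by (simp add: inv_chart_def is_chart_def)

lemma inv_chart_right:
  assumes "x \<in> chart_image c"
  shows "inv_chart c x \<in> fst c" "snd c (inv_chart c x) = x"
  using assms unfolding inv_chart_def chart_image_def
  by (auto intro: inv_into_into f_inv_into_f)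

lemma transition_apply [simp]: "is_chart c \<Longrightarrow> p \<in> fst c \<Longrightarrow> transition c c' (snd c p) = snd c' p"
  by (simp add: transition_def)

lemma snd_chart_in_image: "is_chart c \<Longrightarrow> p \<in> fst c \<Longrightarrow> snd c p \<in> snd c ` W \<longleftrightarrow> p \<in> W" if "W \<subseteq> fst c"
  using that unfolding is_chart_def by (auto dest: inj_onD)

locale atlas =
  fixes A :: "('a, 'e::euclidean_space) chart set"
  assumes smooth_atlas: "smooth_atlas A"
begin

lemma atlas_subset_charts: "A \<subseteq> charts A"
  using smooth_atlas unfolding smooth_atlas_def charts_def points_def by auto

lemma charts_is_chart: "c \<in> charts A \<Longrightarrow> is_chart c"
  by (simp add: charts_def)

lemma atlas_is_chart: "c \<in> A \<Longrightarrow> is_chart c"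
  using smooth_atlas by (simp add: smooth_atlas_def)

lemma charts_atD:
  assumes "c \<in> charts_at A p"
  shows "c \<in> charts A" "p \<in> fst c" "is_chart c"
  using assms charts_is_chart unfolding charts_at_def by blast+

lemma charts_points: "c \<in> charts A \<Longrightarrow> p \<in> fst c \<Longrightarrow> p \<in> points A"
  by (auto simp: charts_def)

lemma chart_at_in: "p \<in> points A \<Longrightarrow> chart_at A p \<in> charts_at A p"
proof -
  assume "p \<in> points A"
  then obtain c where "c \<in> charts_at A p"
    using atlas_subset_charts unfolding points_def charts_at_def by blast
  then show ?thesis unfolding chart_at_def by (rule someI)
qed

lemma chart_near:
  assumes "c \<in> charts A" "c0 \<in> A" "p \<in> fst c" "p \<in> fst c0" "W \<subseteq> fst c0" "open (snd c0 ` W)" "p \<in> W"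
  shows "open (snd c ` (fst c \<inter> fst c0 \<inter> W))"
proof -
  have ch: "is_chart c" "is_chart c0" using assms(1,2) charts_is_chart atlas_is_chart by blast+
  have co: "compatible c c0" using assms by (simp add: charts_def)
  let ?O = "snd c ` (fst c \<inter> fst c0)"
  have "open ?O" "smooth_on ?O (transition c c0)" using co by (auto simp: compatible_def)
  then have "open (?O \<inter> transition c c0 -` (snd c0 ` W))"
    using continuous_open_preimage[OF smooth_on_imp_continuous_on _ assms(6)] by blast
  moreover have "?O \<inter> transition c c0 -` (snd c0 ` W) = snd c ` (fst c \<inter> fst c0 \<inter> W)"
  proof -
    have "snd c0 q \<in> snd c0 ` W \<longleftrightarrow> q \<in> W" if "q \<in> fst c0" for q
      by (rule snd_chart_in_image[OF assms(5) ch(2) that])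
    then have "fst c \<inter> fst c0 \<inter> W = {q \<in> fst c \<inter> fst c0. snd c0 q \<in> snd c0 ` W}" by blast
    then show ?thesis using ch by auto
  qed
  ultimately show ?thesis by simp
qed

text \<open>Membership in \<open>charts A\<close> only asserts compatibility with the charts of
  \<open>A\<close>. Near each point a chart \<open>c0\<close> of \<open>A\<close> is interposed, and
  the transition is factored as \<open>c\<close> to \<open>c0\<close> to \<open>c'\<close>.\<close>

lemma charts_compatible:
  assumes c: "c \<in> charts A" "c' \<in> charts A"
  shows "open (snd c ` (fst c \<inter> fst c'))" "smooth_on (snd c ` (fst c \<inter> fst c')) (transition c c')"
proof -
  have ch: "is_chart c" "is_chart c'" using c charts_is_chart by blast+
  have *: "\<exists>T. open T \<and> x \<in> T \<and> T \<subseteq> snd c ` (fst c \<inter> fst c') \<and> smooth_on T (transition c c')"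
    if x: "x \<in> snd c ` (fst c \<inter> fst c')" for x
  proof -
    obtain p where p: "p \<in> fst c" "p \<in> fst c'" "x = snd c p" using x by auto
    then obtain c0 where c0: "c0 \<in> A" "p \<in> fst c0"
      using charts_points[OF c(1)] unfolding points_def by blast
    have ch0: "is_chart c0" using c0(1) by (rule atlas_is_chart)
    have co: "compatible c c0" "compatible c' c0" using c c0 by (auto simp: charts_def)
    let ?W = "fst c' \<inter> fst c0"
    let ?T = "snd c ` (fst c \<inter> fst c0 \<inter> ?W)"
    have oW: "open (snd c0 ` ?W)" using co(2) by (simp add: compatible_def)
    have oT: "open ?T" using chart_near[OF c(1) c0(1) p(1) c0(2) _ oW] p c0 by auto
    have "smooth_on ?T (\<lambda>y. transition c0 c' (transition c c0 y))"
    proof (rule smooth_on_compose[OF oT oW, where f = "transition c c0" and g = "transition c0 c'"])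
      show "transition c c0 ` ?T \<subseteq> snd c0 ` ?W" using ch by auto
      have "smooth_on (snd c ` (fst c \<inter> fst c0)) (transition c c0)" using co by (simp add: compatible_def)
      then show "smooth_on ?T (transition c c0)" by (rule smooth_on_subset[OF _ oT]) auto
      show "smooth_on (snd c0 ` ?W) (transition c0 c')" using co(2) by (simp add: compatible_def)
    qed
    moreover have "transition c0 c' (transition c c0 y) = transition c c' y" if "y \<in> ?T" for y
      using that ch ch0 by auto
    ultimately have "smooth_on ?T (transition c c')" 
      using smooth_on_cong[of ?T "\<lambda>y. transition c0 c' (transition c c0 y)" "transition c c'"] by blast
    then show ?thesis using oT p c0 by (intro exI[of _ ?T]) auto
  qed
  show o: "open (snd c ` (fst c \<inter> fst c'))" using * by (subst open_subopen) blast
  show "smooth_on (snd c ` (fst c \<inter> fst c')) (transition c c')"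
    using smooth_on_local[OF o *] by blast
qed

section \<open>Differentials of transition maps and tangent vectors in coordinates\<close>

lemma transition_has_derivative:
  assumes "c \<in> charts_at A p" "c' \<in> charts_at A p"
  shows "(transition c c' has_derivative frechet_derivative (transition c c') (at (snd c p))) (at (snd c p))"
  using assms charts_compatible[of c c'] by (intro smooth_on_derivative) (auto simp: charts_at_def)

lemma transition_linear:
  assumes "c \<in> charts_at A p" "c' \<in> charts_at A p"
  shows "linear (frechet_derivative (transition c c') (at (snd c p)))"
  using transition_has_derivative[OF assms] has_derivative_linear by blast

lemma overlap_eventually:
  assumes "c \<in> charts_at A p" "c' \<in> charts_at A p"
  shows "\<forall>\<^sub>F x in nhds (snd c p). x \<in> snd c ` (fst c \<inter> fst c')"
  using assms charts_compatible[of c c'] by (intro eventually_nhds_in_open) (auto simp: charts_at_def)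

lemma inv_chart_transition:
  assumes "is_chart c" "is_chart c'" "x \<in> snd c ` (fst c \<inter> fst c')"
  shows "inv_chart c' (transition c c' x) = inv_chart c x"
  using assms by auto

text \<open>The chain rule for the transition map; the two coordinate expressions of
  \<open>g\<close> are related only on the overlap, which is a neighbourhood of the point.\<close>

lemma has_derivative_change_chart:
  assumes c: "c \<in> charts_at A p" "c' \<in> charts_at A p"
    and g: "(g \<circ> inv_chart c' has_derivative L) (at (snd c' p))"
  shows "(g \<circ> inv_chart c has_derivative
    (\<lambda>u. L (frechet_derivative (transition c c') (at (snd c p)) u))) (at (snd c p))"
proof -
  note ch = charts_atD(3)[OF c(1)] charts_atD(3)[OF c(2)] charts_atD(2)[OF c(1)] charts_atD(2)[OF c(2)]
  have "(g \<circ> inv_chart c' has_derivative L) (at (transition c c' (snd c p)))" using g ch by simp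
  from has_derivative_compose[OF transition_has_derivative[OF c] this]
  show ?thesis
  proof (rule has_derivative_transform_eventually)
    show "\<forall>\<^sub>F x in at (snd c p). (g \<circ> inv_chart c') (transition c c' x) = (g \<circ> inv_chart c) x"
      unfolding eventually_at_filter using overlap_eventually[OF c]
      by (rule eventually_mono) (simp add: inv_chart_transition ch)
  qed (use ch in auto)
qed

lemma transition_derivative_compose:
  assumes "c \<in> charts_at A p" "c' \<in> charts_at A p" "c'' \<in> charts_at A p"
  shows "frechet_derivative (transition c c'') (at (snd c p)) u =
    frechet_derivative (transition c' c'') (at (snd c' p)) (frechet_derivative (transition c c') (at (snd c p)) u)"
proof -
  have "(snd c'' \<circ> inv_chart c' has_derivative frechet_derivative (transition c' c'') (at (snd c' p))) (at (snd c' p))"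
    using transition_has_derivative[OF assms(2,3)] by (simp add: transition_def)
  from frechet_derivative_at[OF has_derivative_change_chart[OF assms(1,2) this]]
  show ?thesis by (simp add: transition_def fun_eq_iff)
qed

lemma transition_derivative_self [simp]:
  assumes "c \<in> charts_at A p"
  shows "frechet_derivative (transition c c) (at (snd c p)) u = u"
proof -
  note ch = charts_atD(3,2)[OF assms]
  have "((\<lambda>x. x) has_derivative (\<lambda>u. u)) (at (snd c p))" by simp
  then have "(transition c c has_derivative (\<lambda>u. u)) (at (snd c p))"
    by (rule has_derivative_transform_within_open[of _ _ _ _ "chart_image c"])
      (use ch in \<open>auto simp: is_chart_def chart_image_def transition_apply\<close>)
  then show ?thesis using frechet_derivative_at by metis
qed

lemma coord_vec_at [simp]: "c \<in> charts_at A p \<Longrightarrow> coord_vec A c p u c = u"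
  by (simp add: coord_vec_def)

lemma coord_vec_tangent [intro]:
  assumes "c \<in> charts_at A p"
  shows "coord_vec A c p u \<in> tangent_space A p"
  unfolding tangent_space_def mem_Collect_eq
proof (intro conjI allI impI ballI)
  fix c' assume "c' \<notin> charts_at A p"
  then show "coord_vec A c p u c' = 0" by (simp add: coord_vec_def)
next
  fix c' c'' assume "c' \<in> charts_at A p" "c'' \<in> charts_at A p"
  then show "coord_vec A c p u c'' = frechet_derivative (transition c' c'') (at (snd c' p)) (coord_vec A c p u c')"
    using transition_derivative_compose[OF assms, of c' c'' u] by (simp add: coord_vec_def)
qed

lemma tangent_change:
  assumes "c \<in> charts_at A p" "c' \<in> charts_at A p" "X \<in> tangent_space A p"
  shows "X c' = frechet_derivative (transition c c') (at (snd c p)) (X c)"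
  using assms unfolding tangent_space_def by blast

lemma tangent_zero: "X \<in> tangent_space A p \<Longrightarrow> c \<notin> charts_at A p \<Longrightarrow> X c = 0"
  unfolding tangent_space_def by blast

lemma coord_vec_eq:
  assumes "c \<in> charts_at A p" "X \<in> tangent_space A p"
  shows "coord_vec A c p (X c) = X"
  using tangent_change[OF assms(1) _ assms(2)] tangent_zero[OF assms(2)]
  by (force simp: coord_vec_def)

lemma tangent_eqI:
  assumes "c \<in> charts_at A p" "X \<in> tangent_space A p" "Y \<in> tangent_space A p" "X c = Y c"
  shows "X = Y"
  by (metis assms coord_vec_eq)

lemma tangent_lincomb:
  assumes "X \<in> tangent_space A p" "Y \<in> tangent_space A p"
  shows "lincomb a X b Y \<in> tangent_space A p"
  unfolding tangent_space_def mem_Collect_eq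
proof (intro conjI allI impI ballI)
  fix c assume "c \<notin> charts_at A p"
  then show "lincomb a X b Y c = 0" using tangent_zero[OF assms(1)] tangent_zero[OF assms(2)] by (simp add: lincomb_def)
next
  fix c c' assume c: "c \<in> charts_at A p" "c' \<in> charts_at A p"
  show "lincomb a X b Y c' = frechet_derivative (transition c c') (at (snd c p)) (lincomb a X b Y c)"
    unfolding lincomb_def tangent_change[OF c assms(1)] tangent_change[OF c assms(2)]
    using transition_linear[OF c] by (simp add: linear_add linear_cmul)
qed

lemma coord_vec_lincomb:
  assumes "c \<in> charts_at A p"
  shows "coord_vec A c p (a *\<^sub>R u + b *\<^sub>R v) = lincomb a (coord_vec A c p u) b (coord_vec A c p v)"
proof (rule tangent_eqI[OF assms])
  show "lincomb a (coord_vec A c p u) b (coord_vec A c p v) \<in> tangent_space A p"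
    using assms by (intro tangent_lincomb coord_vec_tangent)
qed (use assms in \<open>auto simp: lincomb_def\<close>)

text \<open>The definition fixes the chart \<open>chart_at\<close>. The factor produced by changing
  charts is absorbed by the transformation law of \<open>X\<close>, so any convenient chart computes
  the differential; \<open>pushforward_eq\<close> does the same for maps.\<close>

lemma differential_eq:
  assumes c: "c \<in> charts_at A p" and u: "(u \<circ> inv_chart c has_derivative L) (at (snd c p))"
    and X: "X \<in> tangent_space A p"
  shows "differential A u p X = L (X c)"
proof -
  have p: "p \<in> points A" using charts_points[OF charts_atD(1,2)[OF c]] .
  note d = chart_at_in[OF p]
  show ?thesis
    using frechet_derivative_at[OF has_derivative_change_chart[OF d c u], symmetric] X
    by (simp add: differential_def Let_def tangent_change[OF d c X])
qed

lemma pushforward_eq: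
  assumes c: "c \<in> charts_at A p" and C: "C \<in> charts_at X (g p)"
    and g: "(snd C \<circ> g \<circ> inv_chart c has_derivative L) (at (snd c p))" and v: "v \<in> tangent_space A p"
  shows "pushforward A X g p v C = L (v c)"
proof -
  have p: "p \<in> points A" using charts_points[OF charts_atD(1,2)[OF c]] .
  note d = chart_at_in[OF p]
  show ?thesis
    using frechet_derivative_at[OF has_derivative_change_chart[OF d c g], symmetric] C
    by (simp add: pushforward_def Let_def tangent_change[OF d c v])
qed

text \<open>Charts are injective, so taking images commutes with intersections; this is why the
  predicate in \<open>atlas_topology\<close> really is a topology.\<close>

lemma openin_atlas_topology:
  "openin (atlas_topology A) W \<longleftrightarrow> W \<subseteq> points A \<and> (\<forall>c\<in>A. open (snd c ` (W \<inter> fst c)))"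
proof -
  have inj: "inj_on (snd c) (fst c)" if "c \<in> A" for c
    using smooth_atlas that by (simp add: smooth_atlas_def is_chart_def)
  have 1: "snd c ` (S \<inter> T \<inter> fst c) = snd c ` (S \<inter> fst c) \<inter> snd c ` (T \<inter> fst c)" if "c \<in> A" for c S T
    using inj[OF that] by (auto dest: inj_onD)
  have 2: "snd c ` (\<Union>K \<inter> fst c) = (\<Union>S\<in>K. snd c ` (S \<inter> fst c))" for c :: "('a,'e) chart" and K
    by auto
  have "istopology (\<lambda>W. W \<subseteq> points A \<and> (\<forall>c\<in>A. open (snd c ` (W \<inter> fst c))))"
    unfolding istopology_def by (auto simp: 1 2 intro!: open_Int open_UN)
  then show ?thesis unfolding atlas_topology_def by (simp add: topology_inverse')
qed

lemma topspace_atlas_topology [simp]: "topspace (atlas_topology A) = points A"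
proof -
  have "snd c ` (points A \<inter> fst c) = chart_image c" if "c \<in> A" for c
    using that by (auto simp: points_def chart_image_def)
  then have "openin (atlas_topology A) (points A)"
    unfolding openin_atlas_topology using smooth_atlas by (auto simp: smooth_atlas_def is_chart_def)
  then show ?thesis
    using openin_atlas_topology[of "topspace (atlas_topology A)"] openin_subset openin_topspace by blast
qed

text \<open>Openness is tested in the charts of \<open>A\<close> only; \<open>chart_near\<close>
  carries it over to the whole maximal atlas, where frames and \<open>cotangent_bundle\<close>
  live.\<close>

lemma openin_charts:
  assumes W: "openin (atlas_topology A) W" and c: "c \<in> charts A"
  shows "open (snd c ` (W \<inter> fst c))"
proof (subst open_subopen, intro ballI)
  fix x assume "x \<in> snd c ` (W \<inter> fst c)"
  then obtain p where p: "p \<in> W" "p \<in> fst c" "x = snd c p" by auto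
  then obtain c0 where c0: "c0 \<in> A" "p \<in> fst c0"
    using charts_points[OF c] unfolding points_def by blast
  have "open (snd c ` (fst c \<inter> fst c0 \<inter> (W \<inter> fst c0)))"
    using W p c0 by (intro chart_near[OF c c0(1) p(2) c0(2)]) (auto simp: openin_atlas_topology)
  then show "\<exists>T. open T \<and> x \<in> T \<and> T \<subseteq> snd c ` (W \<inter> fst c)"
    using p c0 by (intro exI[of _ "snd c ` (fst c \<inter> fst c0 \<inter> (W \<inter> fst c0))"]) auto
qed

lemma openin_chart_domain: "c \<in> charts A \<Longrightarrow> openin (atlas_topology A) (fst c)"
  unfolding openin_atlas_topology by (auto simp: charts_def compatible_def)

end


section \<open>The atlas of the cotangent bundle\<close>

definition re_part :: "complex^'n \<Rightarrow> real^'n" where "re_part z = (\<chi> k. Re (z $ k))"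
definition im_part :: "complex^'n \<Rightarrow> real^'n" where "im_part z = (\<chi> k. Im (z $ k))"
definition cplx :: "real^'n \<Rightarrow> real^'n \<Rightarrow> complex^'n" where "cplx x y = (\<chi> k. Complex (x $ k) (y $ k))"

lemma re_part_cplx [simp]: "re_part (cplx x y) = x"
  and im_part_cplx [simp]: "im_part (cplx x y) = y"
  and cplx_parts [simp]: "cplx (re_part z) (im_part z) = z"
  and cplx_nth [simp]: "cplx x y $ k = Complex (x $ k) (y $ k)"
  and re_part_nth [simp]: "re_part z $ k = Re (z $ k)"
  and im_part_nth [simp]: "im_part z $ k = Im (z $ k)"
  by (simp_all add: re_part_def im_part_def cplx_def vec_eq_iff)

lemma bounded_linear_re_part: "bounded_linear re_part"
  by (rule linear_conv_bounded_linear[THEN iffD1], rule linearI) (simp_all add: vec_eq_iff)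

lemma bounded_linear_im_part: "bounded_linear im_part"
  by (rule linear_conv_bounded_linear[THEN iffD1], rule linearI) (simp_all add: vec_eq_iff)

lemma bounded_linear_cplx_left: "bounded_linear (\<lambda>x. cplx x 0)"
  by (rule linear_conv_bounded_linear[THEN iffD1], rule linearI) (simp_all add: vec_eq_iff complex_eq_iff)

lemma bounded_linear_cplx_right: "bounded_linear (cplx 0)"
  by (rule linear_conv_bounded_linear[THEN iffD1], rule linearI) (simp_all add: vec_eq_iff complex_eq_iff)

lemma cplx_add: "cplx x y = cplx x 0 + cplx 0 y"
  by (simp add: vec_eq_iff complex_eq_iff)

lemma smooth_on_cplx:
  assumes "open S" "smooth_on S f" "smooth_on S g"
  shows "smooth_on S (\<lambda>x. cplx (f x) (g x))"
proof -
  have "smooth_on S (\<lambda>x. cplx (f x) 0 + cplx 0 (g x))"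
    using assms
    by (intro smooth_on_add smooth_on_linear_compose[OF bounded_linear_cplx_left]
        smooth_on_linear_compose[OF bounded_linear_cplx_right])
  then show ?thesis by (simp add: cplx_add[symmetric])
qed

lemma vec_axis_expansion: "x = (\<Sum>k\<in>UNIV. x $ k *\<^sub>R axis k (1::real))"
  using basis_expansion[of x] by (simp add: scalar_mult_eq_scaleR)

lemma smooth_on_vec_lambda:
  fixes f :: "'e::euclidean_space \<Rightarrow> 'n::finite \<Rightarrow> real"
  assumes "open S" "\<And>k. smooth_on S (\<lambda>x. f x k)"
  shows "smooth_on S (\<lambda>x. \<chi> k. f x k)"
proof -
  have "smooth_on S (\<lambda>x. \<Sum>k\<in>UNIV. f x k *\<^sub>R axis k (1::real))"
    using assms by (intro smooth_on_sum smooth_on_scaleR smooth_on_const)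
  then show ?thesis using vec_axis_expansion[of "\<chi> k. f _ k"] by simp
qed

locale base_atlas = atlas A for A :: "('a, real^'n) chart set"
begin

abbreviation cotangent_atlas :: "(('a, 'n) cotangent_point, complex^'n) chart set" where
  "cotangent_atlas \<equiv> cotangent_bundle A"

text \<open>The inverse of the fibre coordinate in \<open>cotangent_chart\<close>; the value 0 off
  the tangent space is the normal form that \<open>cotangent_space\<close> imposes.\<close>

definition covector :: "('a, real^'n) chart \<Rightarrow> 'a \<Rightarrow> real^'n \<Rightarrow> ('a, real^'n) tvec \<Rightarrow> real" where
  "covector c p y = (\<lambda>X. if X \<in> tangent_space A p then y \<bullet> X c else 0)"

lemma covector_in: "covector c p y \<in> cotangent_space A p"
  using tangent_lincomb by (auto simp: cotangent_space_def covector_def lincomb_def inner_add_right)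

lemma covector_coord_vec: "c \<in> charts_at A p \<Longrightarrow> covector c p y (coord_vec A c p u) = y \<bullet> u"
  by (simp add: covector_def coord_vec_tangent)

text \<open>By linearity the components on the coordinate vectors determine a covector. This gives
  injectivity of the cotangent charts on fibres.\<close>

lemma cotangent_eq:
  assumes c: "c \<in> charts_at A p" and xi: "xi \<in> cotangent_space A p"
  shows "xi = covector c p (\<chi> k. xi (coord_vec A c p (axis k 1)))"
proof
  fix X
  show "xi X = covector c p (\<chi> k. xi (coord_vec A c p (axis k 1))) X"
  proof (cases "X \<in> tangent_space A p")
    case True
    have add: "xi (lincomb a U b V) = a * xi U + b * xi V"
      if "U \<in> tangent_space A p" "V \<in> tangent_space A p" for a b U V
      using xi that by (simp add: cotangent_space_def)
    have lin: "linear (\<lambda>u. xi (coord_vec A c p u))"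
    proof (rule linearI)
      show "xi (coord_vec A c p (u + v)) = xi (coord_vec A c p u) + xi (coord_vec A c p v)" for u v
        using add[of "coord_vec A c p u" "coord_vec A c p v" 1 1] coord_vec_lincomb[OF c, of 1 u 1 v]
          coord_vec_tangent[OF c] by simp
      show "xi (coord_vec A c p (r *\<^sub>R u)) = r *\<^sub>R xi (coord_vec A c p u)" for r u
        using add[of "coord_vec A c p u" "coord_vec A c p u" r 0] coord_vec_lincomb[OF c, of r u 0 u]
          coord_vec_tangent[OF c] by simp
    qed
    have "xi X = xi (coord_vec A c p (X c))" using coord_vec_eq[OF c True] by simp
    also have "\<dots> = xi (coord_vec A c p (\<Sum>k\<in>UNIV. X c $ k *\<^sub>R axis k 1))"
      using vec_axis_expansion[of "X c"] by simp
    also have "\<dots> = (\<Sum>k\<in>UNIV. X c $ k *\<^sub>R xi (coord_vec A c p (axis k 1)))"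
      using linear_sum[OF lin, of "\<lambda>k. X c $ k *\<^sub>R axis k 1" UNIV] linear_cmul[OF lin] by simp
    finally show ?thesis using True by (simp add: covector_def inner_vec_def mult.commute)
  next
    case False
    then show ?thesis using xi by (simp add: cotangent_space_def covector_def)
  qed
qed

lemma fst_cotangent_chart:
  "fst (cotangent_chart A c) = {P. fst P \<in> fst c \<and> snd P \<in> cotangent_space A (fst P)}"
  by (auto simp: cotangent_chart_def)

lemma cotangent_chart_domain:
  "P \<in> fst (cotangent_chart A c) \<longleftrightarrow> fst P \<in> fst c \<and> snd P \<in> cotangent_space A (fst P)"
  by (auto simp: cotangent_chart_def)

lemma cotangent_chart_apply:
  "snd (cotangent_chart A c) (p, xi) = cplx (snd c p) (\<chi> k. xi (coord_vec A c p (axis k 1)))"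
  by (simp add: cotangent_chart_def vec_eq_iff)

lemma cotangent_chart_covector:
  assumes "c \<in> charts_at A p"
  shows "snd (cotangent_chart A c) (p, covector c p y) = cplx (snd c p) y"
  unfolding cotangent_chart_apply using assms by (simp add: covector_coord_vec inner_axis vec_eq_iff)

lemma cotangent_chart_image:
  assumes c: "c \<in> charts A" and W: "W \<subseteq> fst c"
  shows "snd (cotangent_chart A c) ` {P. fst P \<in> W \<and> snd P \<in> cotangent_space A (fst P)}
    = {z. re_part z \<in> snd c ` W}"
proof (intro equalityI subsetI)
  fix z assume "z \<in> {z. re_part z \<in> snd c ` W}"
  then obtain p where p: "p \<in> W" "re_part z = snd c p" by auto
  then have "c \<in> charts_at A p" using c W by (auto simp: charts_at_def)
  then have "z = snd (cotangent_chart A c) (p, covector c p (im_part z))"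
    by (simp add: cotangent_chart_covector flip: p(2))
  then show "z \<in> snd (cotangent_chart A c) ` {P. fst P \<in> W \<and> snd P \<in> cotangent_space A (fst P)}"
    using p covector_in by (intro image_eqI[of _ _ "(p, covector c p (im_part z))"]) auto
qed (auto simp: cotangent_chart_apply)

lemma open_re_part: "open S \<Longrightarrow> open {z. re_part z \<in> S}"
  using open_vimage[of S re_part, OF _ linear_continuous_on[OF bounded_linear_re_part]]
  by (simp add: vimage_def)

lemma cotangent_chart_is_chart:
  assumes c: "c \<in> charts A"
  shows "is_chart (cotangent_chart A c)"
proof -
  have "is_chart c" using c by (rule charts_is_chart)
  have "inj_on (snd (cotangent_chart A c)) (fst (cotangent_chart A c))"
  proof (rule inj_onI)
    fix P P' assume P: "P \<in> fst (cotangent_chart A c)" "P' \<in> fst (cotangent_chart A c)"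
      and eq: "snd (cotangent_chart A c) P = snd (cotangent_chart A c) P'"
    obtain p xi p' xi' where P_eq: "P = (p, xi)" "P' = (p', xi')" by fastforce
    have in_c: "p \<in> fst c" "p' \<in> fst c" and co: "xi \<in> cotangent_space A p" "xi' \<in> cotangent_space A p'"
      using P P_eq by (auto simp: cotangent_chart_domain)
    have e: "snd c p = snd c p'" "(\<chi> k. xi (coord_vec A c p (axis k 1))) = (\<chi> k. xi' (coord_vec A c p' (axis k 1)))"
      using eq unfolding P_eq cotangent_chart_apply by (metis re_part_cplx, metis im_part_cplx)
    then have p: "p = p'" using in_c \<open>is_chart c\<close> by (auto simp: is_chart_def dest: inj_onD)
    have "c \<in> charts_at A p" using c in_c by (auto simp: charts_at_def)
    then have "xi = xi'" using cotangent_eq[of c p xi] cotangent_eq[of c p xi'] co e(2) p by simp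
    then show "P = P'" using p P_eq by simp
  qed
  moreover have "chart_image (cotangent_chart A c) = {z. re_part z \<in> snd c ` fst c}"
    using cotangent_chart_image[OF c, of "fst c"] by (simp add: chart_image_def fst_cotangent_chart)
  moreover have "open {z. re_part z \<in> snd c ` fst c}"
    using \<open>is_chart c\<close> unfolding is_chart_def chart_image_def by (intro open_re_part) simp
  ultimately show ?thesis by (simp add: is_chart_def)
qed

text \<open>The new k-th component is the covector evaluated on the k-th coordinate vector of
  \<open>c'\<close>, whose \<open>c\<close>-coordinates are given by the differential of the reverse
  transition. Hence the derivative runs from \<open>c'\<close> to \<open>c\<close>.\<close>

lemma cotangent_transition:
  assumes c: "c \<in> charts_at A p" and c': "c' \<in> charts_at A p" and z: "re_part z = snd c p"
  shows "transition (cotangent_chart A c) (cotangent_chart A c') z =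
    cplx (transition c c' (re_part z))
     (\<chi> k. im_part z \<bullet> frechet_derivative (transition c' c) (at (transition c c' (re_part z))) (axis k 1))"
proof -
  note ch = charts_atD[OF c] charts_atD[OF c']
  let ?P = "(p, covector c p (im_part z))"
  have P: "?P \<in> fst (cotangent_chart A c)" using ch by (simp add: cotangent_chart_domain covector_in)
  have "z = snd (cotangent_chart A c) ?P" using c by (simp add: cotangent_chart_covector flip: z)
  then have "transition (cotangent_chart A c) (cotangent_chart A c') z = snd (cotangent_chart A c') ?P"
    using P cotangent_chart_is_chart ch(1) by (metis transition_apply)
  also have "\<dots> = cplx (snd c' p)
    (\<chi> k. im_part z \<bullet> frechet_derivative (transition c' c) (at (snd c' p)) (axis k 1))"
    unfolding cotangent_chart_apply covector_def using coord_vec_tangent[OF c'] c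
    by (simp add: coord_vec_def)
  also have "snd c' p = transition c c' (re_part z)" using ch by (simp add: z)
  finally show ?thesis .
qed

text \<open>The fibre part of the transition contains the first derivative of a transition map of
  the base; as the latter is smooth, the lost derivative does no harm.\<close>

lemma cotangent_compatible:
  assumes c: "c \<in> charts A" "c' \<in> charts A"
  shows "open (snd (cotangent_chart A c) ` (fst (cotangent_chart A c) \<inter> fst (cotangent_chart A c')))"
    and "smooth_on (snd (cotangent_chart A c) ` (fst (cotangent_chart A c) \<inter> fst (cotangent_chart A c')))
      (transition (cotangent_chart A c) (cotangent_chart A c'))"
proof -
  let ?O = "snd c ` (fst c \<inter> fst c')" and ?O' = "snd c' ` (fst c' \<inter> fst c)"
  let ?S = "{z. re_part z \<in> ?O}"
  have ch: "is_chart c" "is_chart c'" using c charts_is_chart by blast+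
  note cc = charts_compatible[OF c] charts_compatible[OF c(2,1)]
  have "fst (cotangent_chart A c) \<inter> fst (cotangent_chart A c')
    = {P. fst P \<in> fst c \<inter> fst c' \<and> snd P \<in> cotangent_space A (fst P)}"
    unfolding fst_cotangent_chart by blast
  then have S: "snd (cotangent_chart A c) ` (fst (cotangent_chart A c) \<inter> fst (cotangent_chart A c')) = ?S"
    using cotangent_chart_image[OF c(1), of "fst c \<inter> fst c'"] by simp
  have oS: "open ?S" by (rule open_re_part[OF cc(1)])
  then show "open (snd (cotangent_chart A c) ` (fst (cotangent_chart A c) \<inter> fst (cotangent_chart A c')))"
    unfolding S .
  have phi: "smooth_on ?S (\<lambda>z. transition c c' (re_part z))"
    by (rule smooth_on_compose[OF oS cc(1), where f = re_part and g = "transition c c'"])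
      (auto intro: smooth_on_linear[OF bounded_linear_re_part oS] cc)
  have D: "smooth_on ?S (\<lambda>z. frechet_derivative (transition c' c) (at (transition c c' (re_part z))) v)" for v
  proof (rule smooth_on_compose[OF oS cc(3), where f = "\<lambda>z. transition c c' (re_part z)"
        and g = "\<lambda>x. frechet_derivative (transition c' c) (at x) v"])
    show "(\<lambda>z. transition c c' (re_part z)) ` ?S \<subseteq> ?O'"
      using ch by auto
    show "smooth_on ?O' (\<lambda>x. frechet_derivative (transition c' c) (at x) v)"
      by (rule smooth_on_derivative(2)[OF cc(3,4)])
  qed (rule phi)
  have pair: "smooth_on ?S (\<lambda>z. f z \<bullet> g z)" if "smooth_on ?S f" "smooth_on ?S g" for f g :: "complex^'n \<Rightarrow> real^'n"
  proof -
    have "smooth_on ?S (\<lambda>z. \<Sum>k\<in>UNIV. f z $ k *\<^sub>R g z $ k)"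
      using that by (intro smooth_on_sum smooth_on_scaleR oS smooth_on_linear_compose[OF bounded_linear_vec_nth])
    then show ?thesis by (simp add: inner_vec_def)
  qed
  have "smooth_on ?S (\<lambda>z. cplx (transition c c' (re_part z))
     (\<chi> k. im_part z \<bullet> frechet_derivative (transition c' c) (at (transition c c' (re_part z))) (axis k 1)))"
    by (intro smooth_on_cplx smooth_on_vec_lambda pair oS phi D smooth_on_linear[OF bounded_linear_im_part])
  moreover have "transition (cotangent_chart A c) (cotangent_chart A c') z = cplx (transition c c' (re_part z))
     (\<chi> k. im_part z \<bullet> frechet_derivative (transition c' c) (at (transition c c' (re_part z))) (axis k 1))"
    if "z \<in> ?S" for z
    using that c by (auto simp: charts_at_def intro: cotangent_transition)
  ultimately have "smooth_on ?S (transition (cotangent_chart A c) (cotangent_chart A c'))"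
    using smooth_on_cong[of ?S "transition (cotangent_chart A c) (cotangent_chart A c')"
      "\<lambda>z. cplx (transition c c' (re_part z))
     (\<chi> k. im_part z \<bullet> frechet_derivative (transition c' c) (at (transition c c' (re_part z))) (axis k 1))"]
    by blast
  then show "smooth_on (snd (cotangent_chart A c) ` (fst (cotangent_chart A c) \<inter> fst (cotangent_chart A c')))
      (transition (cotangent_chart A c) (cotangent_chart A c'))"
    unfolding S .
qed

lemma cotangent_smooth_atlas: "smooth_atlas cotangent_atlas"
proof -
  have "compatible (cotangent_chart A c) (cotangent_chart A c')" if "c \<in> charts A" "c' \<in> charts A" for c c'
    using cotangent_compatible[OF that] cotangent_compatible[OF that(2,1)]
    by (simp add: compatible_def Int_commute)
  then show ?thesis
    using cotangent_chart_is_chart unfolding smooth_atlas_def cotangent_bundle_def by blast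
qed

end

sublocale base_atlas \<subseteq> T: atlas "cotangent_bundle A"
  by unfold_locales (rule cotangent_smooth_atlas)

context base_atlas begin

lemma points_cotangent_bundle:
  "P \<in> points cotangent_atlas \<longleftrightarrow> fst P \<in> points A \<and> snd P \<in> cotangent_space A (fst P)"
proof -
  have "fst P \<in> points A \<longleftrightarrow> (\<exists>c\<in>charts A. fst P \<in> fst c)"
    using atlas_subset_charts charts_points unfolding points_def by blast
  then show ?thesis
    unfolding cotangent_bundle_def points_def[of "cotangent_chart A ` charts A"]
    by (simp add: fst_cotangent_chart)
qed

lemma cotangent_chart_at:
  assumes "c \<in> charts_at A (fst P)" "snd P \<in> cotangent_space A (fst P)"
  shows "cotangent_chart A c \<in> charts_at cotangent_atlas P"
  using assms T.atlas_subset_charts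
  unfolding charts_at_def cotangent_bundle_def by (auto simp: cotangent_chart_domain)

end


section \<open>The Calabi--Yau structure\<close>

locale flat_atlas = base_atlas A for A :: "('a, real^'n) chart set" +
  fixes B :: "('a, real^'n) chart set"
  assumes B_charts: "B \<subseteq> charts A"
    and B_points: "points B = points A"
    and B_derivative: "\<And>c c' p. c \<in> B \<Longrightarrow> c' \<in> B \<Longrightarrow> p \<in> fst c \<Longrightarrow> p \<in> fst c' \<Longrightarrow>
      frechet_derivative (transition c c') (at (snd c p)) = id"
begin

text \<open>One flat chart is chosen at each point so that the structures below can be defined
  pointwise. The choice is immaterial by \<open>tangent_flat\<close> on the base and by
  \<open>flat_cotangent_chart_coord\<close> on the bundle.\<close>

definition flat_chart :: "'a \<Rightarrow> ('a, real^'n) chart" where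
  "flat_chart p = (SOME b. b \<in> B \<and> p \<in> fst b)"

definition flat_cotangent_chart ::
  "('a, 'n) cotangent_point \<Rightarrow> (('a, 'n) cotangent_point, complex^'n) chart" where
  "flat_cotangent_chart P = cotangent_chart A (flat_chart (fst P))"

definition J0 :: "(('a, 'n) cotangent_point, complex^'n) endo_field" where
  "J0 P u = coord_vec cotangent_atlas (flat_cotangent_chart P) P (\<i> *s u (flat_cotangent_chart P))"

definition omega0 :: "(('a, 'n) cotangent_point, complex^'n) two_form" where
  "omega0 P u v = re_part (u (flat_cotangent_chart P)) \<bullet> im_part (v (flat_cotangent_chart P))
     - im_part (u (flat_cotangent_chart P)) \<bullet> re_part (v (flat_cotangent_chart P))"

definition Omega0 :: "(('a, 'n) cotangent_point, complex^'n, 'n) complex_n_form" where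
  "Omega0 P v = det (\<chi> j k. v k (flat_cotangent_chart P) $ j)"

lemma flat_chart_in:
  assumes "p \<in> points A"
  shows "flat_chart p \<in> B" "p \<in> fst (flat_chart p)" "flat_chart p \<in> charts_at A p"
proof -
  have "\<exists>b. b \<in> B \<and> p \<in> fst b" using assms B_points unfolding points_def by blast
  then show *: "flat_chart p \<in> B" "p \<in> fst (flat_chart p)"
    unfolding flat_chart_def by (metis (mono_tags, lifting) someI_ex)+
  then show "flat_chart p \<in> charts_at A p" using B_charts unfolding charts_at_def by blast
qed

lemma B_charts_at: "b \<in> B \<Longrightarrow> p \<in> fst b \<Longrightarrow> b \<in> charts_at A p"
  using B_charts unfolding charts_at_def by blast

lemma tangent_flat:
  assumes "X \<in> tangent_space A p" "b \<in> B" "b' \<in> B" "p \<in> fst b" "p \<in> fst b'"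
  shows "X b = X b'"
  using tangent_change[OF B_charts_at[OF assms(2,4)] B_charts_at[OF assms(3,5)] assms(1)]
    B_derivative[OF assms(2-5)] by simp

text \<open>In general the differential of a cotangent transition involves second derivatives of the
  base transition. Here the base differential is \<open>id\<close> on the whole overlap, not just at
  one point, so the map is x + i y to \<tau>(x) + i y nearby and no such term arises.\<close>

lemma cotangent_transition_derivative:
  assumes b: "b \<in> B" "b' \<in> B" "P \<in> fst (cotangent_chart A b)" "P \<in> fst (cotangent_chart A b')"
  shows "frechet_derivative (transition (cotangent_chart A b) (cotangent_chart A b'))
    (at (snd (cotangent_chart A b) P)) = id"
proof -
  obtain p xi where P: "P = (p, xi)" by fastforce
  have p: "p \<in> fst b" "p \<in> fst b'" using b by (auto simp: P cotangent_chart_domain)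
  note c = B_charts_at[OF b(1) p(1)] B_charts_at[OF b(2) p(2)]
  note ch = charts_atD[OF c(1)] charts_atD[OF c(2)]
  let ?S = "{z. re_part z \<in> snd b ` (fst b \<inter> fst b')}"
  let ?z = "snd (cotangent_chart A b) P"
  have z: "re_part ?z = snd b p" by (simp add: P cotangent_chart_apply)
  have S: "open ?S" "?z \<in> ?S"
    using open_re_part[OF charts_compatible(1)[OF ch(1,4)]] z p by auto
  have d: "(transition b b' has_derivative id) (at (re_part ?z))"
    using transition_has_derivative[OF c] B_derivative[OF b(1,2) p] by (simp add: z)
  have "((\<lambda>z. transition b b' (re_part z)) has_derivative (\<lambda>u. id (re_part u))) (at ?z)"
    by (rule has_derivative_compose[where f = re_part and g = "transition b b'", OF _ d]) (rule bounded_linear_imp_has_derivative[OF bounded_linear_re_part])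
  then have "((\<lambda>z. cplx (transition b b' (re_part z)) 0 + cplx 0 (im_part z))
      has_derivative (\<lambda>u. cplx (id (re_part u)) 0 + cplx 0 (im_part u))) (at ?z)"
    by (intro has_derivative_add bounded_linear.has_derivative[OF bounded_linear_cplx_left]
        bounded_linear.has_derivative[OF bounded_linear_cplx_right]
        bounded_linear_imp_has_derivative[OF bounded_linear_im_part])
  then have "((\<lambda>z. cplx (transition b b' (re_part z)) (im_part z)) has_derivative id) (at ?z)"
    by (simp add: cplx_add[symmetric] id_def)
  then have "(transition (cotangent_chart A b) (cotangent_chart A b') has_derivative id) (at ?z)"
  proof (rule has_derivative_transform_within_open[OF _ S])
    fix z assume "z \<in> ?S"
    then obtain q where q: "re_part z = snd b q" "q \<in> fst b" "q \<in> fst b'" by auto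
    note c = B_charts_at[OF b(1) q(2)] B_charts_at[OF b(2) q(3)]
    have "(\<chi> k. im_part z \<bullet> axis k 1) = im_part z" by (simp add: vec_eq_iff inner_axis)
    then show "cplx (transition b b' (re_part z)) (im_part z) = transition (cotangent_chart A b) (cotangent_chart A b') z"
      using cotangent_transition[OF c q(1)] B_derivative[OF b(2,1) q(3,2)] charts_atD[OF c(1)] q by simp
  qed
  then show ?thesis using frechet_derivative_at by metis
qed

lemma cotangent_point_fst: "P \<in> points cotangent_atlas \<Longrightarrow> fst P \<in> points A"
  by (simp add: points_cotangent_bundle)

lemma flat_cotangent_chart_at:
  assumes "P \<in> points cotangent_atlas"
  shows "flat_cotangent_chart P \<in> charts_at cotangent_atlas P"
  using assms flat_chart_in(3) cotangent_chart_at
  by (simp add: flat_cotangent_chart_def points_cotangent_bundle)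

text \<open>It makes \<open>J0\<close>, \<open>omega0\<close> and \<open>Omega0\<close> constant in
  the coordinates of each flat chart, although they are defined through a choice at every
  point.\<close>

lemma flat_cotangent_chart_coord:
  assumes "b \<in> B" "P \<in> fst (cotangent_chart A b)" "u \<in> tangent_space cotangent_atlas P"
  shows "u (flat_cotangent_chart P) = u (cotangent_chart A b)"
proof -
  have c: "cotangent_chart A b \<in> charts_at cotangent_atlas P"
    using assms B_charts_at by (intro cotangent_chart_at) (auto simp: cotangent_chart_domain)
  have P: "P \<in> points cotangent_atlas" by (rule T.charts_points[OF T.charts_atD(1,2)[OF c]])
  note c' = flat_cotangent_chart_at[OF P]
  show ?thesis
    using T.tangent_change[OF c c' assms(3)]
      cotangent_transition_derivative[OF assms(1) flat_chart_in(1)[OF cotangent_point_fst[OF P]] assms(2)]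
      T.charts_atD(2)[OF c'] by (simp add: flat_cotangent_chart_def)
qed

lemma J0_coord:
  assumes "P \<in> points cotangent_atlas"
  shows "J0 P u \<in> tangent_space cotangent_atlas P"
    "J0 P u (flat_cotangent_chart P) = \<i> *s u (flat_cotangent_chart P)"
  using flat_cotangent_chart_at[OF assms] by (auto simp: J0_def)

lemma lincomb_apply: "lincomb a u b v c = a *\<^sub>R u c + b *\<^sub>R v c"
  by (simp add: lincomb_def)

lemma almost_complex_J0: "almost_complex cotangent_atlas J0"
  unfolding almost_complex_def
proof (intro ballI conjI allI)
  fix P and u :: "(('a, 'n) cotangent_point, complex^'n) tvec"
  assume P: "P \<in> points cotangent_atlas" and u: "u \<in> tangent_space cotangent_atlas P"
  note c = flat_cotangent_chart_at[OF P]
  show "J0 P u \<in> tangent_space cotangent_atlas P" by (rule J0_coord[OF P])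
  have m: "(\<lambda>c. - u c) = lincomb (-1) u 0 u" by (simp add: lincomb_def)
  show "J0 P (J0 P u) = (\<lambda>c. - u c)"
    unfolding m
    by (rule T.tangent_eqI[OF c J0_coord(1)[OF P] T.tangent_lincomb[OF u u]])
      (simp add: J0_coord[OF P] lincomb_apply vec_eq_iff)
  fix v :: "(('a, 'n) cotangent_point, complex^'n) tvec" and a b
  assume v: "v \<in> tangent_space cotangent_atlas P"
  show "J0 P (lincomb a u b v) = lincomb a (J0 P u) b (J0 P v)"
    by (rule T.tangent_eqI[OF c J0_coord(1)[OF P] T.tangent_lincomb[OF J0_coord(1)[OF P] J0_coord(1)[OF P]]])
      (simp add: J0_coord[OF P] lincomb_apply vec_eq_iff algebra_simps scaleR_conv_of_real)
qed

lemma holomorphic_chart_flat: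
  assumes "b \<in> B"
  shows "holomorphic_chart cotangent_atlas J0 (cotangent_chart A b)"
  unfolding holomorphic_chart_def
proof (intro conjI ballI)
  have "b \<in> charts A" using assms B_charts by blast
  then show C: "cotangent_chart A b \<in> charts cotangent_atlas"
    using T.atlas_subset_charts unfolding cotangent_bundle_def by blast
  fix P and u :: "(('a, 'n) cotangent_point, complex^'n) tvec"
  assume P: "P \<in> fst (cotangent_chart A b)" and u: "u \<in> tangent_space cotangent_atlas P"
  have "P \<in> points cotangent_atlas" using T.charts_points[OF C P] .
  note J = J0_coord[OF this, of u]
  show "J0 P u (cotangent_chart A b) = \<i> *s u (cotangent_chart A b)"
    using J(2) flat_cotangent_chart_coord[OF assms P J(1)] flat_cotangent_chart_coord[OF assms P u] by simp
qed

lemma complex_structure_J0: "complex_structure cotangent_atlas J0"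
  unfolding complex_structure_def
  using almost_complex_J0 holomorphic_chart_flat flat_chart_in(1) cotangent_point_fst
    T.charts_atD(2)[OF flat_cotangent_chart_at]
  unfolding flat_cotangent_chart_def by blast

lemma omega0_flat:
  assumes "b \<in> B" "P \<in> fst (cotangent_chart A b)"
    "u \<in> tangent_space cotangent_atlas P" "v \<in> tangent_space cotangent_atlas P"
  shows "omega0 P u v = re_part (u (cotangent_chart A b)) \<bullet> im_part (v (cotangent_chart A b))
     - im_part (u (cotangent_chart A b)) \<bullet> re_part (v (cotangent_chart A b))"
  unfolding omega0_def flat_cotangent_chart_coord[OF assms(1-3)] flat_cotangent_chart_coord[OF assms(1,2,4)] ..

lemma re_part_linear: "re_part (a *\<^sub>R u + b *\<^sub>R v) = a *\<^sub>R re_part u + b *\<^sub>R re_part v"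
  and im_part_linear: "im_part (a *\<^sub>R u + b *\<^sub>R v) = a *\<^sub>R im_part u + b *\<^sub>R im_part v"
  and re_part_ii: "re_part (\<i> *s u) = - im_part u"
  and im_part_ii: "im_part (\<i> *s u) = re_part u"
  by (simp_all add: vec_eq_iff)

text \<open>In a flat cotangent chart the coefficients of \<open>omega0\<close> are constant, so
  each of the three derivatives vanishes.\<close>

lemma closed_omega0: "closed_two_form cotangent_atlas omega0"
  unfolding closed_two_form_def
proof (intro conjI ballI allI)
  fix P and u v w :: "(('a, 'n) cotangent_point, complex^'n) tvec" and a b
  show "omega0 P u u = 0" by (simp add: omega0_def inner_commute)
  show "omega0 P (lincomb a u b v) w = a * omega0 P u w + b * omega0 P v w"
    "omega0 P w (lincomb a u b v) = a * omega0 P w u + b * omega0 P w v"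
    by (simp_all add: omega0_def lincomb_apply re_part_linear im_part_linear inner_simps algebra_simps)
next
  fix P assume P: "P \<in> points cotangent_atlas"
  let ?C = "flat_cotangent_chart P"
  have b: "flat_chart (fst P) \<in> B" using flat_chart_in(1)[OF cotangent_point_fst[OF P]] .
  have C: "?C \<in> charts_at cotangent_atlas P" using flat_cotangent_chart_at[OF P] .
  \<comment> \<open>The flat chart chosen at the moving point may differ from \<open>?C\<close>;
    \<open>omega0_flat\<close> allows the evaluation in \<open>?C\<close> all the same.\<close>
  have const: "form_coords cotangent_atlas omega0 ?C x u v = re_part u \<bullet> im_part v - im_part u \<bullet> re_part v"
    if "x \<in> chart_image ?C" for x u v
  proof -
    let ?Q = "inv_chart ?C x"
    have Q: "?Q \<in> fst ?C" using inv_chart_right[OF that] by simp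
    then have CQ: "?C \<in> charts_at cotangent_atlas ?Q" using T.charts_atD(1)[OF C] by (simp add: charts_at_def)
    show ?thesis
      using omega0_flat[OF b Q[unfolded flat_cotangent_chart_def],
          of "coord_vec cotangent_atlas ?C ?Q u" "coord_vec cotangent_atlas ?C ?Q v"] CQ
      by (simp add: form_coords_def Let_def T.coord_vec_tangent flip: flat_cotangent_chart_def)
  qed
  have op: "open (chart_image ?C)" using T.charts_atD(3)[OF C] by (simp add: is_chart_def)
  have sm: "smooth_on (chart_image ?C) (\<lambda>x. form_coords cotangent_atlas omega0 ?C x u v)" for u v
    using smooth_on_cong[of "chart_image ?C" "\<lambda>x. form_coords cotangent_atlas omega0 ?C x u v"
      "\<lambda>x. re_part u \<bullet> im_part v - im_part u \<bullet> re_part v"] const op by simp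
  have D: "frechet_derivative (\<lambda>y. form_coords cotangent_atlas omega0 ?C y u v) (at x) = (\<lambda>_. 0)"
    if "x \<in> chart_image ?C" for x u v
  proof -
    have "((\<lambda>y. form_coords cotangent_atlas omega0 ?C y u v) has_derivative (\<lambda>_. 0)) (at x)"
      by (rule has_derivative_transform_within_open[OF has_derivative_const op that])
        (simp add: const)
    then show ?thesis by (metis frechet_derivative_at)
  qed
  show "\<exists>c\<in>charts_at cotangent_atlas P.
      (\<forall>u v. smooth_on (chart_image c) (\<lambda>x. form_coords cotangent_atlas omega0 c x u v)) \<and>
      (\<forall>x\<in>chart_image c. \<forall>u v w.
            frechet_derivative (\<lambda>y. form_coords cotangent_atlas omega0 c y v w) (at x) u
          - frechet_derivative (\<lambda>y. form_coords cotangent_atlas omega0 c y u w) (at x) v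
          + frechet_derivative (\<lambda>y. form_coords cotangent_atlas omega0 c y u v) (at x) w = 0)"
    using C sm D by (intro bexI[of _ ?C]) auto
qed

text \<open>In flat coordinates \<omega>(u, i u) is the squared length of the real part plus that of
  the imaginary part; the sign in \<open>omega0\<close> is fixed by this.\<close>

lemma kaehler_omega0: "kaehler cotangent_atlas J0 omega0"
  unfolding kaehler_def
proof (intro conjI ballI impI)
  fix P and u v :: "(('a, 'n) cotangent_point, complex^'n) tvec"
  assume P: "P \<in> points cotangent_atlas" and u: "u \<in> tangent_space cotangent_atlas P"
  note c = flat_cotangent_chart_at[OF P]
  show "omega0 P (J0 P u) (J0 P v) = omega0 P u v"
    by (simp add: omega0_def J0_coord[OF P] re_part_ii im_part_ii inner_commute)
  assume "u \<noteq> (\<lambda>_. 0)"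
  then have "u (flat_cotangent_chart P) \<noteq> 0"
    using T.coord_vec_eq[OF c u] T.coord_vec_lincomb[OF c, of 0 0 0 0]
    by (auto simp: lincomb_def)
  then have "re_part (u (flat_cotangent_chart P)) \<noteq> 0 \<or> im_part (u (flat_cotangent_chart P)) \<noteq> 0"
    by (metis cplx_parts cplx_add add.right_neutral bounded_linear_cplx_right linear_0 bounded_linear.linear)
  then show "omega0 P u (J0 P u) > 0"
    by (auto simp: omega0_def J0_coord[OF P] re_part_ii im_part_ii intro: add_pos_nonneg add_nonneg_pos)
qed (rule complex_structure_J0 closed_omega0)+

lemma Omega0_flat:
  assumes "b \<in> B" "P \<in> fst (cotangent_chart A b)" "\<And>k. v k \<in> tangent_space cotangent_atlas P"
  shows "Omega0 P v = det (\<chi> j k. v k (cotangent_chart A b) $ j)"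
  unfolding Omega0_def using flat_cotangent_chart_coord[OF assms(1,2) assms(3)] by simp

lemma calabi_yau_0: "calabi_yau cotangent_atlas J0 omega0 Omega0"
  unfolding calabi_yau_def holomorphic_n_form_def
proof (intro conjI ballI)
  fix P assume P: "P \<in> points cotangent_atlas"
  let ?C = "flat_cotangent_chart P"
  have b: "flat_chart (fst P) \<in> B" using flat_chart_in(1)[OF cotangent_point_fst[OF P]] .
  note c = flat_cotangent_chart_at[OF P]
  show "\<exists>c F. P \<in> fst c \<and> holomorphic_chart cotangent_atlas J0 c \<and>
        holomorphic_function_on (chart_image c) F \<and>
        (\<forall>q\<in>fst c. \<forall>v. (\<forall>k. v k \<in> tangent_space cotangent_atlas q) \<longrightarrow>
            Omega0 q v = F (snd c q) * det (\<chi> j k. v k c $ j))"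
    using T.charts_atD(2)[OF c] holomorphic_chart_flat[OF b] Omega0_flat[OF b]
    unfolding flat_cotangent_chart_def
    \<comment> \<open>The holomorphic coefficient with respect to flat coordinates is the constant
      1.\<close>
    by (intro exI[of _ "cotangent_chart A (flat_chart (fst P))"] exI[of _ "\<lambda>_. 1"])
      (simp add: holomorphic_function_on_def)
  \<comment> \<open>The coordinate vectors of the flat chart witness that the form does not
    vanish.\<close>
  have "(\<chi> j k. coord_vec cotangent_atlas ?C P (axis k 1) ?C $ j) = mat 1"
    using c by (simp add: mat_def axis_def vec_eq_iff)
  then have "Omega0 P (\<lambda>k. coord_vec cotangent_atlas ?C P (axis k 1)) = 1"
    by (simp add: Omega0_def)
  then show "\<exists>v. (\<forall>k. v k \<in> tangent_space cotangent_atlas P) \<and> Omega0 P v \<noteq> 0"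
    using c by (intro exI[of _ "\<lambda>k. coord_vec cotangent_atlas ?C P (axis k 1)"]) auto
qed (rule kaehler_omega0)

text \<open>The differentials \<open>id\<close> have determinant 1, so a parallelizing atlas is
  already an oriented one.\<close>

lemma orientation_flat: "orientation A B"
proof -
  have "matrix (id :: real^'n \<Rightarrow> real^'n) = mat 1"
    by (simp add: matrix_def mat_def axis_def vec_eq_iff)
  then show ?thesis
    unfolding orientation_def using B_charts B_points B_derivative by (auto simp: matrix_def)
qed

end


section \<open>The Hessian in flat coordinates\<close>

lemma at_within_Int_nhd: "open N \<Longrightarrow> x \<in> N \<Longrightarrow> at x within (S \<inter> N) = at x within S"
  by (rule at_within_nhd[of x N]) auto

text \<open>Two charts are comparable only near the point, while the domain \<open>S\<close> may be
  a strip with boundary; equality on \<open>S \<inter> N\<close> is then all there is.\<close>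

lemma has_derivative_transform_nhd:
  assumes "(f has_derivative D) (at x within S)" "open N" "x \<in> N" "x \<in> S"
    and "\<And>y. y \<in> S \<inter> N \<Longrightarrow> g y = f y"
  shows "(g has_derivative D) (at x within S)"
proof -
  have "(f has_derivative D) (at x within (S \<inter> N))"
    using assms(1) unfolding at_within_Int_nhd[OF assms(2,3)] .
  then have "(g has_derivative D) (at x within (S \<inter> N))"
    by (rule has_derivative_transform[rotated 2]) (use assms in auto)
  then show ?thesis unfolding at_within_Int_nhd[OF assms(2,3)] .
qed

text \<open>
  A metric of the form \<open>\<langle>P u, P v\<rangle>\<close> with \<open>P\<close> the differential of a coordinate change into flat
  coordinates: \<open>Q\<close> is the second derivative of that coordinate change, and \<open>P \<Gamma> = Q\<close>.
\<close>

lemma christoffel_pullback: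
  fixes P Q :: "'e::euclidean_space \<Rightarrow> 'e \<Rightarrow> 'e"
  assumes S: "unique_derivative_at S x" "x \<in> S" "open N" "x \<in> N"
    and G: "\<And>y u v. y \<in> S \<inter> N \<Longrightarrow> G y u v = P y u \<bullet> P y v"
    and dP: "\<And>w. ((\<lambda>y. P y w) has_derivative (\<lambda>v. Q v w)) (at x within S)"
    and sym: "\<And>v w. Q v w = Q w v"
    and bij: "bij (P x)"
  shows "P x (christoffel S G x v w) = Q v w"
proof -
  have dG: "dir_deriv S (\<lambda>_. v) (\<lambda>y. G y w z) x = P x w \<bullet> Q v z + Q v w \<bullet> P x z" for v w z
  proof -
    have "((\<lambda>y. P y w \<bullet> P y z) has_derivative (\<lambda>v. P x w \<bullet> Q v z + Q v w \<bullet> P x z)) (at x within S)"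
      by (rule has_derivative_inner[OF dP dP])
    then have "((\<lambda>y. G y w z) has_derivative (\<lambda>v. P x w \<bullet> Q v z + Q v w \<bullet> P x z)) (at x within S)"
      by (rule has_derivative_transform_nhd[OF _ S(3,4,2)]) (rule G)
    then show ?thesis unfolding dir_deriv_def using frechet_derivative_within_eq[OF S(1)] by metis
  qed
  obtain y where y: "P x y = Q v w" using bij by (metis bij_pointE)
  have Gx: "G x u v = P x u \<bullet> P x v" for u v using G S by blast
  \<comment> \<open>Six terms arise; by symmetry of \<open>Q\<close> four of them cancel in pairs
    and the other two are equal.\<close>
  have koszul: "dir_deriv S (\<lambda>_. v) (\<lambda>x'. G x' w z) x + dir_deriv S (\<lambda>_. w) (\<lambda>x'. G x' v z) x
        - dir_deriv S (\<lambda>_. z) (\<lambda>x'. G x' v w) x = 2 * (Q v w \<bullet> P x z)" for z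
    unfolding dG using sym[of w v] sym[of z v] sym[of z w] by (simp add: inner_commute)
  have "christoffel S G x v w = y"
    unfolding christoffel_def koszul Gx
  proof (rule the_equality)
    show "\<forall>z. 2 * (P x y \<bullet> P x z) = 2 * (Q v w \<bullet> P x z)" by (simp add: y)
    fix y' assume *: "\<forall>z. 2 * (P x y' \<bullet> P x z) = 2 * (Q v w \<bullet> P x z)"
    \<comment> \<open>Since \<open>P x\<close> is onto, the error vector itself can be used as test
      vector, which forces it to be zero.\<close>
    obtain z where z: "P x z = P x y' - Q v w" using bij by (metis bij_pointE)
    have "(P x y' - Q v w) \<bullet> (P x y' - Q v w) = 0"
      using *[rule_format, of z] unfolding z by (simp add: inner_diff_left)
    then have "P x y' = P x y" using y by simp
    then show "y' = y" by (rule injD[OF bij_is_inj[OF bij]])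
  qed
  then show ?thesis using y by simp
qed

text \<open>With \<open>u = u' \<circ> Phi\<close>, differentiating twice gives D(P W'(V) + Q(V, W))
  + E(P V, P W). Because P \<Gamma> = Q, the connection term is exactly the first summand, so only
  \<open>E\<close>, the second derivative of \<open>u'\<close> at the image point, survives.\<close>

lemma hessian_coords_pullback:
  fixes P Q :: "'e::euclidean_space \<Rightarrow> 'e \<Rightarrow> 'e" and E :: "'e \<Rightarrow> 'e \<Rightarrow> real"
  assumes S: "\<And>y. y \<in> S \<Longrightarrow> unique_derivative_at S y" "x \<in> S" "open N" "x \<in> N"
    and G: "\<And>y u v. y \<in> S \<inter> N \<Longrightarrow> G y u v = P y u \<bullet> P y v"
    and dP: "\<And>w. ((\<lambda>y. P y w) has_derivative (\<lambda>v. Q v w)) (at x within S)"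
    and sym: "\<And>v w. Q v w = Q w v"
    and bij: "bij (P x)"
    and Phi: "\<And>y. y \<in> S \<inter> N \<Longrightarrow> (Phi has_derivative P y) (at y within S)" "Phi ` (S \<inter> N) \<subseteq> S'"
    and u: "\<And>y. y \<in> S \<inter> N \<Longrightarrow> u y = u' (Phi y)"
    and du': "\<And>y. y \<in> S' \<Longrightarrow> (u' has_derivative D y) (at y within S')"
    and ddu': "\<And>b. ((\<lambda>y. D y b) has_derivative (\<lambda>v. E v b)) (at (Phi x) within S')"
    and symE: "\<And>v w. E v w = E w v"
    and W: "(W has_derivative W') (at x within S)"
  shows "hessian_coords S G u V W x = E (P x (V x)) (P x (W x))"
proof -
  have x: "x \<in> S \<inter> N" using S by simp
  have linP: "linear (P y)" if "y \<in> S \<inter> N" for y using Phi(1)[OF that] has_derivative_linear by blast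
  have linD: "linear (D y)" if "y \<in> S'" for y using du'[OF that] has_derivative_linear by blast
  \<comment> \<open>The derivative gives linearity in the first slot; symmetry transfers it to the
    second.\<close>
  have linQ: "linear (Q v)" for v 
  proof -
    have "(\<lambda>w. Q w v) = Q v" by (rule ext) (rule sym)
    then show ?thesis using has_derivative_linear[OF dP[of v]] by simp
  qed
  have linE: "linear (E v)" for v 
  proof -
    have "(\<lambda>w. E w v) = E v" by (rule ext) (rule symE)
    then show ?thesis using has_derivative_linear[OF ddu'[of v]] by simp
  qed
  have SN: "at y within (S \<inter> N) = at y within S" if "y \<in> N" for y
    by (rule at_within_Int_nhd[OF S(3) that])
  have du: "(u has_derivative (\<lambda>v. D (Phi y) (P y v))) (at y within S)" if y: "y \<in> S \<inter> N" for y
  proof -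
    have "(Phi has_derivative P y) (at y within (S \<inter> N))" using Phi(1)[OF y] SN y by simp
    from has_derivative_in_compose2[OF du' Phi(2) y this]
    have "((\<lambda>y. u' (Phi y)) has_derivative (\<lambda>v. D (Phi y) (P y v))) (at y within S)" using SN y by simp
    then show ?thesis by (rule has_derivative_transform_nhd[OF _ S(3)]) (use y u in auto)
  qed
  have du_eq: "frechet_derivative u (at y within S) = (\<lambda>v. D (Phi y) (P y v))" if "y \<in> S \<inter> N" for y
    using frechet_derivative_within_eq[OF S(1) du[OF that]] that by simp
  \<comment> \<open>The field \<open>W\<close> written in the flat coordinates.\<close>
  define Y where "Y y = P y (W y)" for y
  have dY: "(Y has_derivative (\<lambda>v. P x (W' v) + Q v (W x))) (at x within S)"
  proof -
    have "((\<lambda>y. \<Sum>b\<in>Basis. (W y \<bullet> b) *\<^sub>R P y b) has_derivative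
      (\<lambda>v. \<Sum>b\<in>Basis. (W x \<bullet> b) *\<^sub>R Q v b + (W' v \<bullet> b) *\<^sub>R P x b)) (at x within S)"
      by (intro has_derivative_sum has_derivative_scaleR dP has_derivative_inner_left W)
    then have "((\<lambda>y. \<Sum>b\<in>Basis. (W y \<bullet> b) *\<^sub>R P y b) has_derivative
      (\<lambda>v. P x (W' v) + Q v (W x))) (at x within S)"
      unfolding linear_Basis_expansion[OF linP[OF x], of "W' _"] linear_Basis_expansion[OF linQ, of _ "W x"]
      by (simp only: sum.distrib add.commute)
    then show ?thesis
      by (rule has_derivative_transform_nhd[OF _ S(3,4,2)])
        (simp only: Y_def linear_Basis_expansion[OF linP, symmetric])
  qed
  have dD: "((\<lambda>y. D (Phi y) b) has_derivative (\<lambda>v. E (P x v) b)) (at x within S)" for b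
  proof -
    have "(Phi has_derivative P x) (at x within (S \<inter> N))" using Phi(1)[OF x] SN x by simp
    moreover have "((\<lambda>y. D y b) has_derivative (\<lambda>v. E v b)) (at (Phi x) within Phi ` (S \<inter> N))"
      using ddu' Phi(2) by (rule has_derivative_subset)
    ultimately have "((\<lambda>y. D (Phi y) b) has_derivative (\<lambda>v. E (P x v) b)) (at x within (S \<inter> N))"
      by (rule has_derivative_in_compose)
    then show ?thesis using SN x by simp
  qed
  have ddu: "(dir_deriv S W u has_derivative (\<lambda>v. D (Phi x) (P x (W' v) + Q v (W x)) + E (P x v) (Y x)))
    (at x within S)"
  proof -
    have "((\<lambda>y. \<Sum>b\<in>Basis. (Y y \<bullet> b) *\<^sub>R D (Phi y) b) has_derivative
      (\<lambda>v. \<Sum>b\<in>Basis. (Y x \<bullet> b) *\<^sub>R E (P x v) b + ((P x (W' v) + Q v (W x)) \<bullet> b) *\<^sub>R D (Phi x) b)) (at x within S)"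
      by (intro has_derivative_sum has_derivative_scaleR dD has_derivative_inner_left dY)
    moreover have "(\<Sum>b\<in>Basis. (Y x \<bullet> b) *\<^sub>R E (P x v) b + ((P x (W' v) + Q v (W x)) \<bullet> b) *\<^sub>R D (Phi x) b)
      = D (Phi x) (P x (W' v) + Q v (W x)) + E (P x v) (Y x)" for v
    proof -
      have "linear (D (Phi x))" using Phi(2) x by (intro linD) auto
      then show ?thesis
        using linear_Basis_expansion[of "D (Phi x)" "P x (W' v) + Q v (W x)"]
          linear_Basis_expansion[OF linE, of "P x v" "Y x"] by (simp only: sum.distrib add.commute)
    qed
    ultimately have "((\<lambda>y. \<Sum>b\<in>Basis. (Y y \<bullet> b) *\<^sub>R D (Phi y) b) has_derivative
      (\<lambda>v. D (Phi x) (P x (W' v) + Q v (W x)) + E (P x v) (Y x))) (at x within S)" by simp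
    then show ?thesis
    proof (rule has_derivative_transform_nhd[OF _ S(3,4,2)])
      fix y assume y: "y \<in> S \<inter> N"
      have "linear (D (Phi y))" using Phi(2) y by (intro linD) auto
      then show "dir_deriv S W u y = (\<Sum>b\<in>Basis. (Y y \<bullet> b) *\<^sub>R D (Phi y) b)"
        unfolding dir_deriv_def du_eq[OF y] Y_def[symmetric] by (rule linear_Basis_expansion)
    qed
  qed
  have 1: "dir_deriv S V (dir_deriv S W u) x
    = D (Phi x) (P x (W' (V x)) + Q (V x) (W x)) + E (P x (V x)) (P x (W x))"
    unfolding dir_deriv_def[of S V "dir_deriv S W u"] frechet_derivative_within_eq[OF S(1)[OF S(2)] ddu] Y_def ..
  have "dir_deriv S V W x = W' (V x)"
    unfolding dir_deriv_def frechet_derivative_within_eq[OF S(1)[OF S(2)] W] ..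
  moreover have "P x (christoffel S G x (V x) (W x)) = Q (V x) (W x)"
    by (rule christoffel_pullback[OF S(1)[OF S(2)] S(2-4) G dP sym bij])
  ultimately have "P x (levi_civita S G V W x) = P x (W' (V x)) + Q (V x) (W x)"
    unfolding levi_civita_def using linear_add[OF linP[OF x]] by simp
  then have 2: "dir_deriv S (levi_civita S G V W) u x = D (Phi x) (P x (W' (V x)) + Q (V x) (W x))"
    unfolding dir_deriv_def[of S "levi_civita S G V W"] du_eq[OF x] by simp
  show ?thesis unfolding hessian_coords_def 1 2 by simp
qed


section \<open>Determinants\<close>

text \<open>The block matrix with corner \<open>\<alpha>\<close>, upper border
  \<open>\<beta>\<close>, left border \<open>\<gamma>\<close> and block \<open>K\<close>; the index
  \<open>None\<close> is the time direction, as in \<open>product_frame\<close>.\<close>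

definition bordered :: "'b \<Rightarrow> ('n \<Rightarrow> 'b) \<Rightarrow> ('n \<Rightarrow> 'b) \<Rightarrow> 'b^'n^'n \<Rightarrow> 'b^('n option)^('n::finite option)" where
  "bordered \<alpha> \<beta> \<gamma> K = (\<chi> a b. case a of
      None \<Rightarrow> (case b of None \<Rightarrow> \<alpha> | Some j \<Rightarrow> \<beta> j)
    | Some i \<Rightarrow> (case b of None \<Rightarrow> \<gamma> i | Some j \<Rightarrow> K $ i $ j))"

lemma sum_UNIV_option: "(\<Sum>a\<in>UNIV. f a) = f None + (\<Sum>i\<in>UNIV. f (Some i))"
  for f :: "'n::finite option \<Rightarrow> 'b::comm_monoid_add"
  by (simp add: UNIV_option_conv sum.reindex)

lemma prod_UNIV_option: "(\<Prod>a\<in>UNIV. f a) = f None * (\<Prod>i\<in>UNIV. f (Some i))"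
  for f :: "'n::finite option \<Rightarrow> 'b::comm_monoid_mult"
  by (simp add: UNIV_option_conv prod.reindex)

lemma permutes_range_Some:
  "p permutes range Some \<longleftrightarrow> p permutes (UNIV :: 'n option set) \<and> p None = None"
proof
  assume p: "p permutes range Some"
  then show "p permutes UNIV \<and> p None = None"
    using permutes_subset[OF p, of UNIV] permutes_not_in[OF p, of None] by auto
next
  assume p: "p permutes UNIV \<and> p None = None"
  have "p x = x" if "x \<in> UNIV - range Some" for x
    using p that by (cases x) auto
  then show "p permutes range Some"
    using permutes_superset[of p UNIV "range Some"] p by blast
qed

text \<open>In the Leibniz sum a permutation that moves \<open>None\<close> sends some
  \<open>Some i\<close> to \<open>None\<close> and meets a zero of the left border. Those fixing
  \<open>None\<close> are the permutations of the block, extended by \<open>map_permutation\<close>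
  with the same sign.\<close>

lemma det_bordered_triangular:
  fixes K :: "'b::comm_ring_1^'n^'n"
  shows "det (bordered \<alpha> \<beta> (\<lambda>_. 0) K) = \<alpha> * det K"
proof -
  let ?M = "bordered \<alpha> \<beta> (\<lambda>_. 0) K"
  let ?t = "\<lambda>p. of_int (sign p) * (\<Prod>a\<in>UNIV. ?M $ a $ p a)"
  have zero: "?t p = 0" if p: "p permutes UNIV" "p None \<noteq> None" for p
  proof -
    obtain a where a: "p a = None" using permutes_surj[OF p(1)] by (metis surj_def)
    then obtain i where i: "a = Some i" using p(2) by (cases a) auto
    have "?M $ a $ p a = 0" using a i by (simp add: bordered_def)
    then have "(\<Prod>a\<in>UNIV. ?M $ a $ p a) = 0" by (intro prod_zero) auto
    then show ?thesis by simp
  qed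
  have "det ?M = sum ?t {p. p permutes UNIV}" by (simp add: det_def)
  also have "\<dots> = sum ?t {p. p permutes range Some}"
    by (rule sum.mono_neutral_right) (use zero in \<open>auto simp: permutes_range_Some finite_permutations\<close>)
  also have "\<dots> = (\<Sum>q | q permutes UNIV. ?t (map_permutation UNIV Some q))"
    by (rule sum.reindex_bij_betw[symmetric])
      (use bij_betw_permutations[of Some UNIV "range Some"] in
        \<open>simp add: map_permutation_def restrict_id_def bij_betw_def[of Some]\<close>)
  also have "\<dots> = (\<Sum>q | q permutes UNIV. \<alpha> * (of_int (sign q) * (\<Prod>i\<in>UNIV. K $ i $ q i)))"
  proof (rule sum.cong)
    fix q :: "'n \<Rightarrow> 'n" assume "q \<in> {q. q permutes UNIV}"
    then have q: "q permutes UNIV" by simp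
    have s: "sign (map_permutation UNIV Some q) = sign q"
      by (rule sign_map_permutation) (use q in auto)
    have "map_permutation UNIV Some q None = None" by (simp add: map_permutation_def)
    moreover have "map_permutation UNIV Some q (Some i) = Some (q i)" for i
      by (simp add: map_permutation_apply)
    ultimately show "?t (map_permutation UNIV Some q) = \<alpha> * (of_int (sign q) * (\<Prod>i\<in>UNIV. K $ i $ q i))"
      by (simp add: s prod_UNIV_option bordered_def mult.left_commute)
  qed simp
  also have "\<dots> = \<alpha> * det K" by (simp add: det_def sum_distrib_left)
  finally show ?thesis .
qed

lemma det_bordered_unit:
  fixes y :: "'n::finite \<Rightarrow> 'b::comm_ring_1"
  shows "det (bordered 1 (\<lambda>_. 0) y (mat 1)) = 1"
proof -
  have "transpose (bordered 1 (\<lambda>_. 0) y (mat 1)) = bordered 1 y (\<lambda>_. 0) (mat 1)"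
    by (auto simp: transpose_def bordered_def vec_eq_iff mat_def split: option.splits)
  then show ?thesis using det_bordered_triangular[of 1 y "mat 1"] by (metis det_I det_transpose mult_1)
qed

text \<open>Clearing the first column with the solution \<open>y\<close> of \<open>K y = \<gamma>\<close>.\<close>

lemma det_bordered:
  fixes K :: "'b::comm_ring_1^'n^'n"
  assumes "K *v y = (\<chi> i. \<gamma> i)"
  shows "det (bordered \<alpha> \<beta> \<gamma> K) = (\<alpha> - (\<Sum>j\<in>UNIV. \<beta> j * y $ j)) * det K"
proof -
  let ?\<kappa> = "\<alpha> - (\<Sum>j\<in>UNIV. \<beta> j * y $ j)"
  have \<gamma>: "(\<Sum>j\<in>UNIV. K $ i $ j * y $ j) = \<gamma> i" for i
    using assms by (simp add: matrix_vector_mult_def vec_eq_iff)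
  \<comment> \<open>The right factor adds to the border column the combination of the block columns
    with coefficients \<open>y\<close>; \<open>?\<kappa>\<close> is the Schur complement.\<close>
  have "bordered \<alpha> \<beta> \<gamma> K = bordered ?\<kappa> \<beta> (\<lambda>_. 0) K ** bordered 1 (\<lambda>_. 0) (\<lambda>j. y $ j) (mat 1)"
    by (auto simp: vec_eq_iff matrix_matrix_mult_def sum_UNIV_option bordered_def mat_def \<gamma>
        if_distrib cong: if_cong split: option.splits)
  then show ?thesis by (simp add: det_mul det_bordered_triangular det_bordered_unit)
qed

definition cmat :: "real^'n^'m \<Rightarrow> complex^'n^'m" where
  "cmat V = (\<chi> i j. of_real (V $ i $ j))"

lemma det_cmat: "det (cmat V) = of_real (det V)"
  by (simp add: det_def cmat_def)

lemma det_conjugate: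
  fixes K V :: "'b::comm_ring_1^'n^'n"
  assumes "transpose V ** V = mat 1"
  shows "det (transpose V ** K ** V) = det K"
proof -
  have "det V * det V = 1" using assms by (metis det_I det_mul det_transpose)
  then show ?thesis by (simp add: det_mul det_transpose mult.assoc mult.left_commute)
qed

definition lag_matrix :: "('n \<Rightarrow> 'n \<Rightarrow> real) \<Rightarrow> complex^'n^'n::finite" where
  "lag_matrix H = (\<chi> i j. (if i = j then 1 else 0) + \<i> * of_real (H i j))"

lemma bilinear_axis_expansion:
  fixes h :: "real^'n \<Rightarrow> real^'n \<Rightarrow> real"
  assumes "bilinear h"
  shows "h u v = (\<Sum>i\<in>UNIV. \<Sum>j\<in>UNIV. u $ i * h (axis i 1) (axis j 1) * v $ j)"
proof -
  have "h u v = h (\<Sum>i\<in>UNIV. u $ i *\<^sub>R axis i 1) (\<Sum>j\<in>UNIV. v $ j *\<^sub>R axis j 1)"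
    by (simp flip: vec_axis_expansion)
  also have "\<dots> = (\<Sum>(i,j)\<in>UNIV \<times> UNIV. h (u $ i *\<^sub>R axis i 1) (v $ j *\<^sub>R axis j 1))"
    by (rule bilinear_sum[OF assms])
  finally show ?thesis
    by (simp add: sum.cartesian_product bilinear_lmul[OF assms] bilinear_rmul[OF assms] mult.commute mult.left_commute
        case_prod_unfold)
qed

text \<open>An orthonormal frame is the coordinate frame turned by an orthogonal matrix, which fixes
  the identity and conjugates the Hessian. With \<open>det_conjugate\<close> the determinants in the
  equation do not depend on the frame.\<close>

lemma lag_matrix_conjugate:
  assumes h: "bilinear h" and w: "\<And>i j. w i \<bullet> w j = (if i = j then 1 else 0)"
  shows "lag_matrix (\<lambda>i j. h (w i) (w j)) =
    transpose (cmat (\<chi> k j. w j $ k)) ** lag_matrix (\<lambda>i j. h (axis i 1) (axis j 1)) ** cmat (\<chi> k j. w j $ k)"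
    and "transpose (cmat (\<chi> k j. w j $ k)) ** cmat (\<chi> k j. w j $ k) = mat 1"
proof -
  let ?O = "cmat (\<chi> k j. w j $ k)"
  have oc: "(\<Sum>k\<in>UNIV. of_real (w i $ k) * of_real (w j $ k)) = (if i = j then 1 else 0 :: complex)" for i j
  proof -
    have "(\<Sum>k\<in>UNIV. w i $ k * w j $ k) = (if i = j then 1 else 0)" using w[of i j] by (simp add: inner_vec_def)
    then have "of_real (\<Sum>k\<in>UNIV. w i $ k * w j $ k) = (if i = j then 1 else 0 :: complex)" by simp
    then show ?thesis by simp
  qed
  show *: "transpose ?O ** ?O = mat 1"
    by (simp add: vec_eq_iff matrix_matrix_mult_def transpose_def cmat_def mat_def oc)
  show "lag_matrix (\<lambda>i j. h (w i) (w j)) =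
    transpose ?O ** lag_matrix (\<lambda>i j. h (axis i 1) (axis j 1)) ** ?O"
  proof -
    have "(transpose ?O ** lag_matrix (\<lambda>i j. h (axis i 1) (axis j 1)) ** ?O) $ i $ j
      = lag_matrix (\<lambda>i j. h (w i) (w j)) $ i $ j" for i j
    proof -
      have "(transpose ?O ** lag_matrix (\<lambda>i j. h (axis i 1) (axis j 1)) ** ?O) $ i $ j
        = (\<Sum>l\<in>UNIV. (\<Sum>k\<in>UNIV. of_real (w i $ k) * ((if k = l then 1 else 0) + \<i> * of_real (h (axis k 1) (axis l 1)))) * of_real (w j $ l))"
        by (simp add: matrix_matrix_mult_def transpose_def cmat_def lag_matrix_def)
      also have "\<dots> = (\<Sum>l\<in>UNIV. of_real (w i $ l) * of_real (w j $ l))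
        + \<i> * (\<Sum>l\<in>UNIV. \<Sum>k\<in>UNIV. of_real (w i $ k * h (axis k 1) (axis l 1) * w j $ l))"
      proof -
        have "x * (if P then 1 else 0) = (if P then x else (0::complex))" for x P by simp
        then show ?thesis
          by (simp add: distrib_left distrib_right sum.distrib sum_distrib_left sum_distrib_right
              mult.assoc mult.left_commute)
      qed
      also have "(\<Sum>l\<in>UNIV. \<Sum>k\<in>UNIV. of_real (w i $ k * h (axis k 1) (axis l 1) * w j $ l)) = (of_real (h (w i) (w j)) :: complex)"
        unfolding bilinear_axis_expansion[OF h, of "w i"] by (subst sum.swap) simp
      finally show ?thesis by (simp add: oc lag_matrix_def)
    qed
    then show ?thesis by (simp add: vec_eq_iff)
  qed
qed

lemma det_columns:
  fixes K :: "'b::comm_ring_1^'n^'n"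
  shows "det (\<chi> j k. (K *v w k) $ j) = det K * det (\<chi> j k. w k $ j)"
proof -
  have "(\<chi> j k. (K *v w k) $ j) = K ** (\<chi> j k. w k $ j)"
    by (simp add: vec_eq_iff matrix_matrix_mult_def matrix_vector_mult_def)
  then show ?thesis by (simp add: det_mul)
qed


section \<open>Hessians on the manifold\<close>

definition deriv1 :: "'e::euclidean_space set \<Rightarrow> ('e \<Rightarrow> real) \<Rightarrow> 'e \<Rightarrow> 'e \<Rightarrow> real" where
  "deriv1 S F z w = frechet_derivative F (at z within S) w"

text \<open>The differentiation in direction \<open>w\<close> is performed first, that in direction
  \<open>v\<close> last; the order is that of \<open>E\<close> in
  \<open>hessian_coords_pullback\<close>.\<close>

definition deriv2 :: "'e::euclidean_space set \<Rightarrow> ('e \<Rightarrow> real) \<Rightarrow> 'e \<Rightarrow> 'e \<Rightarrow> 'e \<Rightarrow> real" where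
  "deriv2 S F z v w = frechet_derivative (\<lambda>z. deriv1 S F z w) (at z within S) v"

lemma C2_derivatives:
  assumes "Ck_on 2 S F"
  shows C2_deriv1: "z \<in> S \<Longrightarrow> (F has_derivative deriv1 S F z) (at z within S)"
    and C2_deriv2: "z \<in> S \<Longrightarrow> ((\<lambda>z. deriv1 S F z w) has_derivative (\<lambda>v. deriv2 S F z v w)) (at z within S)"
    and C2_continuous: "continuous_on S (\<lambda>z. deriv2 S F z v w)"
  using assms unfolding deriv1_def deriv2_def numeral_2_eq_2 Ck_on.simps differentiable_on_def
  by (auto simp: frechet_derivative_works[symmetric])

text \<open>Linearity in the slot of the outer derivative is automatic; in the other slot it is
  obtained from symmetry, valid up to the boundary of the strip.\<close>

lemma deriv2_bilinear:
  assumes "open U" "Ck_on 2 ({0..1} \<times> U) F" "z \<in> {0..1::real} \<times> U"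
  shows "deriv2 ({0..1} \<times> U) F z v w = deriv2 ({0..1} \<times> U) F z w v"
    and "bilinear (deriv2 ({0..1} \<times> U) F z)"
proof -
  let ?S = "{0..1::real} \<times> U"
  show sym: "deriv2 ?S F z v w = deriv2 ?S F z w v" for v w
    unfolding deriv2_def deriv1_def
    by (rule second_derivative_symmetric[OF unit_interval_Times_subset_closure_interior[OF assms(1)] assms(2,3)])
  have lin: "linear (\<lambda>v. deriv2 ?S F z v w)" for w
    using C2_deriv2[OF assms(2,3)] has_derivative_linear by blast
  moreover have "linear (deriv2 ?S F z v)" for v
  proof -
    have "deriv2 ?S F z v = (\<lambda>w. deriv2 ?S F z w v)" by (rule ext) (rule sym)
    then show ?thesis using lin by simp
  qed
  ultimately show "bilinear (deriv2 ?S F z)" by (simp add: bilinear_def)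
qed

text \<open>The strip has its boundary in time only: space slices carry ordinary derivatives, time
  slices derivatives within [0,1].\<close>

lemma has_derivative_slices:
  fixes g :: "real \<times> 'e::euclidean_space \<Rightarrow> 'f::real_normed_vector"
  assumes "(g has_derivative g') (at (t, x) within {0..1} \<times> U)" "open U" "x \<in> U" "t \<in> {0..1}"
  shows "((\<lambda>x. g (t, x)) has_derivative (\<lambda>v. g' (0, v))) (at x)"
    and "((\<lambda>s. g (s, x)) has_vector_derivative g' (1, 0)) (at t within {0..1})"
proof -
  have "((\<lambda>x. (t, x)) has_derivative (\<lambda>v. (0, v))) (at x within U)"
    by (intro has_derivative_Pair) auto
  moreover have "(g has_derivative g') (at (t, x) within (\<lambda>x. (t, x)) ` U)"
    by (rule has_derivative_subset[OF assms(1)]) (use assms in auto)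
  ultimately show "((\<lambda>x. g (t, x)) has_derivative (\<lambda>v. g' (0, v))) (at x)"
    unfolding at_within_open[OF assms(3,2), symmetric]
    by (rule has_derivative_in_compose[where f = "\<lambda>x. (t, x)" and g = g])
next
  have "((\<lambda>s. (s, x)) has_derivative (\<lambda>a. (a, 0))) (at t within {0..1})"
    by (intro has_derivative_Pair) auto
  moreover have "(g has_derivative g') (at (t, x) within (\<lambda>s. (s, x)) ` {0..1})"
    by (rule has_derivative_subset[OF assms(1)]) (use assms in auto)
  ultimately have "((\<lambda>s. g (s, x)) has_derivative (\<lambda>a. g' (a, 0))) (at t within {0..1})"
    by (rule has_derivative_in_compose[where f = "\<lambda>s. (s, x)" and g = g])
  moreover have "(\<lambda>a. g' (a, 0)) = (\<lambda>a. a *\<^sub>R g' (1, 0))"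
  proof
    show "g' (a, 0) = a *\<^sub>R g' (1, 0)" for a
      using linear_cmul[OF has_derivative_linear[OF assms(1)], of a "(1, 0)"] by simp
  qed
  ultimately show "((\<lambda>s. g (s, x)) has_vector_derivative g' (1, 0)) (at t within {0..1})"
    by (simp only: has_vector_derivative_def)
qed

text \<open>Componentwise from the scalar case. Applied to transition maps it yields the symmetry of
  \<open>Q\<close>.\<close>

lemma second_derivative_symmetric_vec:
  fixes F :: "'e::euclidean_space \<Rightarrow> 'f::euclidean_space"
  assumes "open S" "smooth_on S F" "x \<in> S"
  shows "frechet_derivative (\<lambda>y. frechet_derivative F (at y) v) (at x) w
       = frechet_derivative (\<lambda>y. frechet_derivative F (at y) w) (at x) v"
proof (rule euclidean_eqI)
  fix b :: 'f assume "b \<in> Basis"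
  let ?D = "\<lambda>y. frechet_derivative F (at y)"
  have 1: "frechet_derivative (\<lambda>x. F x \<bullet> b) (at y) v = ?D y v \<bullet> b" if "y \<in> S" for y v
  proof -
    have "((\<lambda>x. F x \<bullet> b) has_derivative (\<lambda>v. ?D y v \<bullet> b)) (at y)"
      by (rule has_derivative_inner_left[OF smooth_on_derivative(1)[OF assms(1,2) that]])
    from frechet_derivative_at[OF this] show ?thesis by metis
  qed
  have 2: "frechet_derivative (\<lambda>y. frechet_derivative (\<lambda>x. F x \<bullet> b) (at y) v) (at x) w
    = frechet_derivative (\<lambda>y. ?D y v) (at x) w \<bullet> b" for v w
  proof -
    have "((\<lambda>y. ?D y v) has_derivative frechet_derivative (\<lambda>y. ?D y v) (at x)) (at x)"
      by (rule smooth_on_derivative(1)[OF assms(1) smooth_on_derivative(2)[OF assms(1,2)] assms(3)])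
    from has_derivative_inner_left[OF this, of b]
    have "((\<lambda>y. frechet_derivative (\<lambda>x. F x \<bullet> b) (at y) v) has_derivative
        (\<lambda>w. frechet_derivative (\<lambda>y. ?D y v) (at x) w \<bullet> b)) (at x)"
      by (rule has_derivative_transform_within_open[OF _ assms(1,3)]) (simp add: 1)
    from frechet_derivative_at[OF this] show ?thesis by metis
  qed
  have "Ck_on 2 S (\<lambda>x. F x \<bullet> b)"
    using smooth_on_linear_compose[OF bounded_linear_inner_left assms(1,2), of b] by (simp add: smooth_on_def)
  from second_derivative_symmetric_open[OF assms(1) this assms(3), of v w]
  show "frechet_derivative (\<lambda>y. ?D y v) (at x) w \<bullet> b = frechet_derivative (\<lambda>y. ?D y w) (at x) v \<bullet> b"
    by (simp only: 2)
qed

section \<open>The function f and the induced metric in flat charts\<close>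

context flat_atlas begin

definition strip :: "('a, real^'n) chart \<Rightarrow> (real \<times> (real^'n)) set" where
  "strip b = {0..1} \<times> chart_image b"

definition local_rep :: "('a, real^'n) chart \<Rightarrow> (real \<Rightarrow> 'a \<Rightarrow> real) \<Rightarrow> real \<times> (real^'n) \<Rightarrow> real" where
  "local_rep b f = (\<lambda>(t, x). f t (inv_chart b x))"

abbreviation D1 where "D1 b f \<equiv> deriv1 (strip b) (local_rep b f)"
abbreviation D2 where "D2 b f \<equiv> deriv2 (strip b) (local_rep b f)"

lemma C2_local_rep: "C2_on_product A f \<Longrightarrow> b \<in> charts A \<Longrightarrow> Ck_on 2 (strip b) (local_rep b f)"
  by (simp add: C2_on_product_def strip_def local_rep_def)

lemma open_chart_image: "b \<in> charts A \<Longrightarrow> open (chart_image b)"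
  using charts_is_chart by (auto simp: is_chart_def)

lemma chart_image_memI: "p \<in> fst b \<Longrightarrow> snd b p \<in> chart_image b"
  by (simp add: chart_image_def)

lemma D2_symmetric:
  assumes "C2_on_product A f" "b \<in> charts A" "z \<in> strip b"
  shows "D2 b f z v w = D2 b f z w v" "bilinear (D2 b f z)"
  using deriv2_bilinear[OF open_chart_image[OF assms(2)] C2_local_rep[OF assms(1,2), unfolded strip_def]
      assms(3)[unfolded strip_def]]
  unfolding strip_def by blast+

lemma D1_has_derivative:
  assumes "C2_on_product A f" "b \<in> charts A" "z \<in> strip b"
  shows "(local_rep b f has_derivative D1 b f z) (at z within strip b)"
    "((\<lambda>z. D1 b f z w) has_derivative (\<lambda>v. D2 b f z v w)) (at z within strip b)"
  using C2_deriv1[OF C2_local_rep[OF assms(1,2)] assms(3)] C2_deriv2[OF C2_local_rep[OF assms(1,2)] assms(3)]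
  by blast+

lemma D1_slices:
  assumes f: "C2_on_product A f" and b: "b \<in> charts A" and t: "t \<in> {0..1}" and x: "x \<in> chart_image b"
  shows "(f t \<circ> inv_chart b has_derivative (\<lambda>v. D1 b f (t, x) (0, v))) (at x)"
    "((\<lambda>x. D1 b f (t, x) w) has_derivative (\<lambda>v. D2 b f (t, x) (0, v) w)) (at x)"
    "((\<lambda>s. f s (inv_chart b x)) has_vector_derivative D1 b f (t, x) (1, 0)) (at t within {0..1})"
    "((\<lambda>s. D1 b f (s, x) w) has_vector_derivative D2 b f (t, x) (1, 0) w) (at t within {0..1})"
proof -
  have z: "(t, x) \<in> strip b" using t x by (simp add: strip_def)
  note d = D1_has_derivative[OF f b z]
  note sl = has_derivative_slices[OF d(1)[unfolded strip_def] open_chart_image[OF b] x t, folded strip_def]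
  show "(f t \<circ> inv_chart b has_derivative (\<lambda>v. D1 b f (t, x) (0, v))) (at x)"
    "((\<lambda>s. f s (inv_chart b x)) has_vector_derivative D1 b f (t, x) (1, 0)) (at t within {0..1})"
    using sl by (simp_all add: local_rep_def o_def)
  note sl = has_derivative_slices[OF d(2)[unfolded strip_def] open_chart_image[OF b] x t, folded strip_def]
  show "((\<lambda>x. D1 b f (t, x) w) has_derivative (\<lambda>v. D2 b f (t, x) (0, v) w)) (at x)"
    "((\<lambda>s. D1 b f (s, x) w) has_vector_derivative D2 b f (t, x) (1, 0) w) (at t within {0..1})"
    using sl by simp_all
qed

lemma zero_covector: "(\<lambda>_. 0) \<in> cotangent_space A p"
  by (simp add: cotangent_space_def)

text \<open>Serves twice: for the zero section, which defines the metric, and for the graph of the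
  differential of f.\<close>

lemma pushforward_section:
  assumes p: "p \<in> points A" and \<xi>: "\<xi> p \<in> cotangent_space A p"
    and d: "((\<lambda>x. snd (cotangent_chart A (flat_chart p)) (inv_chart (flat_chart p) x, \<xi> (inv_chart (flat_chart p) x)))
      has_derivative L) (at (snd (flat_chart p) p))"
    and v: "v \<in> tangent_space A p"
  shows "pushforward A cotangent_atlas (\<lambda>q. (q, \<xi> q)) p v (flat_cotangent_chart (p, \<xi> p)) = L (v (flat_chart p))"
proof -
  have P: "(p, \<xi> p) \<in> points cotangent_atlas" using p \<xi> by (simp add: points_cotangent_bundle)
  have d': "(snd (flat_cotangent_chart (p, \<xi> p)) \<circ> (\<lambda>q. (q, \<xi> q)) \<circ> inv_chart (flat_chart p) has_derivative L)
    (at (snd (flat_chart p) p))"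
    using d by (simp add: flat_cotangent_chart_def o_def)
  show ?thesis
    by (rule pushforward_eq[OF flat_chart_in(3)[OF p] _ d' v])
      (use flat_cotangent_chart_at[OF P] in simp)
qed

text \<open>The zero section has differential u to u + 0 i, and \<omega>(u, i v) is the Euclidean
  product of real vectors u and v. By \<open>tangent_flat\<close> any flat chart gives the same
  value.\<close>

lemma induced_metric_flat:
  assumes b: "b \<in> B" "p \<in> fst b" and u: "u \<in> tangent_space A p" and v: "v \<in> tangent_space A p"
  shows "induced_metric A J0 omega0 p u v = u b \<bullet> v b"
proof -
  have p: "p \<in> points A" using charts_points[OF charts_atD(1,2)[OF B_charts_at[OF b]]] .
  let ?b = "flat_chart p" and ?C = "flat_cotangent_chart (zero_section p)"
  note fb = flat_chart_in[OF p]
  have P: "zero_section p \<in> points cotangent_atlas"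
    using p zero_covector by (simp add: points_cotangent_bundle zero_section_def)
  have push: "pushforward A cotangent_atlas zero_section p w ?C = cplx (w ?b) 0"
    if w: "w \<in> tangent_space A p" for w
  proof -
    have "((\<lambda>x. cplx x 0) has_derivative (\<lambda>u. cplx u 0)) (at (snd ?b p))"
      by (rule bounded_linear_imp_has_derivative[OF bounded_linear_cplx_left])
    then have d: "((\<lambda>x. snd (cotangent_chart A ?b) (inv_chart ?b x, \<lambda>_. 0)) has_derivative (\<lambda>u. cplx u 0))
      (at (snd ?b p))"
      by (rule has_derivative_transform_within_open[of _ _ _ _ "chart_image ?b"])
        (use fb charts_atD[OF fb(3)] in
          \<open>auto simp: open_chart_image chart_image_memI cotangent_chart_apply inv_chart_right vec_eq_iff zero_complex.code\<close>)
    have zs: "zero_section = (\<lambda>q. (q, \<lambda>_. 0))" by (simp add: zero_section_def fun_eq_iff)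
    show ?thesis unfolding zs by (rule pushforward_section[OF p zero_covector d w])
  qed
  show ?thesis
    unfolding induced_metric_def Let_def omega0_def J0_coord(2)[OF P] push[OF u] push[OF v]
    using tangent_flat[OF u b(1) fb(1) b(2) fb(2)] tangent_flat[OF v b(1) fb(1) b(2) fb(2)]
    by (simp add: re_part_ii im_part_ii)
qed

lemma flat_metric_induced: "flat_metric A (induced_metric A J0 omega0)"
  unfolding flat_metric_def using flat_chart_in induced_metric_flat by blast

text \<open>Collects the hypotheses of \<open>hessian_coords_pullback\<close> for the passage from
  an arbitrary chart \<open>c\<close> to a flat chart \<open>b\<close>; later \<open>c\<close> is
  \<open>chart_at A p\<close>, about which nothing more is known.\<close>

lemma transition_facts:
  assumes c: "c \<in> charts_at A p" and b: "b \<in> B" "p \<in> fst b"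
  defines "N \<equiv> snd c ` (fst c \<inter> fst b)"
  defines "P \<equiv> (\<lambda>y. frechet_derivative (transition c b) (at y))"
  defines "Q \<equiv> (\<lambda>v w. frechet_derivative (\<lambda>y. P y w) (at (snd c p)) v)"
  shows "open N" "snd c p \<in> N" "N \<subseteq> chart_image c" "transition c b ` N \<subseteq> chart_image b"
    "\<And>y. y \<in> N \<Longrightarrow> (transition c b has_derivative P y) (at y)"
    "\<And>w. ((\<lambda>y. P y w) has_derivative (\<lambda>v. Q v w)) (at (snd c p))"
    "\<And>v w. Q v w = Q w v"
    "bij (P (snd c p))"
    "\<And>y u v. y \<in> N \<Longrightarrow> form_coords A (induced_metric A J0 omega0) c y u v = P y u \<bullet> P y v"
    "\<And>y. y \<in> N \<Longrightarrow> inv_chart b (transition c b y) = inv_chart c y"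
proof -
  note cc = charts_atD[OF c] charts_atD[OF B_charts_at[OF b]]
  note co = charts_compatible[OF cc(1,4), folded N_def]
  show N: "open N" by (rule co(1))
  show x: "snd c p \<in> N" using cc b by (simp add: N_def)
  show "N \<subseteq> chart_image c" by (auto simp: N_def chart_image_def)
  show "transition c b ` N \<subseteq> chart_image b" using cc by (auto simp: N_def chart_image_def)
  show "(transition c b has_derivative P y) (at y)" if "y \<in> N" for y
    unfolding P_def by (rule smooth_on_derivative(1)[OF co that])
  show "((\<lambda>y. P y w) has_derivative (\<lambda>v. Q v w)) (at (snd c p))" for w
    unfolding Q_def P_def by (rule smooth_on_derivative(1)[OF N smooth_on_derivative(2)[OF co] x])
  show "Q v w = Q w v" for v w
    unfolding Q_def P_def by (rule second_derivative_symmetric_vec[OF co x])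
  show "bij (P (snd c p))"
  proof (rule bijI')
    \<comment> \<open>The differential of the reverse transition is a two-sided inverse, by the
      cocycle rule.\<close>
    let ?R = "frechet_derivative (transition b c) (at (snd b p))"
    note bc = B_charts_at[OF b]
    have RP: "?R (P (snd c p) u) = u" for u
      unfolding P_def using transition_derivative_compose[OF c bc c, of u] transition_derivative_self[OF c] by simp
    have PR: "P (snd c p) (?R u) = u" for u
      unfolding P_def using transition_derivative_compose[OF bc c bc, of u] transition_derivative_self[OF bc] by simp
    show "(P (snd c p) u = P (snd c p) v) = (u = v)" for u v using RP by metis
    show "\<exists>u. v = P (snd c p) u" for v using PR by metis
  qed
  fix y assume y: "y \<in> N"
  then obtain q where q: "q \<in> fst c" "q \<in> fst b" "y = snd c q" by (auto simp: N_def)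
  have cq: "c \<in> charts_at A q" using cc q by (simp add: charts_at_def)
  have bq: "b \<in> charts_at A q" by (rule B_charts_at[OF b(1) q(2)])
  show "form_coords A (induced_metric A J0 omega0) c y u v = P y u \<bullet> P y v" for u v
    unfolding form_coords_def Let_def q(3) inv_chart_left[OF cc(3) q(1)]
    using induced_metric_flat[OF b(1) q(2) coord_vec_tangent[OF cq] coord_vec_tangent[OF cq]] bq
    by (simp add: P_def coord_vec_def)
  show "inv_chart b (transition c b y) = inv_chart c y"
    using cc q by simp
qed

text \<open>The definition differentiates \<open>W\<close>, so its differentiability is required,
  but the cancellation leaves only the values of \<open>V\<close> and \<open>W\<close> at
  \<open>p\<close>.\<close>

lemma hessian_flat:
  assumes f: "C2_on_product A f" and t: "t \<in> {0..1}" and b: "b \<in> B" "p \<in> fst b"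
    and V: "V p \<in> tangent_space A p" and W: "W p \<in> tangent_space A p"
    and dW: "(\<lambda>x. W (inv_chart (chart_at A p) x) (chart_at A p)) differentiable at (snd (chart_at A p) p)"
  shows "hessian A (induced_metric A J0 omega0) (f t) V W p
    = D2 b f (t, snd b p) (0, V p b) (0, W p b)"
proof -
  define c where "c = chart_at A p"
  have p: "p \<in> points A" using charts_points[OF charts_atD(1,2)[OF B_charts_at[OF b]]] .
  have c: "c \<in> charts_at A p" unfolding c_def by (rule chart_at_in[OF p])
  note bc = B_charts_at[OF b]
  note cc = charts_atD[OF c] charts_atD[OF bc]
  define N where "N = snd c ` (fst c \<inter> fst b)"
  define P where "P y = frechet_derivative (transition c b) (at y)" for y
  define Q where "Q v w = frechet_derivative (\<lambda>y. P y w) (at (snd c p)) v" for v w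
  note tf = transition_facts[OF c b, folded P_def N_def, folded Q_def]
  let ?S = "chart_image c" and ?x = "snd c p"
  have oS: "open ?S" "open (chart_image b)" using open_chart_image cc by auto
  have xS: "?x \<in> ?S" using cc by (intro chart_image_memI)
  have Phix: "transition c b ?x = snd b p" using cc by simp
  have atS: "at y within ?S = at y" if "y \<in> N" for y
    using that tf(3) oS by (intro at_within_open) auto
  obtain W' where W': "((\<lambda>x. W (inv_chart c x) c) has_derivative W') (at ?x within ?S)"
    using dW unfolding c_def[symmetric] differentiable_def by (meson has_derivative_at_withinI)
  have z: "(t, snd b p) \<in> strip b" using t cc by (simp add: strip_def chart_image_memI)
  have "hessian_coords ?S (form_coords A (induced_metric A J0 omega0) c) (f t \<circ> inv_chart c)
      (\<lambda>x. V (inv_chart c x) c) (\<lambda>x. W (inv_chart c x) c) ?x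
    = D2 b f (t, snd b p) (0, P ?x (V (inv_chart c ?x) c)) (0, P ?x (W (inv_chart c ?x) c))"
  proof (rule hessian_coords_pullback[where N = N and S' = "chart_image b" and Phi = "transition c b"
        and P = P and Q = Q and u' = "f t \<circ> inv_chart b"
        and D = "\<lambda>y w. D1 b f (t, y) (0, w)" and E = "\<lambda>v w. D2 b f (t, snd b p) (0, v) (0, w)"])
    show "unique_derivative_at ?S y" if "y \<in> ?S" for y using oS that by (intro open_unique_derivative_at)
    show "?x \<in> ?S" "open N" "?x \<in> N" using xS tf by auto
    show "form_coords A (induced_metric A J0 omega0) c y u v = P y u \<bullet> P y v" if "y \<in> ?S \<inter> N" for y u v
      using that by (intro tf(9)) auto
    show "((\<lambda>y. P y w) has_derivative (\<lambda>v. Q v w)) (at ?x within ?S)" for w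
      using tf(6) by (rule has_derivative_at_withinI)
    show "Q v w = Q w v" for v w by (rule tf(7))
    show "bij (P ?x)" by (rule tf(8))
    show "(transition c b has_derivative P y) (at y within ?S)" if "y \<in> ?S \<inter> N" for y
      by (rule has_derivative_at_withinI[OF tf(5)]) (use that in auto)
    show "transition c b ` (?S \<inter> N) \<subseteq> chart_image b" using tf(4) by auto
    show "(f t \<circ> inv_chart c) y = (f t \<circ> inv_chart b) (transition c b y)" if "y \<in> ?S \<inter> N" for y
      using that tf(10) by simp
    show "(f t \<circ> inv_chart b has_derivative (\<lambda>w. D1 b f (t, y) (0, w))) (at y within chart_image b)"
      if "y \<in> chart_image b" for y
      by (rule has_derivative_at_withinI[OF D1_slices(1)[OF f cc(4) t that]])
    show "((\<lambda>y. D1 b f (t, y) (0, w)) has_derivative (\<lambda>v. D2 b f (t, snd b p) (0, v) (0, w)))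
      (at (transition c b ?x) within chart_image b)" for w
      unfolding Phix
      by (rule has_derivative_at_withinI[OF D1_slices(2)[OF f cc(4) t]]) (use cc in \<open>simp add: chart_image_memI\<close>)
    show "D2 b f (t, snd b p) (0, v) (0, w) = D2 b f (t, snd b p) (0, w) (0, v)" for v w
      by (rule D2_symmetric(1)[OF f cc(4) z])
  qed (rule W')
  then show ?thesis
    unfolding hessian_def Let_def c_def[symmetric] inv_chart_left[OF cc(3,2)]
    using tangent_change[OF c bc V] tangent_change[OF c bc W] by (simp add: P_def)
qed

lemma product_hessian_flat:
  fixes V W :: "real \<Rightarrow> 'a \<Rightarrow> real \<times> ('a, real^'n) tvec"
  assumes f: "C2_on_product A f" and t: "t \<in> {0..1}" and b: "b \<in> B" "p \<in> fst b"
    and V: "snd (V t p) \<in> tangent_space A p" and W: "snd (W t p) \<in> tangent_space A p"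
    and dW: "(\<lambda>(s, x). (fst (W s (inv_chart (chart_at A p) x)), snd (W s (inv_chart (chart_at A p) x)) (chart_at A p)))
      differentiable at (t, snd (chart_at A p) p) within ({0..1} \<times> chart_image (chart_at A p))"
  shows "product_hessian A (induced_metric A J0 omega0) f V W t p
    = D2 b f (t, snd b p) (fst (V t p), snd (V t p) b) (fst (W t p), snd (W t p) b)"
proof -
  define c where "c = chart_at A p"
  have p: "p \<in> points A" using charts_points[OF charts_atD(1,2)[OF B_charts_at[OF b]]] .
  have c: "c \<in> charts_at A p" unfolding c_def by (rule chart_at_in[OF p])
  note bc = B_charts_at[OF b]
  note cc = charts_atD[OF c] charts_atD[OF bc]
  define N where "N = snd c ` (fst c \<inter> fst b)"
  define P where "P y = frechet_derivative (transition c b) (at y)" for y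
  define Q where "Q v w = frechet_derivative (\<lambda>y. P y w) (at (snd c p)) v" for v w
  note tf = transition_facts[OF c b, folded P_def N_def, folded Q_def]
  let ?S = "{0..1::real} \<times> chart_image c" and ?x = "(t, snd c p)"
  \<comment> \<open>Time is untouched by the coordinate change and contributes a constant summand to
    the metric, so the second derivative has time component 0.\<close>
  let ?P = "\<lambda>z w. (fst w :: real, P (snd z) (snd w))" and ?Q = "\<lambda>v w. (0 :: real, Q (snd v) (snd w))"
  let ?Phi = "\<lambda>z. (fst z :: real, transition c b (snd z))"
  let ?coords = "\<lambda>U (s, x). (fst (U s (inv_chart c x)), snd (U s (inv_chart c x)) c)"
  have oS: "open (chart_image c)" using open_chart_image cc by auto
  have xS: "snd c p \<in> chart_image c" using cc by (intro chart_image_memI)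
  have Phix: "transition c b (snd c p) = snd b p" using cc by simp
  obtain W' where W': "(?coords W has_derivative W') (at ?x within ?S)"
    using dW unfolding c_def[symmetric] differentiable_def by blast
  have z: "(t, snd b p) \<in> strip b" using t cc by (simp add: strip_def chart_image_memI)
  have "hessian_coords ?S
      (\<lambda>(s, x) (a, u) (b, v). a * b + form_coords A (induced_metric A J0 omega0) c x u v)
      (\<lambda>(s, x). f s (inv_chart c x)) (?coords V) (?coords W) ?x
    = D2 b f (t, snd b p) (?P ?x (?coords V ?x)) (?P ?x (?coords W ?x))"
  proof (rule hessian_coords_pullback[where N = "UNIV \<times> N" and S' = "strip b" and Phi = ?Phi
        and P = ?P and Q = ?Q and u' = "local_rep b f"
        and D = "D1 b f" and E = "D2 b f (t, snd b p)"])
    show "unique_derivative_at ?S y" if "y \<in> ?S" for y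
      using that oS by (cases y) (auto intro: unique_derivative_at_unit_interval_Times)
    show "?x \<in> ?S" "open (UNIV \<times> N)" "?x \<in> UNIV \<times> N" using xS t tf by (auto intro: open_Times)
    show "(\<lambda>(s, x) (a, u) (b, v). a * b + form_coords A (induced_metric A J0 omega0) c x u v) y u v
      = ?P y u \<bullet> ?P y v" if "y \<in> ?S \<inter> UNIV \<times> N" for y u v
      using that tf(9)[of "snd y"] by (auto simp: case_prod_unfold inner_prod_def)
    show "((\<lambda>y. ?P y w) has_derivative (\<lambda>v. ?Q v w)) (at ?x within ?S)" for w
    proof (rule has_derivative_Pair)
      show "((\<lambda>y. P (snd y) (snd w)) has_derivative (\<lambda>v. Q (snd v) (snd w))) (at ?x within ?S)"
        by (rule has_derivative_compose[where f = snd and g = "\<lambda>y. P y (snd w)" and g' = "\<lambda>v. Q v (snd w)"])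
          (auto intro: derivative_eq_intros tf(6))
    qed auto
    show "?Q v w = ?Q w v" for v w using tf(7) by simp
    show "bij (?P ?x)"
    proof (rule bijI')
      show "(?P ?x u = ?P ?x v) = (u = v)" for u v
        by (simp add: prod_eq_iff inj_eq[OF bij_is_inj[OF tf(8)]])
      show "\<exists>u. v = ?P ?x u" for v
        using bij_is_surj[OF tf(8)] by (cases v) (auto simp: surj_def)
    qed
    show "(?Phi has_derivative ?P y) (at y within ?S)" if "y \<in> ?S \<inter> UNIV \<times> N" for y
    proof (rule has_derivative_Pair)
      show "((\<lambda>z. transition c b (snd z)) has_derivative (\<lambda>w. P (snd y) (snd w))) (at y within ?S)"
        by (rule has_derivative_compose[where f = snd and g = "transition c b" and g' = "P (snd y)"])
          (use that in \<open>auto intro: derivative_eq_intros tf(5)\<close>)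
    qed (auto intro: derivative_eq_intros)
    show "?Phi ` (?S \<inter> UNIV \<times> N) \<subseteq> strip b" using tf(4) by (auto simp: strip_def)
    show "(\<lambda>(s, x). f s (inv_chart c x)) y = local_rep b f (?Phi y)" if "y \<in> ?S \<inter> UNIV \<times> N" for y
      using that tf(10) by (auto simp: local_rep_def)
    show "(local_rep b f has_derivative D1 b f y) (at y within strip b)" if "y \<in> strip b" for y
      by (rule D1_has_derivative(1)[OF f cc(4) that])
    show "((\<lambda>y. D1 b f y w) has_derivative (\<lambda>v. D2 b f (t, snd b p) v w)) (at (?Phi ?x) within strip b)" for w
      using D1_has_derivative(2)[OF f cc(4) z] by (simp add: Phix)
    show "D2 b f (t, snd b p) v w = D2 b f (t, snd b p) w v" for v w
      by (rule D2_symmetric(1)[OF f cc(4) z])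
  qed (rule W')
  then show ?thesis
    unfolding product_hessian_def Let_def c_def[symmetric]
    using tangent_change[OF c bc V] tangent_change[OF c bc W] inv_chart_left[OF cc(3,2)] by (simp add: P_def)
qed

end


section \<open>Graph Lagrangians\<close>

text \<open>Transposition, so that the row rules \<open>det_row_mul\<close> and
  \<open>det_row_add\<close> can be applied to tangent vectors stored as columns.\<close>

lemma det_vec_columns: "det (\<chi> j k. w k $ j) = det (\<chi> k. w k)"
proof -
  have "transpose (\<chi> k. w k) = (\<chi> j k. w k $ j)" by (simp add: transpose_def vec_eq_iff)
  then show ?thesis by (metis det_transpose)
qed

lemma det_real_columns: "det (\<chi> j k. cplx (w k) 0 $ j) = of_real (det (\<chi> j k. w k $ j))"
proof -
  have "(\<chi> j k. cplx (w k) 0 $ j) = cmat (\<chi> j k. w k $ j)"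
    by (simp add: cmat_def vec_eq_iff complex_eq_iff)
  then show ?thesis by (simp add: det_cmat)
qed

text \<open>The determinant is complex linear in the column \<open>k\<close>, and all other columns are real.\<close>

lemma Re_det_column:
  fixes v :: "'n \<Rightarrow> real^'n"
  shows "Re (\<kappa> * det (\<chi> j i. ((\<lambda>i. cplx (v i) 0)(k := y)) i $ j))
    = det (\<chi> j i. (v(k := re_part (\<kappa> *s y))) i $ j)"
proof -
  let ?R = "\<lambda>y. det (\<chi> i. if i = k then y else cplx (v i) 0)"
  let ?r = "re_part (\<kappa> *s y)" and ?s = "im_part (\<kappa> *s y)"
  have real: "?R (cplx r 0) = of_real (det (\<chi> i. if i = k then r else v i))" for r
  proof -
    have "(\<chi> i. if i = k then cplx r 0 else cplx (v i) 0) = cmat (\<chi> i. if i = k then r else v i)"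
      by (simp add: cmat_def vec_eq_iff complex_eq_iff)
    then show ?thesis by (simp add: det_cmat)
  qed
  have "\<kappa> * ?R y = ?R (\<kappa> *s y)" by (simp add: det_row_mul[of k \<kappa> "\<lambda>_. y"])
  \<comment> \<open>Splitting the column into real and imaginary parts leaves two real determinants;
    the second carries a factor i and drops out of the real part.\<close>
  also have "\<kappa> *s y = cplx ?r 0 + \<i> *s cplx ?s 0" by (simp add: vec_eq_iff complex_eq_iff)
  also have "?R (cplx ?r 0 + \<i> *s cplx ?s 0) = ?R (cplx ?r 0) + \<i> * ?R (cplx ?s 0)"
    using det_row_add[of k "\<lambda>_. cplx ?r 0" "\<lambda>_. \<i> *s cplx ?s 0" "\<lambda>i. cplx (v i) 0"]
      det_row_mul[of k \<i> "\<lambda>_. cplx ?s 0" "\<lambda>i. cplx (v i) 0"] by simp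
  finally have "Re (\<kappa> * ?R y) = det (\<chi> i. if i = k then ?r else v i)"
    by (simp add: real)
  then show ?thesis unfolding det_vec_columns fun_upd_def .
qed

text \<open>Cramer's rule for the identity matrix; it reads off single components of
  \<zeta>.\<close>

lemma det_axis_column: "det (\<chi> j i. ((\<lambda>i. axis i 1)(k := u)) i $ j) = (u $ k :: real)"
proof -
  have "(\<chi> j i. ((\<lambda>i. axis i 1)(k := u)) i $ j) = (\<chi> i j. if j = k then (mat 1 *v u) $ i else mat 1 $ i $ j)"
    unfolding matrix_vector_mul_lid by (simp add: vec_eq_iff mat_def axis_def)
  then show ?thesis by (simp only: cramer_lemma det_I mult_1_right)
qed

lemma det_scaled_column:
  fixes v :: "'n \<Rightarrow> real^'n"
  shows "det (\<chi> j i. (v(k := s *\<^sub>R u)) i $ j) = s * det (\<chi> j i. (v(k := u)) i $ j)"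
  unfolding det_vec_columns fun_upd_def using det_row_mul[of k s "\<lambda>_. u" v]
  by (simp only: scalar_mult_eq_scaleR)

text \<open>If \<open>y\<close> solves the system for \<open>K\<close>, then
  \<open>transpose V *v y\<close> solves the rotated one. The pairing of border and solution is
  unchanged because \<open>V ** transpose V\<close> is the identity.\<close>

lemma bordered_conjugate_det:
  fixes K V :: "complex^'n^'n"
  assumes orth: "transpose V ** V = mat 1" and y: "K *v y = \<alpha>"
  shows "det (bordered \<kappa> (\<lambda>j. (transpose V *v \<alpha>) $ j) (\<lambda>i. (transpose V *v \<alpha>) $ i) (transpose V ** K ** V))
    = (\<kappa> - (\<Sum>k\<in>UNIV. \<alpha> $ k * y $ k)) * det K"
proof -
  have orth': "V ** transpose V = mat 1" using orth by (simp only: matrix_left_right_inverse[of V])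
  have "(transpose V ** K ** V) *v (transpose V *v y) = transpose V *v \<alpha>"
    by (metis matrix_mul_assoc matrix_vector_mul_assoc orth' matrix_mul_rid y)
  then have "det (bordered \<kappa> (\<lambda>j. (transpose V *v \<alpha>) $ j) (\<lambda>i. (transpose V *v \<alpha>) $ i) (transpose V ** K ** V))
    = (\<kappa> - (\<Sum>j\<in>UNIV. (transpose V *v \<alpha>) $ j * (transpose V *v y) $ j)) * det (transpose V ** K ** V)"
    by (intro det_bordered) simp
  moreover have "(\<Sum>j\<in>UNIV. (transpose V *v \<alpha>) $ j * (transpose V *v y) $ j) = (\<Sum>k\<in>UNIV. \<alpha> $ k * y $ k)"
  proof -
    have "(\<Sum>j\<in>UNIV. (transpose V *v \<alpha>) $ j * (transpose V *v y) $ j)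
      = (\<Sum>j\<in>UNIV. \<Sum>k\<in>UNIV. \<alpha> $ k * (V $ k $ j * (transpose V *v y) $ j))"
    proof -
      have "(transpose V *v \<alpha>) $ j = (\<Sum>k\<in>UNIV. V $ k $ j * \<alpha> $ k)" for j
        by (simp add: matrix_vector_mult_def transpose_def)
      then show ?thesis
        by (simp only: sum_distrib_right) (simp only: mult.commute mult.left_commute)
    qed
    also have "\<dots> = (\<Sum>k\<in>UNIV. \<alpha> $ k * (V *v (transpose V *v y)) $ k)"
      by (subst sum.swap) (simp add: matrix_vector_mult_def[of V] sum_distrib_left)
    also have "V *v (transpose V *v y) = y" by (simp only: matrix_vector_mul_assoc orth' matrix_vector_mul_lid)
    finally show ?thesis .
  qed
  ultimately show ?thesis by (simp add: det_conjugate[OF orth])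
qed

lemma has_derivative_vec_lambda:
  fixes g :: "'n::finite \<Rightarrow> 'e::real_normed_vector \<Rightarrow> real"
  assumes "\<And>k. (g k has_derivative g' k) F"
  shows "((\<lambda>x. \<chi> k. g k x) has_derivative (\<lambda>v. \<chi> k. g' k v)) F"
proof -
  have "((\<lambda>x. \<Sum>k\<in>UNIV. g k x *\<^sub>R axis k (1::real)) has_derivative (\<lambda>v. \<Sum>k\<in>UNIV. g' k v *\<^sub>R axis k 1)) F"
    by (intro has_derivative_sum has_derivative_scaleR_left assms)
  then show ?thesis
    using vec_axis_expansion[of "\<chi> k. g k _"] vec_axis_expansion[of "\<chi> k. g' k _"] by simp
qed

lemma has_derivative_cplx:
  assumes "(f has_derivative f') F" "(g has_derivative g') F"
  shows "((\<lambda>x. cplx (f x) (g x)) has_derivative (\<lambda>v. cplx (f' v) (g' v))) F"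
proof -
  have "((\<lambda>x. cplx (f x) 0 + cplx 0 (g x)) has_derivative (\<lambda>v. cplx (f' v) 0 + cplx 0 (g' v))) F"
    by (intro has_derivative_add bounded_linear.has_derivative[OF bounded_linear_cplx_left]
        bounded_linear.has_derivative[OF bounded_linear_cplx_right] assms)
  then show ?thesis by (simp add: cplx_add[symmetric])
qed

lemma continuous_on_cplx:
  assumes "continuous_on S f" "continuous_on S g"
  shows "continuous_on S (\<lambda>x. cplx (f x) (g x))"
proof -
  have "continuous_on S (\<lambda>x. cplx (f x) 0 + cplx 0 (g x))"
    by (intro continuous_on_add bounded_linear.continuous_on[OF bounded_linear_cplx_left]
        bounded_linear.continuous_on[OF bounded_linear_cplx_right] assms)
  then show ?thesis by (simp add: cplx_add[symmetric])
qed

locale C2_path = flat_atlas A B for A B :: "('a, real^'n) chart set" +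
  fixes f :: "real \<Rightarrow> 'a \<Rightarrow> real"
  assumes C2: "C2_on_product A f"
begin

abbreviation g where "g \<equiv> graph_path A f"

text \<open>The quantities \<open>hess\<close>, \<open>mixed\<close>, \<open>ftt\<close> and
  \<open>K\<close> are all evaluated here, in the flat chart of \<open>p\<close>, which their
  notation suppresses.\<close>

definition base_point :: "real \<Rightarrow> 'a \<Rightarrow> real \<times> (real^'n)" where
  "base_point t p = (t, snd (flat_chart p) p)"

text \<open>The chart is an explicit argument because \<open>x\<close> moves while the chart stays
  fixed when the graph is differentiated.\<close>

definition grad :: "('a, real^'n) chart \<Rightarrow> real \<Rightarrow> real^'n \<Rightarrow> real^'n" where
  "grad b t x = (\<chi> k. D1 b f (t, x) (0, axis k 1))"

definition hess :: "real \<Rightarrow> 'a \<Rightarrow> real^'n \<Rightarrow> real^'n \<Rightarrow> real" where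
  "hess t p v w = D2 (flat_chart p) f (base_point t p) (0, v) (0, w)"

definition hess_vec :: "real \<Rightarrow> 'a \<Rightarrow> real^'n \<Rightarrow> real^'n" where
  "hess_vec t p v = (\<chi> k. hess t p v (axis k 1))"

definition mixed :: "real \<Rightarrow> 'a \<Rightarrow> real^'n" where
  "mixed t p = (\<chi> k. D2 (flat_chart p) f (base_point t p) (1, 0) (0, axis k 1))"

definition ftt :: "real \<Rightarrow> 'a \<Rightarrow> real" where
  "ftt t p = D2 (flat_chart p) f (base_point t p) (1, 0) (1, 0)"

definition K :: "real \<Rightarrow> 'a \<Rightarrow> complex^'n^'n" where
  "K t p = lag_matrix (\<lambda>i j. hess t p (axis i 1) (axis j 1))"

lemma flat_chart_facts:
  assumes "p \<in> points A"
  shows "flat_chart p \<in> B" "flat_chart p \<in> charts A" "flat_chart p \<in> charts_at A p"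
    "p \<in> fst (flat_chart p)" "is_chart (flat_chart p)" "snd (flat_chart p) p \<in> chart_image (flat_chart p)"
  using flat_chart_in[OF assms] charts_atD[OF flat_chart_in(3)[OF assms]]
    chart_image_memI[OF flat_chart_in(2)[OF assms]] by blast+

lemma base_point_in: "p \<in> points A \<Longrightarrow> t \<in> {0..1} \<Longrightarrow> base_point t p \<in> strip (flat_chart p)"
  using flat_chart_facts by (simp add: base_point_def strip_def)

context
  fixes p :: 'a and t :: real
  assumes p: "p \<in> points A" and t: "t \<in> {0..1}"
begin

lemma D2_bilinear: "bilinear (D2 (flat_chart p) f (base_point t p))"
  and D2_commute: "D2 (flat_chart p) f (base_point t p) v w = D2 (flat_chart p) f (base_point t p) w v"
  using D2_symmetric[OF C2 flat_chart_facts(2)[OF p] base_point_in[OF p t]] by auto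

lemma hess_commute: "hess t p v w = hess t p w v"
  by (simp add: hess_def D2_commute)

lemma hess_bilinear: "bilinear (hess t p)"
proof -
  have "linear (hess t p v)" for v
    unfolding hess_def using D2_bilinear
    by (intro linearI) (auto simp: bilinear_radd[of _ _ "(0,_)" "(0,_)", simplified] bilinear_rmul[of _ _ _ "(0,_)", simplified])
  moreover have "(\<lambda>v. hess t p v w) = hess t p w" for w by (rule ext) (rule hess_commute)
  ultimately show ?thesis by (simp add: bilinear_def)
qed

lemma hess_vec_inner: "hess_vec t p v \<bullet> w = hess t p v w"
proof -
  have lin: "linear (hess t p v)" using hess_bilinear by (simp add: bilinear_def)
  have "hess t p v w = hess t p v (\<Sum>k\<in>UNIV. w $ k *\<^sub>R axis k 1)" by (simp flip: vec_axis_expansion)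
  also have "\<dots> = (\<Sum>k\<in>UNIV. w $ k * hess t p v (axis k 1))"
    by (simp add: linear_sum[OF lin] linear_cmul[OF lin])
  finally show ?thesis by (simp add: hess_vec_def inner_vec_def mult.commute)
qed

lemma mixed_inner: "mixed t p \<bullet> w = D2 (flat_chart p) f (base_point t p) (1, 0) (0, w)"
proof -
  let ?L = "\<lambda>w. D2 (flat_chart p) f (base_point t p) (1, 0) (0, w)"
  have lin: "linear ?L"
    using D2_bilinear
    by (intro linearI) (auto simp: bilinear_radd[of _ _ "(0,_)" "(0,_)", simplified] bilinear_rmul[of _ _ _ "(0,_)", simplified])
  have "?L w = ?L (\<Sum>k\<in>UNIV. w $ k *\<^sub>R axis k 1)" by (simp flip: vec_axis_expansion)
  also have "\<dots> = (\<Sum>k\<in>UNIV. w $ k * ?L (axis k 1))"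
    by (simp add: linear_sum[OF lin] linear_cmul[OF lin])
  finally show ?thesis by (simp add: mixed_def inner_vec_def mult.commute)
qed

lemma K_mult: "K t p *v cplx w 0 = cplx w (hess_vec t p w)"
proof -
  have "(K t p *v cplx w 0) $ i = cplx w (hess_vec t p w) $ i" for i
  proof -
    have "hess_vec t p w $ i = hess t p (axis i 1) w"
      by (simp add: hess_vec_def hess_commute)
    also have "\<dots> = (\<Sum>j\<in>UNIV. hess t p (axis i 1) (axis j 1) * w $ j)"
      using hess_vec_inner[of "axis i 1" w] by (simp add: inner_vec_def hess_vec_def)
    finally have "hess_vec t p w $ i = (\<Sum>j\<in>UNIV. hess t p (axis i 1) (axis j 1) * w $ j)" .
    moreover have "(K t p *v cplx w 0) $ i
      = (\<Sum>j\<in>UNIV. (if i = j then of_real (w $ j) else 0) + \<i> * of_real (hess t p (axis i 1) (axis j 1) * w $ j))"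
      unfolding matrix_vector_mult_def K_def lag_matrix_def
      by (simp, rule sum.cong) (auto simp: complex_eq_iff)
    ultimately show ?thesis
      by (simp add: sum.distrib complex_eq_iff flip: sum_distrib_left)
  qed
  then show ?thesis by (simp add: vec_eq_iff)
qed

end

section \<open>The graph of the differential as a map into the cotangent bundle\<close>

lemma differential_coord:
  assumes b: "b \<in> charts_at A q" and t: "t \<in> {0..1}" and X: "X \<in> tangent_space A q"
  shows "differential A (f t) q X = D1 b f (t, snd b q) (0, X b)"
  using differential_eq[OF b D1_slices(1)[OF C2 charts_atD(1)[OF b] t chart_image_memI[OF charts_atD(2)[OF b]]] X] .

lemma differential_cotangent:
  assumes q: "q \<in> points A" and t: "t \<in> {0..1}"
  shows "differential A (f t) q \<in> cotangent_space A q"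
proof -
  note b = flat_chart_in(3)[OF q]
  note d = differential_coord[OF b t]
  have lin: "linear (\<lambda>v. D1 (flat_chart q) f (t, snd (flat_chart q) q) (0, v))"
    using D1_slices(1)[OF C2 charts_atD(1)[OF b] t chart_image_memI[OF charts_atD(2)[OF b]]]
    by (rule has_derivative_linear)
  show ?thesis
    unfolding cotangent_space_def mem_Collect_eq
  proof (intro conjI allI impI ballI)
    fix X Y a b assume X: "X \<in> tangent_space A q" and Y: "Y \<in> tangent_space A q"
    show "differential A (f t) q (lincomb a X b Y) = a * differential A (f t) q X + b * differential A (f t) q Y"
      unfolding d[OF tangent_lincomb[OF X Y]] d[OF X] d[OF Y] lincomb_apply
      using linear_add[OF lin] linear_cmul[OF lin] by simp
  qed (simp add: differential_def)
qed

lemma fst_g [simp]: "fst (g t p) = p" and snd_g: "snd (g t p) = differential A (f t) p"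
  by (simp_all add: graph_path_def)

lemma g_point: "q \<in> points A \<Longrightarrow> t \<in> {0..1} \<Longrightarrow> g t q \<in> points cotangent_atlas"
  by (simp add: points_cotangent_bundle snd_g differential_cotangent)

lemma g_coord:
  assumes b: "b \<in> charts_at A q" and t: "t \<in> {0..1}"
  shows "snd (cotangent_chart A b) (g t q) = cplx (snd b q) (grad b t (snd b q))"
  using differential_coord[OF b t coord_vec_tangent[OF b]] b
  by (simp add: graph_path_def cotangent_chart_apply grad_def)

lemma g_coord_image:
  assumes b: "b \<in> charts A" and t: "t \<in> {0..1}" and x: "x \<in> chart_image b"
  shows "snd (cotangent_chart A b) (g t (inv_chart b x)) = cplx x (grad b t x)"
  using g_coord[of b "inv_chart b x", OF _ t] b inv_chart_right[OF x] by (simp add: charts_at_def)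

lemma grad_derivative:
  assumes b: "b \<in> charts A" and t: "t \<in> {0..1}" and x: "x \<in> chart_image b"
  shows "((\<lambda>x. cplx x (grad b t x)) has_derivative
    (\<lambda>v. cplx v (\<chi> k. D2 b f (t, x) (0, v) (0, axis k 1)))) (at x)"
  unfolding grad_def
  by (intro has_derivative_cplx has_derivative_ident has_derivative_vec_lambda D1_slices(2)[OF C2 b t x])

lemma pushforward_g:
  assumes p: "p \<in> points A" and t: "t \<in> {0..1}" and v: "v \<in> tangent_space A p"
  shows "pushforward A cotangent_atlas (g t) p v (flat_cotangent_chart (g t p))
    = cplx (v (flat_chart p)) (hess_vec t p (v (flat_chart p)))"
proof -
  let ?b = "flat_chart p"
  note fc = flat_chart_facts[OF p]
  have gt: "g t = (\<lambda>q. (q, differential A (f t) q))" by (simp add: graph_path_def fun_eq_iff)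
  have "((\<lambda>x. cplx x (grad ?b t x)) has_derivative (\<lambda>v. cplx v (hess_vec t p v))) (at (snd ?b p))"
    using grad_derivative[OF fc(2) t fc(6)] by (simp add: hess_vec_def hess_def base_point_def)
  then have "((\<lambda>x. snd (cotangent_chart A ?b) (inv_chart ?b x, differential A (f t) (inv_chart ?b x)))
    has_derivative (\<lambda>v. cplx v (hess_vec t p v))) (at (snd ?b p))"
    by (rule has_derivative_transform_within_open[OF _ open_chart_image[OF fc(2)] fc(6)])
      (simp add: g_coord_image[OF fc(2) t, unfolded gt])
  from pushforward_section[OF p differential_cotangent[OF p t] this v]
  show ?thesis unfolding gt .
qed

lemma C1_map_g:
  assumes t: "t \<in> {0..1}"
  shows "C1_map A cotangent_atlas (g t)"
  unfolding C1_map_def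
proof
  fix p assume p: "p \<in> points A"
  let ?b = "flat_chart p" and ?C = "cotangent_chart A (flat_chart p)"
  note fc = flat_chart_facts[OF p]
  note op = open_chart_image[OF fc(2)]
  have C: "?C \<in> charts_at cotangent_atlas (g t p)"
    using flat_cotangent_chart_at[OF g_point[OF p t]] by (simp add: flat_cotangent_chart_def)
  have "g t ` fst ?b \<subseteq> fst ?C"
    using charts_points[OF fc(2)] differential_cotangent[OF _ t] by (auto simp: cotangent_chart_domain snd_g)
  moreover have "Ck_on 1 (chart_image ?b) (snd ?C \<circ> g t \<circ> inv_chart ?b)"
  proof -
    have "Ck_on (Suc 0) (chart_image ?b) (\<lambda>x. cplx x (grad ?b t x))"
    proof (rule Ck_on_SucI[OF op grad_derivative[OF fc(2) t]])
      \<comment> \<open>Here the C^2 hypothesis enters: the derivatives of the fibre coordinates are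
        second derivatives of f, restricted to one time slice.\<close>
      have "continuous_on (chart_image ?b) (\<lambda>x. D2 ?b f (t, x) (0, v) (0, axis k 1))" for v k
      proof (rule continuous_on_compose2[OF C2_continuous[OF C2_local_rep[OF C2 fc(2)]], where f = "\<lambda>x. (t, x)"])
        show "continuous_on (chart_image ?b) (\<lambda>x. (t, x))" by (intro continuous_intros)
        show "(\<lambda>x. (t, x)) ` chart_image ?b \<subseteq> strip ?b" using t by (auto simp: strip_def)
      qed
      then show "Ck_on 0 (chart_image ?b) (\<lambda>x. cplx v (\<chi> k. D2 ?b f (t, x) (0, v) (0, axis k 1)))" for v
        by (auto intro!: continuous_on_cplx continuous_on_vec_lambda continuous_on_const)
    qed
    moreover have "cplx x (grad ?b t x) = (snd ?C \<circ> g t \<circ> inv_chart ?b) x" if "x \<in> chart_image ?b" for x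
      using g_coord_image[OF fc(2) t that] by simp
    ultimately show ?thesis
      using Ck_on_cong[of "chart_image ?b" "\<lambda>x. cplx x (grad ?b t x)" "snd ?C \<circ> g t \<circ> inv_chart ?b" "Suc 0"]
      by simp
  qed
  ultimately show "\<exists>c\<in>charts_at A p. \<exists>C\<in>charts_at cotangent_atlas (g t p). g t ` fst c \<subseteq> fst C \<and>
      Ck_on 1 (chart_image c) (snd C \<circ> g t \<circ> inv_chart c)"
    using fc(3) C by blast
qed

text \<open>The projection is the continuous left inverse that turns the graph map into a
  topological embedding.\<close>

lemma continuous_map_projection: "continuous_map (atlas_topology cotangent_atlas) (atlas_topology A) fst"
  unfolding continuous_map_def
proof (intro conjI allI impI)
  show "fst \<in> topspace (atlas_topology cotangent_atlas) \<rightarrow> topspace (atlas_topology A)"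
    by (auto simp: points_cotangent_bundle)
  fix W assume W: "openin (atlas_topology A) W"
  show "openin (atlas_topology cotangent_atlas) {P \<in> topspace (atlas_topology cotangent_atlas). fst P \<in> W}"
    unfolding T.openin_atlas_topology
  proof (intro conjI ballI)
    show "{P \<in> topspace (atlas_topology cotangent_atlas). fst P \<in> W} \<subseteq> points cotangent_atlas" by simp
    fix C assume "C \<in> cotangent_atlas"
    then obtain c where c: "c \<in> charts A" "C = cotangent_chart A c" by (auto simp: cotangent_bundle_def)
    have "{P \<in> topspace (atlas_topology cotangent_atlas). fst P \<in> W} \<inter> fst C
      = {P. fst P \<in> W \<inter> fst c \<and> snd P \<in> cotangent_space A (fst P)}"
      using charts_points[OF c(1)] by (auto simp: c(2) fst_cotangent_chart points_cotangent_bundle)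
    then show "open (snd C ` ({P \<in> topspace (atlas_topology cotangent_atlas). fst P \<in> W} \<inter> fst C))"
      using cotangent_chart_image[OF c(1), of "W \<inter> fst c"] open_re_part[OF openin_charts[OF W c(1)]]
      by (simp add: c(2))
  qed
qed

lemma continuous_map_g:
  assumes t: "t \<in> {0..1}"
  shows "continuous_map (atlas_topology A) (atlas_topology cotangent_atlas) (g t)"
  unfolding continuous_map_def
proof (intro conjI allI impI)
  show "g t \<in> topspace (atlas_topology A) \<rightarrow> topspace (atlas_topology cotangent_atlas)"
    using g_point[OF _ t] by auto
  fix W assume W: "openin (atlas_topology cotangent_atlas) W"
  show "openin (atlas_topology A) {p \<in> topspace (atlas_topology A). g t p \<in> W}"
    unfolding openin_atlas_topology
  proof (intro conjI ballI)
    show "{p \<in> topspace (atlas_topology A). g t p \<in> W} \<subseteq> points A" by simp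
    fix c assume "c \<in> A"
    then have c: "c \<in> charts A" using atlas_subset_charts by blast
    let ?C = "cotangent_chart A c"
    have C: "?C \<in> cotangent_atlas" using c by (simp add: cotangent_bundle_def)
    have ic: "is_chart c" "is_chart ?C" using c charts_is_chart cotangent_chart_is_chart by blast+
    have mem: "snd c p \<in> chart_image c \<inter> (\<lambda>x. cplx x (grad c t x)) -` (snd ?C ` (W \<inter> fst ?C)) \<longleftrightarrow> g t p \<in> W"
      if p: "p \<in> fst c" for p
    proof -
      have cp: "c \<in> charts_at A p" using c p by (simp add: charts_at_def)
      have "g t p \<in> fst ?C" using p charts_points[OF c p] t
        by (simp add: cotangent_chart_domain snd_g differential_cotangent)
      then show ?thesis
        using snd_chart_in_image[of "W \<inter> fst ?C" ?C "g t p"] ic p g_coord[OF cp t]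
        by (simp add: chart_image_memI)
    qed
    have "snd c ` ({p \<in> topspace (atlas_topology A). g t p \<in> W} \<inter> fst c)
      = chart_image c \<inter> (\<lambda>x. cplx x (grad c t x)) -` (snd ?C ` (W \<inter> fst ?C))" (is "?L = ?R")
    proof (intro equalityI subsetI)
      fix x assume "x \<in> ?L"
      then show "x \<in> ?R" using mem by blast
    next
      fix x assume x: "x \<in> ?R"
      then obtain p where p: "p \<in> fst c" "x = snd c p" by (auto simp: chart_image_def)
      then show "x \<in> ?L" using mem[OF p(1)] x charts_points[OF c p(1)] by auto
    qed
    moreover have "open (snd ?C ` (W \<inter> fst ?C))" using W C by (simp add: T.openin_atlas_topology)
    moreover have "continuous_on (chart_image c) (\<lambda>x. cplx x (grad c t x))"
      using grad_derivative[OF c t] has_derivative_continuous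
      by (intro continuous_at_imp_continuous_on) blast
    ultimately show "open (snd c ` ({p \<in> topspace (atlas_topology A). g t p \<in> W} \<inter> fst c))"
      using continuous_open_preimage[OF _ open_chart_image[OF c]] by simp
  qed
qed

text \<open>Projection splits the graph map, so it is an embedding; the real part of the pushed
  vector is the vector itself, so it is an immersion; and the pullback of \<omega> is the
  antisymmetric part of the Hessian, hence zero.\<close>

lemma lagrangian_g:
  assumes t: "t \<in> {0..1}"
  shows "lagrangian_embedding A cotangent_atlas omega0 (g t)"
  unfolding lagrangian_embedding_def
proof (intro conjI ballI)
  show "C1_map A cotangent_atlas (g t)" by (rule C1_map_g[OF t])
  have "section_map (atlas_topology A) (atlas_topology cotangent_atlas) (g t)"
    unfolding section_map_def retraction_maps_def
    using continuous_map_projection continuous_map_g[OF t] by (intro exI[of _ fst]) simp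
  then show "embedding_map (atlas_topology A) (atlas_topology cotangent_atlas) (g t)"
    by (rule section_imp_embedding_map)
  fix p assume p: "p \<in> points A"
  note fc = flat_chart_facts[OF p]
  show "inj_on (pushforward A cotangent_atlas (g t) p) (tangent_space A p)"
  proof (rule inj_onI)
    fix u v assume u: "u \<in> tangent_space A p" and v: "v \<in> tangent_space A p"
      and eq: "pushforward A cotangent_atlas (g t) p u = pushforward A cotangent_atlas (g t) p v"
    have "u (flat_chart p) = v (flat_chart p)"
      using pushforward_g[OF p t u] pushforward_g[OF p t v] eq by (metis re_part_cplx)
    then show "u = v" by (rule tangent_eqI[OF fc(3) u v])
  qed
  fix u v assume u: "u \<in> tangent_space A p" and v: "v \<in> tangent_space A p"
  show "omega0 (g t p) (pushforward A cotangent_atlas (g t) p u) (pushforward A cotangent_atlas (g t) p v) = 0"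
    unfolding omega0_def pushforward_g[OF p t u] pushforward_g[OF p t v]
    using hess_vec_inner[OF p t] hess_commute[OF p t, of "u (flat_chart p)" "v (flat_chart p)"]
    by (simp add: inner_commute[of _ "hess_vec t p _"])
qed

end


section \<open>The degenerate special Lagrangian equation\<close>

context flat_atlas begin

text \<open>The equation quantifies over all local orthonormal frames; to extract information from
  it one frame around each point must be exhibited.\<close>

lemma coordinate_frame:
  assumes b: "b \<in> B"
  shows "orthonormal_frame A (induced_metric A J0 omega0) (fst b) (\<lambda>i p. coord_vec A b p (axis i 1))"
  unfolding orthonormal_frame_def
proof (intro conjI ballI allI)
  have bA: "b \<in> charts A" using b B_charts by blast
  show "openin (atlas_topology A) (fst b)" by (rule openin_chart_domain[OF bA])
  fix p and i j :: 'n assume p: "p \<in> fst b"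
  note bp = B_charts_at[OF b p]
  show "coord_vec A b p (axis i 1) \<in> tangent_space A p" by (rule coord_vec_tangent[OF bp])
  show "induced_metric A J0 omega0 p (coord_vec A b p (axis i 1)) (coord_vec A b p (axis j 1)) = (if i = j then 1 else 0)"
    unfolding induced_metric_flat[OF b p coord_vec_tangent[OF bp] coord_vec_tangent[OF bp]]
    using bp by (simp add: inner_axis_axis)
next
  fix c i assume c: "c \<in> charts A"
  have bA: "b \<in> charts A" using b B_charts by blast
  note ch = charts_is_chart[OF c] charts_is_chart[OF bA]
  note cb = charts_compatible[OF c bA] and bc = charts_compatible[OF bA c]
  let ?N = "snd c ` (fst c \<inter> fst b)"
  \<comment> \<open>In another chart \<open>c\<close> the frame vectors are the columns of the
    differential of the transition from \<open>b\<close> to \<open>c\<close>.\<close>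
  have "smooth_on ?N (\<lambda>x. frechet_derivative (transition b c) (at (transition c b x)) (axis i 1))"
    by (rule smooth_on_compose[OF cb(1) bc(1), where f = "transition c b"
          and g = "\<lambda>y. frechet_derivative (transition b c) (at y) (axis i 1)"])
      (use ch smooth_on_derivative(2)[OF bc] cb(2) in auto)
  moreover have "frechet_derivative (transition b c) (at (transition c b x)) (axis i 1)
    = coord_vec A b (inv_chart c x) (axis i 1) c" if "x \<in> ?N" for x
    using that ch c by (auto simp: coord_vec_def charts_at_def)
  ultimately show "smooth_on (snd c ` (fst b \<inter> fst c)) (\<lambda>x. coord_vec A b (inv_chart c x) (axis i 1) c)"
    using smooth_on_cong[of ?N "\<lambda>x. frechet_derivative (transition b c) (at (transition c b x)) (axis i 1)"
      "\<lambda>x. coord_vec A b (inv_chart c x) (axis i 1) c"] by (simp add: Int_commute)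
qed

text \<open>The last fact supplies the differentiability in \<open>chart_at\<close> coordinates that
  the Hessian lemmas ask of the frame fields.\<close>

lemma orthonormal_frameD:
  assumes fr: "orthonormal_frame A (induced_metric A J0 omega0) U v" and p: "p \<in> U"
  shows "p \<in> points A" "v i p \<in> tangent_space A p"
    "v i p (flat_chart p) \<bullet> v j p (flat_chart p) = (if i = j then 1 else 0)"
    "((\<lambda>x. v i (inv_chart (chart_at A p) x) (chart_at A p)) has_derivative
      frechet_derivative (\<lambda>x. v i (inv_chart (chart_at A p) x) (chart_at A p)) (at (snd (chart_at A p) p)))
      (at (snd (chart_at A p) p))"
proof -
  have U: "openin (atlas_topology A) U" using fr by (simp add: orthonormal_frame_def)
  then show pA: "p \<in> points A" using p openin_subset by fastforce
  have tan: "v i p \<in> tangent_space A p" for i using fr p by (simp add: orthonormal_frame_def)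
  then show "v i p \<in> tangent_space A p" .
  show "v i p (flat_chart p) \<bullet> v j p (flat_chart p) = (if i = j then 1 else 0)"
    using fr p induced_metric_flat[OF flat_chart_in(1,2)[OF pA] tan tan]
    by (simp add: orthonormal_frame_def)
  note c = chart_at_in[OF pA]
  note cc = charts_atD[OF c]
  show "((\<lambda>x. v i (inv_chart (chart_at A p) x) (chart_at A p)) has_derivative
      frechet_derivative (\<lambda>x. v i (inv_chart (chart_at A p) x) (chart_at A p)) (at (snd (chart_at A p) p)))
      (at (snd (chart_at A p) p))"
    by (rule smooth_on_derivative(1)[OF openin_charts[OF U cc(1)]])
      (use fr cc p in \<open>auto simp: orthonormal_frame_def\<close>)
qed

end

context C2_path begin

abbreviation metric where "metric \<equiv> induced_metric A J0 omega0"

text \<open>The number \<open>\<kappa>\<close> of the overview; it is not normalized and has modulus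
  |det K|.\<close>

definition phase :: "real \<Rightarrow> real \<Rightarrow> 'a \<Rightarrow> complex" where
  "phase \<theta> t p = exp (- \<i> * of_real \<theta>) * det (K t p)"

lemma Omega0_push:
  assumes p: "p \<in> points A" and t: "t \<in> {0..1}" and v: "\<And>k. v k \<in> tangent_space A p"
  shows "Omega0 (g t p) (\<lambda>k. pushforward A cotangent_atlas (g t) p (v k))
    = det (K t p) * of_real (det (\<chi> j k. v k (flat_chart p) $ j))"
  unfolding Omega0_def pushforward_g[OF p t v] K_mult[OF p t, symmetric] det_columns det_real_columns ..

lemma positive_iff:
  assumes t: "t \<in> {0..1}"
  shows "positive_of_phase A B cotangent_atlas Omega0 \<theta> (g t) \<longleftrightarrow> (\<forall>p\<in>points A. Re (phase \<theta> t p) > 0)"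
proof
  assume pos: "positive_of_phase A B cotangent_atlas Omega0 \<theta> (g t)"
  show "\<forall>p\<in>points A. Re (phase \<theta> t p) > 0"
  proof
    fix p assume p: "p \<in> points A"
    note fc = flat_chart_facts[OF p]
    \<comment> \<open>A positively oriented basis of volume 1, on which the rotated form takes the
      value \<open>phase \<theta> t p\<close>.\<close>
    let ?v = "\<lambda>k. coord_vec A (flat_chart p) p (axis k 1)"
    have tan: "?v k \<in> tangent_space A p" for k by (rule coord_vec_tangent[OF fc(3)])
    have "(\<chi> j k. ?v k (flat_chart p) $ j) = mat 1"
      using fc by (simp add: vec_eq_iff mat_def axis_def)
    then have d: "det (\<chi> j k. ?v k (flat_chart p) $ j) = 1" by (simp only: det_I)
    have "Re (exp (- \<i> * of_real \<theta>) * Omega0 (g t p) (\<lambda>k. pushforward A cotangent_atlas (g t) p (?v k))) > 0"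
      using pos p tan fc(1,4) d unfolding positive_of_phase_def by (metis zero_less_one)
    then show "Re (phase \<theta> t p) > 0"
      unfolding Omega0_push[OF p t tan] d by (simp add: phase_def)
  qed
next
  assume pos: "\<forall>p\<in>points A. Re (phase \<theta> t p) > 0"
  show "positive_of_phase A B cotangent_atlas Omega0 \<theta> (g t)"
    unfolding positive_of_phase_def
  proof (intro ballI allI impI, elim conjE bexE)
    fix p v c assume p: "p \<in> points A" and v: "\<forall>k. v k \<in> tangent_space A p"
      and c: "c \<in> B" "p \<in> fst c" and d: "det (\<chi> j k. v k c $ j) > 0"
    have "v k c = v k (flat_chart p)" for k
      using v c flat_chart_facts[OF p] by (intro tangent_flat) auto
    then have d': "det (\<chi> j k. v k (flat_chart p) $ j) > 0" using d by simp
    have "exp (- \<i> * of_real \<theta>) * Omega0 (g t p) (\<lambda>k. pushforward A cotangent_atlas (g t) p (v k))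
      = phase \<theta> t p * of_real (det (\<chi> j k. v k (flat_chart p) $ j))"
      using Omega0_push[OF p t, of v] v by (simp add: phase_def)
    then show "Re (exp (- \<i> * of_real \<theta>) * Omega0 (g t p) (\<lambda>k. pushforward A cotangent_atlas (g t) p (v k))) > 0"
      using pos p d' by simp
  qed
qed

lemma hessian_frame:
  assumes fr: "orthonormal_frame A metric U v" and p: "p \<in> U" and t: "t \<in> {0..1}"
  shows "hessian A metric (f t) (v i) (v j) p = hess t p (v i p (flat_chart p)) (v j p (flat_chart p))"
proof -
  note fd = orthonormal_frameD[OF fr p]
  note fc = flat_chart_facts[OF fd(1)]
  show ?thesis
    unfolding hess_def base_point_def
    by (rule hessian_flat[where V = "v i" and W = "v j", OF C2 t fc(1,4) fd(2) fd(2)]) (use fd(4) in \<open>auto simp: differentiable_def\<close>)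
qed

lemma product_hessian_frame:
  assumes fr: "orthonormal_frame A metric U v" and p: "p \<in> U" and t: "t \<in> {0..1}"
  shows "product_hessian A metric f (product_frame v a) (product_frame v b) t p
    = D2 (flat_chart p) f (base_point t p)
      (case a of None \<Rightarrow> (1, 0) | Some i \<Rightarrow> (0, v i p (flat_chart p)))
      (case b of None \<Rightarrow> (1, 0) | Some i \<Rightarrow> (0, v i p (flat_chart p)))"
proof -
  note fd = orthonormal_frameD[OF fr p]
  note fc = flat_chart_facts[OF fd(1)]
  let ?c = "chart_at A p"
  have zero: "(\<lambda>_. 0) \<in> tangent_space A p"
    using tangent_lincomb[OF fd(2) fd(2), of 0 undefined 0 undefined] by (simp add: lincomb_def)
  have tan: "snd (product_frame v a t p) \<in> tangent_space A p" for a
    using zero fd(2) by (simp add: product_frame_def split: option.split)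
  have dif: "(\<lambda>(s, x). (fst (product_frame v b s (inv_chart ?c x)), snd (product_frame v b s (inv_chart ?c x)) ?c))
      differentiable at (t, snd ?c p) within ({0..1} \<times> chart_image ?c)"
  proof (cases b)
    case None
    then show ?thesis by (simp add: product_frame_def case_prod_unfold)
  next
    case (Some i)
    have "((\<lambda>z :: real \<times> (real^'n). v i (inv_chart ?c (snd z)) ?c) has_derivative
      (\<lambda>z. frechet_derivative (\<lambda>x. v i (inv_chart ?c x) ?c) (at (snd ?c p)) (snd z)))
      (at (t, snd ?c p) within ({0..1} \<times> chart_image ?c))"
      by (rule has_derivative_compose[where f = snd and g = "\<lambda>x. v i (inv_chart ?c x) ?c"])
        (auto intro: derivative_eq_intros fd(4))
    then have "((\<lambda>z :: real \<times> (real^'n). (0::real, v i (inv_chart ?c (snd z)) ?c)) has_derivative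
      (\<lambda>z. (0, frechet_derivative (\<lambda>x. v i (inv_chart ?c x) ?c) (at (snd ?c p)) (snd z))))
      (at (t, snd ?c p) within ({0..1} \<times> chart_image ?c))"
      by (intro has_derivative_Pair has_derivative_const)
    then show ?thesis using Some by (auto simp: product_frame_def case_prod_unfold differentiable_def)
  qed
  have "product_hessian A metric f (product_frame v a) (product_frame v b) t p
    = D2 (flat_chart p) f (t, snd (flat_chart p) p)
       (fst (product_frame v a t p), snd (product_frame v a t p) (flat_chart p))
       (fst (product_frame v b t p), snd (product_frame v b t p) (flat_chart p))"
    by (rule product_hessian_flat[where V = "product_frame v a" and W = "product_frame v b",
          OF C2 t fc(1,4) tan tan dif])
  then show ?thesis
    by (simp add: base_point_def product_frame_def split: option.splits)
qed

lemma frame_matrix: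
  assumes fr: "orthonormal_frame A metric U v" and p: "p \<in> U" and t: "t \<in> {0..1}"
  defines "V \<equiv> cmat (\<chi> k j. v j p (flat_chart p) $ k)"
  shows "lag_matrix (\<lambda>i j. hess t p (v i p (flat_chart p)) (v j p (flat_chart p))) = transpose V ** K t p ** V"
    and "transpose V ** V = mat 1"
  unfolding V_def K_def
  by (rule lag_matrix_conjugate[OF hess_bilinear[OF orthonormal_frameD(1)[OF fr p] t]
        orthonormal_frameD(3)[OF fr p]])+

text \<open>All orthonormal frames give the same determinant, so the condition over frames collapses
  to a condition at points.\<close>

lemma DSL_Re_iff:
  "DSL_Re A metric \<theta> f \<longleftrightarrow> (\<forall>t\<in>{0..1}. \<forall>p\<in>points A. Re (phase \<theta> t p) > 0)"
proof -
  have frame: "exp (- \<i> * of_real \<theta>) *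
      det (\<chi> i j. (if i = j then 1 else 0) + \<i> * of_real (hessian A metric (f t) (v i) (v j) p)) = phase \<theta> t p"
    if "orthonormal_frame A metric U v" "t \<in> {0..1}" "p \<in> U" for U v t p
    unfolding hessian_frame[OF that(1,3,2)] lag_matrix_def[symmetric] frame_matrix(1)[OF that(1,3,2)]
      det_conjugate[OF frame_matrix(2)[OF that(1,3,2)]] phase_def ..
  show ?thesis
  proof
    assume D: "DSL_Re A metric \<theta> f"
    show "\<forall>t\<in>{0..1}. \<forall>p\<in>points A. Re (phase \<theta> t p) > 0"
    proof (intro ballI)
      fix t :: real and p assume t: "t \<in> {0..1}" and p: "p \<in> points A"
      note fc = flat_chart_facts[OF p]
      note fr = coordinate_frame[OF fc(1)]
      show "Re (phase \<theta> t p) > 0"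
        using D[unfolded DSL_Re_def, rule_format, OF fr t fc(4)] unfolding frame[OF fr t fc(4)] .
    qed
  next
    assume pos: "\<forall>t\<in>{0..1}. \<forall>p\<in>points A. Re (phase \<theta> t p) > 0"
    show "DSL_Re A metric \<theta> f"
      unfolding DSL_Re_def
    proof (intro allI impI ballI)
      fix U v and t :: real and p assume fr: "orthonormal_frame A metric U v" and t: "t \<in> {0..1}" and p: "p \<in> U"
      show "Re (exp (- \<i> * of_real \<theta>) *
        det (\<chi> i j. (if i = j then 1 else 0) + \<i> * of_real (hessian A metric (f t) (v i) (v j) p))) > 0"
        unfolding frame[OF fr t p] using pos t orthonormal_frameD(1)[OF fr p] by blast
    qed
  qed
qed

text \<open>The base point stays fixed along the curve, so the velocity is vertical, hence purely
  imaginary.\<close>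

lemma curve_velocity_g:
  assumes p: "p \<in> points A" and t: "t \<in> {0..1}"
  shows "curve_velocity cotangent_atlas (\<lambda>s. g s p) t (flat_cotangent_chart (g t p)) = cplx 0 (mixed t p)"
proof -
  note fc = flat_chart_facts[OF p]
  let ?b = "flat_chart p" and ?x = "snd (flat_chart p) p"
  have "((\<lambda>s. cplx ?x (grad ?b s ?x)) has_derivative
      (\<lambda>a. cplx 0 (\<chi> k. a *\<^sub>R D2 ?b f (t, ?x) (1, 0) (0, axis k 1)))) (at t within {0..1})"
    unfolding grad_def
    by (intro has_derivative_cplx has_derivative_const has_derivative_vec_lambda
        D1_slices(4)[OF C2 fc(2) t fc(6), unfolded has_vector_derivative_def])
  moreover have "cplx 0 (\<chi> k. a *\<^sub>R D2 ?b f (t, ?x) (1, 0) (0, axis k 1)) = a *\<^sub>R cplx 0 (mixed t p)" for a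
    by (simp add: vec_eq_iff mixed_def base_point_def complex_eq_iff)
  ultimately have "((\<lambda>s. cplx ?x (grad ?b s ?x)) has_vector_derivative cplx 0 (mixed t p)) (at t within {0..1})"
    by (simp add: has_vector_derivative_def)
  then have "((\<lambda>s. snd (flat_cotangent_chart (g t p)) (g s p)) has_vector_derivative cplx 0 (mixed t p)) (at t within {0..1})"
    by (rule has_vector_derivative_transform[OF t, rotated])
      (simp add: flat_cotangent_chart_def g_coord[OF fc(3)])
  from vector_derivative_within_closed_interval[OF _ t this]
  show ?thesis
    using flat_cotangent_chart_at[OF g_point[OF p t]] by (simp add: curve_velocity_def)
qed

lemma time_deriv_coord:
  assumes b: "b \<in> charts_at A q" and t: "t \<in> {0..1}"
  shows "time_deriv f t q = D1 b f (t, snd b q) (1, 0)"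
proof -
  note cb = charts_atD[OF b]
  have "((\<lambda>s. f s q) has_vector_derivative D1 b f (t, snd b q) (1, 0)) (at t within {0..1})"
    using D1_slices(3)[OF C2 cb(1) t chart_image_memI[OF cb(2)]] cb by simp
  from vector_derivative_within_closed_interval[OF _ t this] show ?thesis by (simp add: time_deriv_def)
qed

section \<open>Velocity function, the vector field \<zeta> and the geodesic equation\<close>

context
  fixes h :: "real \<Rightarrow> ('a, 'n) cotangent_point \<Rightarrow> real"
  assumes h: "\<forall>t\<in>{0..1}. \<forall>p\<in>points A. h t (g t p) = - time_deriv f t p"
begin

text \<open>Only the values of \<open>h t\<close> on the graph enter. Space derivatives of the time
  derivative appear here, while \<open>mixed\<close> takes time derivatives of space derivatives;
  \<open>D2_commute\<close> identifies them.\<close>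

lemma differential_h:
  assumes p: "p \<in> points A" and t: "t \<in> {0..1}" and v: "v \<in> tangent_space A p"
  shows "differential A (h t \<circ> g t) p v = - (mixed t p \<bullet> v (flat_chart p))"
proof -
  note fc = flat_chart_facts[OF p]
  let ?b = "flat_chart p" and ?x = "snd (flat_chart p) p"
  have "((\<lambda>x. - D1 ?b f (t, x) (1, 0)) has_derivative (\<lambda>v. - D2 ?b f (t, ?x) (0, v) (1, 0))) (at ?x)"
    by (intro has_derivative_minus D1_slices(2)[OF C2 fc(2) t fc(6)])
  then have "(h t \<circ> g t \<circ> inv_chart ?b has_derivative (\<lambda>v. - D2 ?b f (t, ?x) (0, v) (1, 0))) (at ?x)"
  proof (rule has_derivative_transform_within_open[OF _ open_chart_image[OF fc(2)] fc(6)])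
    fix x assume x: "x \<in> chart_image ?b"
    note q = inv_chart_right[OF x]
    have "?b \<in> charts_at A (inv_chart ?b x)" using fc(2) q by (simp add: charts_at_def)
    then show "- D1 ?b f (t, x) (1, 0) = (h t \<circ> g t \<circ> inv_chart ?b) x"
      using h t charts_points[OF fc(2) q(1)] time_deriv_coord[of ?b "inv_chart ?b x" t] q(2) by simp
  qed
  from differential_eq[OF fc(3) this v]
  show ?thesis
    using mixed_inner[OF p t] D2_commute[OF p t, of "(1, 0)"] by (simp add: base_point_def)
qed

text \<open>Pairing the vertical velocity i a with w + i H w under \<open>omega0\<close> gives minus
  the product of a and w, which is the origin of the sign in \<open>h\<close>.\<close>

lemma velocity_equation_g: "velocity_equation A cotangent_atlas omega0 g h"
  unfolding velocity_equation_def
proof (intro ballI)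
  fix t :: real and p v assume t: "t \<in> {0..1}" and p: "p \<in> points A" and v: "v \<in> tangent_space A p"
  show "omega0 (g t p) (curve_velocity cotangent_atlas (\<lambda>s. g s p) t) (pushforward A cotangent_atlas (g t) p v)
    = differential A (h t \<circ> g t) p v"
    unfolding omega0_def curve_velocity_g[OF p t] pushforward_g[OF p t v] differential_h[OF p t v] by simp
qed

lemma h_time_derivative:
  assumes p: "p \<in> points A" and t: "t \<in> {0..1}"
  shows "vector_derivative (\<lambda>s. h s (g s p)) (at t within {0..1}) = - ftt t p"
proof -
  note fc = flat_chart_facts[OF p]
  let ?b = "flat_chart p" and ?x = "snd (flat_chart p) p"
  have "((\<lambda>s. - D1 ?b f (s, ?x) (1, 0)) has_vector_derivative - D2 ?b f (t, ?x) (1, 0) (1, 0)) (at t within {0..1})"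
    by (intro has_vector_derivative_minus D1_slices(4)[OF C2 fc(2) t fc(6)])
  then have "((\<lambda>s. h s (g s p)) has_vector_derivative - D2 ?b f (t, ?x) (1, 0) (1, 0)) (at t within {0..1})"
    by (rule has_vector_derivative_transform[OF t, rotated]) (use h p time_deriv_coord[OF fc(3)] in simp)
  from vector_derivative_within_closed_interval[OF _ t this]
  show ?thesis by (simp add: ftt_def base_point_def)
qed

context
  fixes \<theta> :: real and t :: real and p :: 'a
  assumes t: "t \<in> {0..1}" and p: "p \<in> points A" and pos: "Re (phase \<theta> t p) > 0"
begin

definition "K_solution = (SOME y. K t p *v y = cplx 0 (mixed t p))"

text \<open>This is \<zeta> in flat coordinates multiplied by \<open>- Re \<kappa>\<close>. Left
  undivided, it appears literally in the imaginary part of the bordered determinant.\<close>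

definition "zeta_vec = re_part (phase \<theta> t p *s K_solution)"

lemma K_solution: "K t p *v K_solution = cplx 0 (mixed t p)"
proof -
  have "det (K t p) \<noteq> 0" using pos by (auto simp: phase_def)
  then obtain L where "K t p ** L = mat 1" by (metis invertible_det_nz invertible_def)
  then have "K t p *v (L *v cplx 0 (mixed t p)) = cplx 0 (mixed t p)"
    by (simp only: matrix_vector_mul_assoc matrix_vector_mul_lid)
  then show ?thesis unfolding K_solution_def by (rule someI)
qed

lemma zeta_lhs:
  assumes v: "\<And>i. v i \<in> tangent_space A p" and z: "z \<in> tangent_space A p"
  shows "Re (exp (- \<i> * of_real \<theta>) *
      Omega0 (g t p) (\<lambda>i. pushforward A cotangent_atlas (g t) p ((v(k := z)) i)))
    = Re (phase \<theta> t p) * det (\<chi> j i. ((\<lambda>i. v i (flat_chart p))(k := z (flat_chart p))) i $ j)"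
proof -
  have tan: "(v(k := z)) i \<in> tangent_space A p" for i using v z by simp
  have "(v(k := z)) i (flat_chart p) = ((\<lambda>i. v i (flat_chart p))(k := z (flat_chart p))) i" for i
    by simp
  then have "exp (- \<i> * of_real \<theta>) * Omega0 (g t p) (\<lambda>i. pushforward A cotangent_atlas (g t) p ((v(k := z)) i))
    = phase \<theta> t p * of_real (det (\<chi> j i. ((\<lambda>i. v i (flat_chart p))(k := z (flat_chart p))) i $ j))"
    by (simp only: Omega0_push[OF p t tan] phase_def mult.assoc)
  then show ?thesis by (simp only:) simp
qed

text \<open>The velocity is \<open>K\<close> applied to the complex vector
  \<open>K_solution\<close>, just as the pushed vectors are \<open>K\<close> applied to real ones.
  So det K factors out of all columns together, and \<open>Re_det_column\<close> handles the one
  complex column left.\<close>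

lemma zeta_rhs:
  assumes v: "\<And>i. v i \<in> tangent_space A p"
  shows "Re (exp (- \<i> * of_real \<theta>) *
      Omega0 (g t p) ((\<lambda>i. pushforward A cotangent_atlas (g t) p (v i))
        (k := curve_velocity cotangent_atlas (\<lambda>s. g s p) t)))
    = det (\<chi> j i. ((\<lambda>i. v i (flat_chart p))(k := zeta_vec)) i $ j)"
proof -
  let ?w = "(\<lambda>i. cplx (v i (flat_chart p)) 0)(k := K_solution)"
  have "((\<lambda>i. pushforward A cotangent_atlas (g t) p (v i)) (k := curve_velocity cotangent_atlas (\<lambda>s. g s p) t)) i
      (flat_cotangent_chart (g t p)) = K t p *v ?w i" for i
    using pushforward_g[OF p t v] curve_velocity_g[OF p t] K_mult[OF p t] K_solution by simp
  then have "Omega0 (g t p) ((\<lambda>i. pushforward A cotangent_atlas (g t) p (v i))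
        (k := curve_velocity cotangent_atlas (\<lambda>s. g s p) t)) = det (K t p) * det (\<chi> j i. ?w i $ j)"
    unfolding Omega0_def by (simp only: det_columns)
  then show ?thesis
    unfolding zeta_vec_def by (simp only: Re_det_column[symmetric] phase_def mult.assoc)
qed

lemma zeta_g:
  "zeta A cotangent_atlas Omega0 \<theta> g t p
    = coord_vec A (flat_chart p) p ((- 1 / Re (phase \<theta> t p)) *\<^sub>R zeta_vec)"
  (is "_ = ?z")
  unfolding zeta_def
proof (rule the_equality)
  note fc = flat_chart_facts[OF p]
  have z: "?z \<in> tangent_space A p" by (rule coord_vec_tangent[OF fc(3)])
  have zb: "?z (flat_chart p) = (- 1 / Re (phase \<theta> t p)) *\<^sub>R zeta_vec" using fc(3) by simp
  show "?z \<in> tangent_space A p \<and>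
      (\<forall>v k. (\<forall>i. v i \<in> tangent_space A p) \<longrightarrow>
         Re (exp (- \<i> * of_real \<theta>) *
           Omega0 (g t p) (\<lambda>i. pushforward A cotangent_atlas (g t) p ((v(k := ?z)) i)))
         = - Re (exp (- \<i> * of_real \<theta>) *
           Omega0 (g t p) ((\<lambda>i. pushforward A cotangent_atlas (g t) p (v i))
              (k := curve_velocity cotangent_atlas (\<lambda>s. g s p) t))))"
  proof (intro conjI allI impI z)
    fix v :: "'n \<Rightarrow> ('a, real^'n) tvec" and k assume v: "\<forall>i. v i \<in> tangent_space A p"
    show "Re (exp (- \<i> * of_real \<theta>) *
           Omega0 (g t p) (\<lambda>i. pushforward A cotangent_atlas (g t) p ((v(k := ?z)) i)))
         = - Re (exp (- \<i> * of_real \<theta>) *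
           Omega0 (g t p) ((\<lambda>i. pushforward A cotangent_atlas (g t) p (v i))
              (k := curve_velocity cotangent_atlas (\<lambda>s. g s p) t)))"
      unfolding zeta_lhs[OF v[rule_format] z] zeta_rhs[OF v[rule_format]] zb det_scaled_column
      using pos by simp
  qed
next
  note fc = flat_chart_facts[OF p]
  fix z assume "z \<in> tangent_space A p \<and>
      (\<forall>v k. (\<forall>i. v i \<in> tangent_space A p) \<longrightarrow>
         Re (exp (- \<i> * of_real \<theta>) *
           Omega0 (g t p) (\<lambda>i. pushforward A cotangent_atlas (g t) p ((v(k := z)) i)))
         = - Re (exp (- \<i> * of_real \<theta>) *
           Omega0 (g t p) ((\<lambda>i. pushforward A cotangent_atlas (g t) p (v i))
              (k := curve_velocity cotangent_atlas (\<lambda>s. g s p) t))))"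
  then have z: "z \<in> tangent_space A p" and eq: "\<And>v k. (\<forall>i. v i \<in> tangent_space A p) \<Longrightarrow>
         Re (exp (- \<i> * of_real \<theta>) *
           Omega0 (g t p) (\<lambda>i. pushforward A cotangent_atlas (g t) p ((v(k := z)) i)))
         = - Re (exp (- \<i> * of_real \<theta>) *
           Omega0 (g t p) ((\<lambda>i. pushforward A cotangent_atlas (g t) p (v i))
              (k := curve_velocity cotangent_atlas (\<lambda>s. g s p) t)))"
    by blast+
  \<comment> \<open>Uniqueness needs only the coordinate basis: replacing its k-th vector makes both
    determinants equal to k-th components.\<close>
  let ?v = "\<lambda>i. coord_vec A (flat_chart p) p (axis i 1)"
  have v: "?v i \<in> tangent_space A p" for i by (rule coord_vec_tangent[OF fc(3)])
  have "z (flat_chart p) $ k = ((- 1 / Re (phase \<theta> t p)) *\<^sub>R zeta_vec) $ k" for k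
  proof -
    have "Re (phase \<theta> t p) * z (flat_chart p) $ k = - (zeta_vec $ k)"
      using eq[of ?v k] v unfolding zeta_lhs[of ?v z k, OF v z] zeta_rhs[of ?v k, OF v]
        coord_vec_at[OF fc(3)] det_axis_column by simp
    then show ?thesis using pos by (simp add: field_simps)
  qed
  then have "z (flat_chart p) = ?z (flat_chart p)" using fc(3) by (simp add: vec_eq_iff)
  then show "z = ?z" by (rule tangent_eqI[OF fc(3) z coord_vec_tangent[OF fc(3)]])
qed

text \<open>Multiplication by the nonzero number \<open>- Re \<kappa>\<close> clears the denominator
  of \<zeta>.\<close>

lemma geodesic_expression:
  "vector_derivative (\<lambda>s. h s (g s p)) (at t within {0..1})
     + differential A (h t \<circ> g t) p (zeta A cotangent_atlas Omega0 \<theta> g t p) = 0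
   \<longleftrightarrow> ftt t p * Re (phase \<theta> t p) - mixed t p \<bullet> zeta_vec = 0"
proof -
  note fc = flat_chart_facts[OF p]
  have z: "zeta A cotangent_atlas Omega0 \<theta> g t p \<in> tangent_space A p"
    unfolding zeta_g by (rule coord_vec_tangent[OF fc(3)])
  show ?thesis
    unfolding h_time_derivative[OF p t] differential_h[OF p t z]
    unfolding zeta_g coord_vec_at[OF fc(3)]
    using pos by (auto simp: field_simps)
qed

text \<open>The corner has no summand 1, since I_n is 0 in the time slot; it is i times the second
  time derivative. The borders are the rotated vector i a, so the Schur complement is i times a
  complex scalar and the imaginary part becomes a real part of \<open>\<kappa>\<close> times
  it.\<close>

lemma DSL_Im_expression:
  assumes fr: "orthonormal_frame A metric U v" and pU: "p \<in> U"
  shows "Im (exp (- \<i> * of_real \<theta>) *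
      det (\<chi> a b. (if a = b \<and> a \<noteq> None then 1 else 0) +
        \<i> * of_real (product_hessian A metric f (product_frame v a) (product_frame v b) t p)))
    = ftt t p * Re (phase \<theta> t p) - mixed t p \<bullet> zeta_vec"
proof -
  let ?w = "\<lambda>i. v i p (flat_chart p)"
  define V where "V = cmat (\<chi> k j. ?w j $ k)"
  let ?\<alpha> = "cplx 0 (mixed t p)"
  note fm = frame_matrix[OF fr pU t, folded V_def]
  \<comment> \<open>The border in the frame is the coordinate border turned by \<open>V\<close>, the
    form that \<open>bordered_conjugate_det\<close> expects.\<close>
  have \<alpha>: "(transpose V *v ?\<alpha>) $ j = \<i> * of_real (mixed t p \<bullet> ?w j)" for j
    by (simp add: matrix_vector_mult_def transpose_def V_def cmat_def inner_vec_def sum_distrib_left complex_eq_iff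
        mult.commute)
  have "(\<chi> a b. (if a = b \<and> a \<noteq> None then 1 else 0) +
        \<i> * of_real (product_hessian A metric f (product_frame v a) (product_frame v b) t p))
    = bordered (\<i> * of_real (ftt t p)) (\<lambda>j. (transpose V *v ?\<alpha>) $ j) (\<lambda>i. (transpose V *v ?\<alpha>) $ i)
      (transpose V ** K t p ** V)"
    unfolding \<alpha> fm(1)[symmetric] product_hessian_frame[OF fr pU t]
    using D2_commute[OF p t, of "(0, _)" "(1, 0)"] mixed_inner[OF p t]
    by (auto simp: vec_eq_iff bordered_def lag_matrix_def ftt_def hess_def split: option.split)
  moreover have "det (bordered (\<i> * of_real (ftt t p)) (\<lambda>j. (transpose V *v ?\<alpha>) $ j) (\<lambda>i. (transpose V *v ?\<alpha>) $ i)
      (transpose V ** K t p ** V))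
    = (\<i> * of_real (ftt t p) - (\<Sum>k\<in>UNIV. ?\<alpha> $ k * K_solution $ k)) * det (K t p)"
    by (rule bordered_conjugate_det[OF fm(2) K_solution])
  ultimately have "exp (- \<i> * of_real \<theta>) *
      det (\<chi> a b. (if a = b \<and> a \<noteq> None then 1 else 0) +
        \<i> * of_real (product_hessian A metric f (product_frame v a) (product_frame v b) t p))
    = (\<i> * of_real (ftt t p) - (\<Sum>k\<in>UNIV. ?\<alpha> $ k * K_solution $ k)) * phase \<theta> t p"
    by (simp only: phase_def mult.left_commute)
  also have "\<dots> = \<i> * of_real (ftt t p) * phase \<theta> t p
      - (\<Sum>k\<in>UNIV. \<i> * (of_real (mixed t p $ k) * (phase \<theta> t p *s K_solution) $ k))"
  proof -
    have "?\<alpha> $ k = \<i> * of_real (mixed t p $ k)" for k by (simp add: complex_eq_iff)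
    then show ?thesis
      by (simp only: left_diff_distrib sum_distrib_right vector_smult_component)
        (simp only: mult.commute mult.left_commute mult.assoc)
  qed
  also have "Im \<dots> = ftt t p * Re (phase \<theta> t p) - mixed t p \<bullet> zeta_vec"
    by (simp add: zeta_vec_def inner_vec_def)
  finally show ?thesis .
qed

end

lemma geodesic_iff:
  assumes pos: "\<forall>t\<in>{0..1}. \<forall>p\<in>points A. Re (phase \<theta> t p) > 0"
  shows "geodesic_equation A cotangent_atlas Omega0 \<theta> g h \<longleftrightarrow> DSL_Im A metric \<theta> f"
proof -
  \<comment> \<open>The graph map is injective because it preserves the base point; the quantifier
    over points of the submanifold becomes one over the base.\<close>
  have inv: "inv_into (points A) (g t) (g t p) = p" if "p \<in> points A" for t p
    using that by (intro inv_into_f_f inj_onI) (metis fst_g)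
  have "geodesic_equation A cotangent_atlas Omega0 \<theta> g h \<longleftrightarrow>
    (\<forall>t\<in>{0..1}. \<forall>p\<in>points A. vector_derivative (\<lambda>s. h s (g s p)) (at t within {0..1})
     + differential A (h t \<circ> g t) p (zeta A cotangent_atlas Omega0 \<theta> g t p) = 0)"
    unfolding geodesic_equation_def Let_def by (simp add: inv)
  also have "\<dots> \<longleftrightarrow> (\<forall>t\<in>{0..1}. \<forall>p\<in>points A. ftt t p * Re (phase \<theta> t p) - mixed t p \<bullet> zeta_vec \<theta> t p = 0)"
    using pos by (intro ball_cong refl geodesic_expression) auto
  also have "\<dots> \<longleftrightarrow> DSL_Im A metric \<theta> f"
  proof
    assume G: "\<forall>t\<in>{0..1}. \<forall>p\<in>points A. ftt t p * Re (phase \<theta> t p) - mixed t p \<bullet> zeta_vec \<theta> t p = 0"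
    show "DSL_Im A metric \<theta> f"
      unfolding DSL_Im_def
    proof (intro allI impI ballI)
      fix U v and t :: real and p assume fr: "orthonormal_frame A metric U v" and t: "t \<in> {0..1}" and p: "p \<in> U"
      have pA: "p \<in> points A" by (rule orthonormal_frameD(1)[OF fr p])
      show "Im (exp (- \<i> * of_real \<theta>) *
            det (\<chi> a b. (if a = b \<and> a \<noteq> None then 1 else 0) +
                   \<i> * of_real (product_hessian A metric f (product_frame v a) (product_frame v b) t p))) = 0"
        using DSL_Im_expression[OF t pA pos[rule_format, OF t pA] fr p] G t pA by simp
    qed
  next
    assume D: "DSL_Im A metric \<theta> f"
    show "\<forall>t\<in>{0..1}. \<forall>p\<in>points A. ftt t p * Re (phase \<theta> t p) - mixed t p \<bullet> zeta_vec \<theta> t p = 0"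
    proof (intro ballI)
      fix t :: real and p assume t: "t \<in> {0..1}" and p: "p \<in> points A"
      note fc = flat_chart_facts[OF p]
      note fr = coordinate_frame[OF fc(1)]
      show "ftt t p * Re (phase \<theta> t p) - mixed t p \<bullet> zeta_vec \<theta> t p = 0"
        using D[unfolded DSL_Im_def, rule_format, OF fr t fc(4)]
          DSL_Im_expression[OF t p pos[rule_format, OF t p] fr fc(4)] by simp
    qed
  qed
  finally show ?thesis .
qed

end

end

theorem theorem1p1p2:
  fixes M :: "('a, real^'n) chart set"
  assumes "integrably_parallelizable M"
  shows "\<exists>J \<omega> \<Omega> Or.
    calabi_yau (cotangent_bundle M) J \<omega> \<Omega> \<and>
    orientation M Or \<and>
    flat_metric M (induced_metric M J \<omega>) \<and>
    (\<forall>\<theta>\<in>{-pi<..pi}. \<forall>f. C2_on_product M f \<longrightarrow>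
      (\<forall>t\<in>{0..1}. lagrangian_embedding M (cotangent_bundle M) \<omega> (graph_path M f t)) \<and>
      ((\<forall>t\<in>{0..1}. positive_of_phase M Or (cotangent_bundle M) \<Omega> \<theta> (graph_path M f t))
        \<longleftrightarrow> DSL_Re M (induced_metric M J \<omega>) \<theta> f) \<and>
      (\<forall>h. (\<forall>t\<in>{0..1}. \<forall>p\<in>points M. h t (graph_path M f t p) = - time_deriv f t p) \<longrightarrow>
        velocity_equation M (cotangent_bundle M) \<omega> (graph_path M f) h \<and>
        ((\<forall>t\<in>{0..1}. positive_of_phase M Or (cotangent_bundle M) \<Omega> \<theta> (graph_path M f t)) \<longrightarrow>
          (geodesic_equation M (cotangent_bundle M) \<Omega> \<theta> (graph_path M f) h
            \<longleftrightarrow> DSL_Im M (induced_metric M J \<omega>) \<theta> f))))"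
proof -
  obtain B where B: "B \<subseteq> charts M" "points B = points M"
    and flat: "\<forall>c\<in>B. \<forall>c'\<in>B. \<forall>x\<in>snd c ` (fst c \<inter> fst c'). frechet_derivative (transition c c') (at x) = id"
    and M: "smooth_atlas M"
    using assms unfolding integrably_parallelizable_def smooth_manifold_def by blast
  interpret flat_atlas M B
    by unfold_locales (use B flat M in auto)
  show ?thesis
  proof (intro exI conjI ballI allI impI)
    show "calabi_yau (cotangent_bundle M) J0 omega0 Omega0" by (rule calabi_yau_0)
    show "orientation M B" by (rule orientation_flat)
    show "flat_metric M (induced_metric M J0 omega0)" by (rule flat_metric_induced)
  next
    fix \<theta> and f :: "real \<Rightarrow> 'a \<Rightarrow> real" assume "C2_on_product M f"
    \<comment> \<open>f is fixed only now: the Calabi-Yau structure and the orientation depend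
      neither on f nor on \<theta>.\<close>
    then interpret C2_path M B f by unfold_locales
    show "lagrangian_embedding M (cotangent_bundle M) omega0 (graph_path M f t)" if "t \<in> {0..1}" for t
      by (rule lagrangian_g[OF that])
    show pos: "(\<forall>t\<in>{0..1}. positive_of_phase M B (cotangent_bundle M) Omega0 \<theta> (graph_path M f t))
        \<longleftrightarrow> DSL_Re M (induced_metric M J0 omega0) \<theta> f"
      unfolding DSL_Re_iff using positive_iff by simp
    fix h :: "real \<Rightarrow> ('a, 'n) cotangent_point \<Rightarrow> real"
    assume h: "\<forall>t\<in>{0..1}. \<forall>p\<in>points M. h t (graph_path M f t p) = - time_deriv f t p"
    show "velocity_equation M (cotangent_bundle M) omega0 (graph_path M f) h"
      by (rule velocity_equation_g[OF h])
    assume "\<forall>t\<in>{0..1}. positive_of_phase M B (cotangent_bundle M) Omega0 \<theta> (graph_path M f t)"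
    then show "geodesic_equation M (cotangent_bundle M) Omega0 \<theta> (graph_path M f) h
        \<longleftrightarrow> DSL_Im M (induced_metric M J0 omega0) \<theta> f"
      using geodesic_iff[OF h] unfolding pos DSL_Re_iff by blast
  qed
qed

end
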